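(* Let $V_1,V_2$ and $\nu_1^\xi,\nu_2^\xi$ be as defined in the context. For every $p,q>0$ we have, for $x>0$, $$V_1(x)=\sqrt{q^2+4x}-p\log(4x)-q\log\left(\sqrt{q^2+4x}+q\right)-2p-q+p\log(4p^2+4pq)+q\log(2p+2q),$$ and $$V_2(x)=\begin{cases}0, & \text{for } x<-q^2/4,\\ -2\sqrt{q^2+4x}+q\log\left(\dfrac{q+\sqrt{q^2+4x}}{q-\sqrt{q^2+4x}}\right), & \text{for } -q^2/4\le x<0.\end{cases}$$ The densities of the measures $\nu_1^\xi$, $\nu_2^\xi$ ($\xi>0$) are given by $$\frac{d\nu_1^\xi}{dx}(x)=c\,\frac{z_{1+}(x,\xi)-z_{1-}(x,\xi)}{z_{1+}(x,\xi)\,z_{1-}(x,\xi)},\qquad x\in\operatorname{supp}(\nu_1^\xi),$$ $$\frac{d\nu_2^\xi}{dx}(x)=\begin{cases}c\,\dfrac{z_{2+}(x,\xi)-z_{2-}(x,\xi)}{z_{2+}(x,\xi)\,z_{2-}(x,\xi)\,x}, & x\in\operatorname{supp}(\nu_2^\xi)\text{ and }-q^2/4<x<0,\\[2ex] c\,\dfrac{z_{2+}(x,\xi)-z_{2-}(x,\xi)}{z_{2+}(x,\xi)\,z_{2-}(x,\xi)\,x}+\dfrac{\sqrt{|q^2+4x|}}{2\pi x}, & x\in\operatorname{supp}(\nu_2^\xi)\text{ and }x\le -q^2/4,\end{cases}$$ where $$c=\frac{\xi(\xi+p)(\xi+p+q)}{2\pi i}.$$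
   Context: Fix $p,q>0$. For $s>0$ let $$A_s(z)=z+b(s)+c(s)z^{-1}+d(s)z^{-2}=\frac{(z+s(s+p))(z+s(s+p+q))(z+(s+p)(s+p+q))}{z^2},$$ where $b(s)=3s^2+4sp+2sq+p^2+pq$, $c(s)=s(s+p)(s+p+q)(3s+2p+q)$, $d(s)=s^2(s+p)^2(s+p+q)^2$ (the function $c(s)$ is not the constant $c$ of the claim). For $x\in\mathbb C$ let $z_1(x,s),z_2(x,s),z_3(x,s)$ be the three solutions (with multiplicity) of $A_s(z)=x$, ordered so that $|z_1(x,s)|\ge|z_2(x,s)|\ge|z_3(x,s)|>0$. The external fields are $$V_1(x)=\int_0^\infty \log\left|\frac{z_1(x,s)}{z_2(x,s)}\right|ds,\qquad V_2(x)=\int_0^\infty \log\left|\frac{z_2(x,s)}{z_3(x,s)}\right|ds.$$ Put $$\Gamma_1(s)=\{x\in\mathbb C:\ |z_1(x,s)|=|z_2(x,s)|\},\qquad \Gamma_2(s)=\{x\in\mathbb C:\ |z_2(x,s)|=|z_3(x,s)|\}.$$ These sets are real: $\Gamma_1(s)\subset(0,\infty)$ is a compact interval and $\Gamma_2(s)\subset(-\infty,0)$ is a closed half-line unbounded to the left. For $x\in\Gamma_j(s)$, $z_{j\pm}(x,s)$ denotes the limit of $z_j(\tilde x,s)$ as $\tilde x\to x$ from the $\pm$ side of $\Gamma_j(s)$ (the $+$ side being the upper and the $-$ side the lower half-plane). For $j=1,2$ let $\mu_j^s$ be the positive measure on $\Gamma_j(s)$ with $$d\mu_j^s(x)=\frac{1}{2\pi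 i}\left(\frac{z_{j-}'(x,s)}{z_{j-}(x,s)}-\frac{z_{j+}'(x,s)}{z_{j+}(x,s)}\right)dx,$$ where $'$ is the derivative with respect to $x$. For $\xi>0$ define $\nu_j^\xi=\frac1\xi\int_0^\xi\mu_j^s\,ds$, $j=1,2$.
   Formalization: The printed densities fail by scaling (p,q,ξ→tp,tq,tξ; x→t²x) for ν_j^ξ defined as the average (1/ξ)∫_0^ξ μ_j^s ds; the proved dν_1^ξ/dx is the printed expression times 1/(ξx), and dν_2^ξ/dx is the printed two-case expression times 1/ξ. *)

theory Defs
  imports
    "HOL-Analysis.Analysis"
    "HOL-Computational_Algebra.Fundamental_Theorem_Algebra"
begin

section \<open>The symbol and its ordered solutions\<close>

definition A_sym :: "real \<Rightarrow> real \<Rightarrow> real \<Rightarrow> complex \<Rightarrow> complex" where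
  "A_sym p q s z =
     (z + of_real (s * (s + p))) * (z + of_real (s * (s + p + q)))
       * (z + of_real ((s + p) * (s + p + q))) / z ^ 2"

text \<open>
  For \<open>s, p, q > 0\<close> the solutions of \<open>A_sym p q s z = x\<close>, counted with multiplicity, are the
  roots of the cubic polynomial obtained by clearing the denominator \<open>z\<^sup>2\<close> (0 is not a root of it).
\<close>

definition A_poly :: "real \<Rightarrow> real \<Rightarrow> real \<Rightarrow> complex \<Rightarrow> complex poly" where
  "A_poly p q s x =
     [:of_real (s * (s + p)), 1:] * [:of_real (s * (s + p + q)), 1:]
       * [:of_real ((s + p) * (s + p + q)), 1:] - monom x 2"

text \<open>
  A list of the three solutions in order of decreasing modulus. The order, hence the list, is
  ambiguous exactly where two different solutions have equal modulus; there an arbitrary admissible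
  order is chosen.
\<close>

definition ordered_solutions :: "real \<Rightarrow> real \<Rightarrow> real \<Rightarrow> complex \<Rightarrow> complex list" where
  "ordered_solutions p q s x =
     (SOME zs. mset zs = proots (A_poly p q s x) \<and> sorted_wrt (\<lambda>u v. cmod u \<ge> cmod v) zs)"

definition zsol :: "real \<Rightarrow> real \<Rightarrow> nat \<Rightarrow> complex \<Rightarrow> real \<Rightarrow> complex" where
  "zsol p q j x s = ordered_solutions p q s x ! (j - 1)"

lemma A_sym_expand:
  assumes "z \<noteq> 0"
  shows "A_sym p q s z =
    z + of_real (3 * s^2 + 4 * s * p + 2 * s * q + p^2 + p * q)
      + of_real (s * (s + p) * (s + p + q) * (3 * s + 2 * p + q)) / z
      + of_real (s^2 * (s + p)^2 * (s + p + q)^2) / z^2"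
proof -
  have expand: "(z + of_real a1) * (z + of_real a2) * (z + of_real a3) / z^2 =
      z + of_real (a1 + a2 + a3) + of_real (a1 * a2 + a1 * a3 + a2 * a3) / z
        + of_real (a1 * a2 * a3) / z^2" for a1 a2 a3 :: real
    using assms by (simp add: field_simps power2_eq_square)
  define u v where "u = s + p" and "v = s + p + q"
  have b: "s * u + s * v + u * v = 3 * s^2 + 4 * s * p + 2 * s * q + p^2 + p * q"
    by (simp add: u_def v_def algebra_simps power2_eq_square)
  have sum: "3 * s + 2 * p + q = s + u + v"
    by (simp add: u_def v_def)
  have c: "s * u * (s * v) + s * u * (u * v) + s * v * (u * v) = s * u * v * (3 * s + 2 * p + q)"
    unfolding sum by (simp add: algebra_simps)
  have d: "s * u * (s * v) * (u * v) = s^2 * u^2 * v^2"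
    by (simp add: power2_eq_square)
  show ?thesis
    using expand[of "s * u" "s * v" "u * v"] unfolding b c d unfolding A_sym_def u_def v_def .
qed

lemma poly_A_poly:
  "poly (A_poly p q s x) z =
     (z + of_real (s * (s + p))) * (z + of_real (s * (s + p + q)))
       * (z + of_real ((s + p) * (s + p + q))) - x * z ^ 2"
proof -
  have 1: "poly [:a, 1:] z = z + a" for a :: complex
    by simp
  show ?thesis
    unfolding A_poly_def poly_diff poly_mult poly_monom 1 ..
qed

lemma A_poly_root_iff:
  assumes "p > 0" "q > 0" "s > 0"
  shows "poly (A_poly p q s x) z = 0 \<longleftrightarrow> z \<noteq> 0 \<and> A_sym p q s z = x"
proof (cases "z = 0")
  case True
  have "s * (s + p) > 0" "s * (s + p + q) > 0" "(s + p) * (s + p + q) > 0"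
    using assms by simp_all
  then have "s * (s + p) * (s * (s + p + q)) * ((s + p) * (s + p + q)) \<noteq> 0"
    by (metis mult_pos_pos less_irrefl)
  then have "complex_of_real (s * (s + p) * (s * (s + p + q)) * ((s + p) * (s + p + q))) \<noteq> 0"
    by (simp only: of_real_eq_0_iff not_False_eq_True)
  then show ?thesis
    using True by (simp add: poly_A_poly)
next
  case False
  then show ?thesis
    unfolding poly_A_poly A_sym_def by (simp add: divide_eq_eq)
qed

lemma degree_A_poly: "degree (A_poly p q s x) = 3"
  unfolding A_poly_def by (simp add: numeral_2_eq_2 monom_Suc monom_0)

lemma ordered_solutions_spec:
  shows "mset (ordered_solutions p q s x) = proots (A_poly p q s x)"
    and "sorted_wrt (\<lambda>u v. cmod u \<ge> cmod v) (ordered_solutions p q s x)"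
    and "length (ordered_solutions p q s x) = 3"
proof -
  obtain l where l: "mset l = proots (A_poly p q s x)"
    by (metis ex_mset)
  define zs where "zs = rev (sort_key cmod l)"
  have "mset zs = proots (A_poly p q s x)"
    using l by (simp add: zs_def)
  moreover have "sorted_wrt (\<lambda>u v. cmod u \<ge> cmod v) zs"
    using sorted_sort_key[of cmod l]
    unfolding zs_def by (simp add: sorted_wrt_rev sorted_map)
  ultimately have ex: "\<exists>zs. mset zs = proots (A_poly p q s x)
      \<and> sorted_wrt (\<lambda>u v. cmod u \<ge> cmod v) zs"
    by blast
  show *: "mset (ordered_solutions p q s x) = proots (A_poly p q s x)"
    and "sorted_wrt (\<lambda>u v. cmod u \<ge> cmod v) (ordered_solutions p q s x)"
    using someI_ex[OF ex] by (simp_all add: ordered_solutions_def)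
  show "length (ordered_solutions p q s x) = 3"
    using * by (metis size_mset size_proots_complex degree_A_poly)
qed


section \<open>External fields\<close>

definition V_integrand :: "real \<Rightarrow> real \<Rightarrow> nat \<Rightarrow> complex \<Rightarrow> real \<Rightarrow> real" where
  "V_integrand p q j x s = ln (cmod (zsol p q j x s / zsol p q (j + 1) x s))"

definition V_field :: "real \<Rightarrow> real \<Rightarrow> nat \<Rightarrow> complex \<Rightarrow> real" where
  "V_field p q j x = set_lebesgue_integral lborel {0<..} (V_integrand p q j x)"


section \<open>The measures\<close>

definition Gam :: "real \<Rightarrow> real \<Rightarrow> nat \<Rightarrow> real \<Rightarrow> complex set" where
  "Gam p q j s = {x. cmod (zsol p q j x s) = cmod (zsol p q (j + 1) x s)}"

definition z_plus :: "real \<Rightarrow> real \<Rightarrow> nat \<Rightarrow> real \<Rightarrow> real \<Rightarrow> complex" where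
  "z_plus p q j x s = Lim (at (complex_of_real x) within {w. Im w > 0}) (\<lambda>w. zsol p q j w s)"

definition z_minus :: "real \<Rightarrow> real \<Rightarrow> nat \<Rightarrow> real \<Rightarrow> real \<Rightarrow> complex" where
  "z_minus p q j x s = Lim (at (complex_of_real x) within {w. Im w < 0}) (\<lambda>w. zsol p q j w s)"

definition mu_dens :: "real \<Rightarrow> real \<Rightarrow> nat \<Rightarrow> real \<Rightarrow> real \<Rightarrow> complex" where
  "mu_dens p q j s x =
     1 / (2 * of_real pi * \<i>)
       * (vector_derivative (\<lambda>t. z_minus p q j t s) (at x) / z_minus p q j x s
          - vector_derivative (\<lambda>t. z_plus p q j t s) (at x) / z_plus p q j x s)"

text \<open>
  Since the sets \<open>Gam p q 1 s\<close> and \<open>Gam p q 2 s\<close> are contained in the real axis, the measures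
  living on them are represented as Borel measures on \<^typ>\<open>real\<close>. On these sets the two boundary
  values are complex conjugates of each other, so \<open>mu_dens\<close> is real there.
\<close>

definition mu :: "real \<Rightarrow> real \<Rightarrow> nat \<Rightarrow> real \<Rightarrow> real measure" where
  "mu p q j s =
     density lborel
       (\<lambda>x. ennreal (Re (mu_dens p q j s x)) * indicator {x. complex_of_real x \<in> Gam p q j s} x)"

definition nu :: "real \<Rightarrow> real \<Rightarrow> nat \<Rightarrow> real \<Rightarrow> real measure" where
  "nu p q j \<xi> =
     measure_of UNIV (sets borel)
       (\<lambda>B. ennreal (1 / \<xi>) * (\<integral>\<^sup>+ s \<in> {0<..<\<xi>}. emeasure (mu p q j s) B \<partial>lborel))"

definition supp :: "'a :: topological_space measure \<Rightarrow> 'a set" where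
  "supp M = {x. \<forall>U. open U \<longrightarrow> x \<in> U \<longrightarrow> emeasure M U > 0}"

text \<open>
  \<open>M\<close> is absolutely continuous with respect to Lebesgue measure, with a density that is given at
  each point of \<open>supp M\<close> by the (a priori complex-valued) expression \<open>f\<close>, and that vanishes outside.
\<close>

definition has_density_on_supp :: "real measure \<Rightarrow> (real \<Rightarrow> complex) \<Rightarrow> bool" where
  "has_density_on_supp M f \<longleftrightarrow>
     (\<exists>g \<in> borel_measurable borel.
        (\<forall>x. 0 \<le> g x) \<and> M = density lborel (\<lambda>x. ennreal (g x))
        \<and> (\<forall>x \<in> supp M. complex_of_real (g x) = f x) \<and> (\<forall>x. x \<notin> supp M \<longrightarrow> g x = 0))"

end

theory Submission
  imports Defs
begin

text \<open>
  Put \<open>h v = v (v + p) (v + p + q)\<close> and substitute \<open>z = h s / w\<close>, \<open>v = w + s\<close>. The equation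
  \<open>A_sym p q s z = x\<close> turns into \<open>h v = x (v - s)\<close>. Hence, for fixed \<open>x\<close>, the parameter
  \<open>s = v - h v / x\<close> is an explicit function of \<open>v\<close>, and \<open>w = h v / x\<close>. For real \<open>x \<noteq> 0\<close> one root
  is always real, and the other two form a pair that may be real for small \<open>s\<close> and is complex
  conjugate for large \<open>s\<close>. The external field is the integral of \<open>\<plusminus> ln \<bar>w\<bar>\<close> along the two real branches of the
  pair; these meet where the pair becomes complex, and an integration by parts in the variable \<open>v\<close>
  leaves an elementary function of the roots at \<open>s = 0\<close>. For the measures, differentiating
  \<open>h v = x (v - s)\<close> in both variables shows that the logarithmic derivative of \<open>z\<close> in \<open>x\<close> equals the
  derivative of \<open>v / x\<close> in \<open>s\<close>, so that averaging over \<open>s\<close> leaves boundary terms at \<open>s = \<xi>\<close> and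
  \<open>s = 0\<close> only; the latter is nonzero exactly for \<open>x < - q\<^sup>2 / 4\<close>.
\<close>

section \<open>The roots in the variable \<open>w\<close>\<close>

text \<open>The solutions are ordered by modulus alone, with an arbitrary choice at ties, and the
  ties are exactly the sets \<open>Gam\<close>. There the pair can only be handled as a multiset or
  through symmetric functions; its members are told apart by limits from a half-plane. The firm
  handle is the real root. On a suitable half-line the secant slopes of \<open>F x\<close> have a
  fixed sign and are bounded away from 0, so this root depends continuously on \<open>s\<close>, and
  its modulus is strictly separated from those of the pair. By Vieta the pair is then governed by
  its midpoint and one real quantity, \<open>pair_disc\<close>. The derivative of
  \<open>pair_disc\<close> in \<open>s\<close> is positive, because the displacement of the midpoint
  from the real root has the sign of \<open>x\<close>; hence a real pair becomes nonreal exactly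
  once and stays so. The same sign decides which member of a conjugate pair is the smaller one just
  off the axis. The threshold \<open>- q^2 / 4\<close> is where, for \<open>x < 0\<close>, the pair
  at \<open>s = 0\<close>, the roots of \<open>(v + p) (v + p + q) = x\<close>, changes from nonreal
  to real: its discriminant is \<open>q^2 + 4 x\<close>.\<close>

locale symbol_params =
  fixes p q :: real
  assumes p_pos: "p > 0" and q_pos: "q > 0"
begin

definition h :: "real \<Rightarrow> real" where
  "h v = v * (v + p) * (v + p + q)"

text \<open>This is \<open>h\<close> continued to complex arguments and taken at
  \<open>t + s\<close>, so that \<open>cubic s t = x * t\<close> is \<open>h v = x (v - s)\<close>
  with \<open>v = t + s\<close>.\<close>

definition cubic :: "real \<Rightarrow> complex \<Rightarrow> complex" where
  "cubic s t = (t + of_real s) * (t + of_real (s + p)) * (t + of_real (s + p + q))"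

text \<open>The substitution reverses the order of the moduli: \<open>wsol 1\<close> is the smallest root.\<close>

definition wsol :: "nat \<Rightarrow> complex \<Rightarrow> real \<Rightarrow> complex" where
  "wsol j x s = of_real (h s) / zsol p q j x s"

lemma h_pos: "s > 0 \<Longrightarrow> h s > 0"
  using p_pos q_pos by (simp add: h_def)

lemma ordered_solutions_eq:
  "ordered_solutions p q s x = [zsol p q 1 x s, zsol p q 2 x s, zsol p q 3 x s]"
proof -
  obtain a b c where "ordered_solutions p q s x = [a, b, c]"
    using ordered_solutions_spec(3)[of p q s x] by (auto simp: length_Suc_conv eval_nat_numeral)
  then show ?thesis
    by (simp add: zsol_def)
qed

lemma lead_coeff_A_poly: "lead_coeff (A_poly p q s x) = 1"
  unfolding degree_A_poly by (simp add: A_poly_def numeral_2_eq_2 numeral_3_eq_3 monom_Suc monom_0)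

lemma A_poly_factor:
  "A_poly p q s x = [:- zsol p q 1 x s, 1:] * [:- zsol p q 2 x s, 1:] * [:- zsol p q 3 x s, 1:]"
proof -
  have "proots (A_poly p q s x) = {#zsol p q 1 x s, zsol p q 2 x s, zsol p q 3 x s#}"
    using ordered_solutions_spec(1)[of p q s x] by (simp add: ordered_solutions_eq)
  then show ?thesis
    using complex_poly_decompose_multiset[of "A_poly p q s x"]
    unfolding lead_coeff_A_poly by (simp add: mult.assoc del: mult_pCons_left mult_pCons_right)
qed

lemma cubic_expand:
  "cubic s t = t^3 + of_real (3 * s + 2*p + q) * t^2
     + of_real (s*(s+p) + s*(s+p+q) + (s+p)*(s+p+q)) * t + of_real (h s)"
  by (simp add: cubic_def h_def power2_eq_square power3_eq_cube algebra_simps)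

lemma zsol_nonzero:
  assumes "s > 0" "j \<in> {1,2,3}"
  shows "zsol p q j x s \<noteq> 0"
proof -
  have "poly (A_poly p q s x) (zsol p q j x s) = 0"
    using assms(2) unfolding A_poly_factor poly_mult by auto
  then show ?thesis
    using A_poly_root_iff[OF p_pos q_pos assms(1)] by blast
qed

lemma wsol_nonzero: "s > 0 \<Longrightarrow> j \<in> {1,2,3} \<Longrightarrow> wsol j x s \<noteq> 0"
  using zsol_nonzero h_pos[of s] by (simp add: wsol_def)

lemma zsol_wsol: "s > 0 \<Longrightarrow> j \<in> {1,2,3} \<Longrightarrow> zsol p q j x s = of_real (h s) / wsol j x s"
  using zsol_nonzero h_pos[of s] by (simp add: wsol_def)

text \<open>The symmetric functions of the \<open>z\<close> are read off by evaluation at 0, 1 and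
  -1. Passing to reciprocals scaled by \<open>h s\<close> works because the product of the
  \<open>z\<close> is \<open>- (h s)^2\<close>, so the new polynomial has the constant term
  \<open>h s\<close>.\<close>

lemma wsol_factor:
  assumes s: "s > 0"
  shows "(t - wsol 1 x s) * (t - wsol 2 x s) * (t - wsol 3 x s) = cubic s t - x * t"
proof -
  define a b c where "a = zsol p q 1 x s" and "b = zsol p q 2 x s" and "c = zsol p q 3 x s"
  have nz: "a \<noteq> 0" "b \<noteq> 0" "c \<noteq> 0"
    using zsol_nonzero[OF s] by (auto simp: a_def b_def c_def)
  define A B C where "A = complex_of_real (s * (s + p))" and "B = complex_of_real (s * (s + p + q))"
    and "C = complex_of_real ((s + p) * (s + p + q))"
  have id: "(z - a) * (z - b) * (z - c) = (z + A) * (z + B) * (z + C) - x * z^2" for z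
    using poly_A_poly[of p q s x z]
    unfolding A_poly_factor a_def b_def c_def A_def B_def C_def poly_mult by simp
  have e3: "a * b * c = - (A * B * C)"
    using id[of 0] by (simp add: minus_equation_iff[of "a * b * c"] eq_commute)
  have "(1 - a) * (1 - b) * (1 - c) = (1 + A) * (1 + B) * (1 + C) - x"
    "(-1 - a) * (-1 - b) * (-1 - c) = (-1 + A) * (-1 + B) * (-1 + C) - x"
    using id[of 1] id[of "-1"] by simp_all
  then have e2: "a * b + a * c + b * c = A * B + A * C + B * C"
    and e1: "a + b + c = x - A - B - C"
    using e3 by algebra+
  define H where "H = complex_of_real (h s)"
  have H: "H \<noteq> 0" "H * H = A * B * C"
    using h_pos[OF s] by (simp_all add: H_def A_def B_def C_def) (simp add: h_def algebra_simps)
  have eH: "a * b * c = - (H * H)" using e3 H by simp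
  have s1: "H/a + H/b + H/c = - of_real (3 * s + 2*p + q)"
  proof -
    have "H/a + H/b + H/c = H * (a * b + a * c + b * c) / (a * b * c)"
      using nz by (simp add: field_simps)
    also have "\<dots> = - ((A * B + A * C + B * C) / H)"
      unfolding e2 eH using H(1) by (simp add: field_simps)
    also have "A * B + A * C + B * C = H * of_real (3 * s + 2*p + q)"
      by (simp add: H_def A_def B_def C_def h_def algebra_simps)
    finally show ?thesis using H(1) by simp
  qed
  have s3: "H/a * (H/b) * (H/c) = - H"
  proof -
    have "H/a * (H/b) * (H/c) = H * H * H / (a * b * c)" by simp
    then show ?thesis unfolding eH using H(1) by (simp add: field_simps)
  qed
  have s2: "H/a * (H/b) + H/a * (H/c) + H/b * (H/c)
       = of_real (s*(s+p) + s*(s+p+q) + (s+p)*(s+p+q)) - x"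
  proof -
    have "H/a * (H/b) + H/a * (H/c) + H/b * (H/c) = H * H * (a + b + c) / (a * b * c)"
      using nz by (simp add: field_simps)
    also have "\<dots> = A + B + C - x"
      unfolding e1 eH using H(1) by (simp add: field_simps)
    finally show ?thesis by (simp add: A_def B_def C_def)
  qed
  have "(t - X) * (t - Y) * (t - Z)
      = t^3 - (X + Y + Z) * t^2 + (X * Y + X * Z + Y * Z) * t - X * Y * Z" for X Y Z :: complex
    by (simp add: power2_eq_square power3_eq_cube algebra_simps)
  from this[of "H/a" "H/b" "H/c"] show ?thesis
    unfolding s1 s2 s3 cubic_expand
    by (simp add: wsol_def a_def b_def c_def H_def algebra_simps)
qed

lemma wsol_sorted:
  assumes s: "s > 0"
  shows "cmod (wsol 1 x s) \<le> cmod (wsol 2 x s)" "cmod (wsol 2 x s) \<le> cmod (wsol 3 x s)"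
proof -
  have "cmod (zsol p q 1 x s) \<ge> cmod (zsol p q 2 x s)" "cmod (zsol p q 2 x s) \<ge> cmod (zsol p q 3 x s)"
    using ordered_solutions_spec(2)[of p q s x] by (simp_all add: ordered_solutions_eq)
  then show "cmod (wsol 1 x s) \<le> cmod (wsol 2 x s)" "cmod (wsol 2 x s) \<le> cmod (wsol 3 x s)"
    using zsol_nonzero[OF s] h_pos[OF s] 
    by (auto simp: wsol_def norm_divide intro!: divide_left_mono)
qed

text \<open>The order of \<open>wsol\<close> involves a choice, so a factorisation determines the
  roots only as a multiset.\<close>

lemma wsol_mset:
  assumes s: "s > 0" and f: "\<And>t. (t - a) * (t - b) * (t - c) = cubic s t - x * t"
  shows "{#a, b, c#} = {#wsol 1 x s, wsol 2 x s, wsol 3 x s#}"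
proof -
  have "[:- a, 1:] * [:- b, 1:] * [:- c, 1:]
      = [:- wsol 1 x s, 1:] * [:- wsol 2 x s, 1:] * [:- wsol 3 x s, 1:]" (is "?l = ?r")
  proof -
    have "poly ?l = poly ?r"
    proof
      fix t
      have "poly ?l t = (t - a) * (t - b) * (t - c)" unfolding poly_mult by simp
      moreover have "poly ?r t = (t - wsol 1 x s) * (t - wsol 2 x s) * (t - wsol 3 x s)"
        unfolding poly_mult by simp
      ultimately show "poly ?l t = poly ?r t" using f wsol_factor[OF s] by simp
    qed
    then show ?thesis using poly_eq_poly_eq_iff by blast
  qed
  then have "proots ([:- a, 1:] * [:- b, 1:] * [:- c, 1:])
      = proots ([:- wsol 1 x s, 1:] * [:- wsol 2 x s, 1:] * [:- wsol 3 x s, 1:])"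
    by (rule arg_cong)
  then show ?thesis
    by (simp add: proots_mult del: mult_pCons_left mult_pCons_right)
       (simp add: ac_simps add_mset_commute)
qed

text \<open>The moduli are determined even at ties, since a multiset of reals has only one sorted
  list.\<close>

lemma wsol_cmod:
  assumes s: "s > 0" and f: "\<And>t. (t - a) * (t - b) * (t - c) = cubic s t - x * t"
    and "cmod a \<le> cmod b" "cmod b \<le> cmod c"
  shows "cmod (wsol 1 x s) = cmod a" "cmod (wsol 2 x s) = cmod b" "cmod (wsol 3 x s) = cmod c"
proof -
  have "image_mset cmod {#a, b, c#} = image_mset cmod {#wsol 1 x s, wsol 2 x s, wsol 3 x s#}"
    using wsol_mset[OF s f] by simp
  then have "mset [cmod a, cmod b, cmod c] = mset [cmod (wsol 1 x s), cmod (wsol 2 x s), cmod (wsol 3 x s)]"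
    by simp
  moreover have "sorted [cmod a, cmod b, cmod c]"
    "sorted [cmod (wsol 1 x s), cmod (wsol 2 x s), cmod (wsol 3 x s)]"
    using assms wsol_sorted[OF s] by (auto intro: order_trans)
  ultimately have "[cmod a, cmod b, cmod c] = [cmod (wsol 1 x s), cmod (wsol 2 x s), cmod (wsol 3 x s)]"
    by (metis properties_for_sort)
  then show "cmod (wsol 1 x s) = cmod a" "cmod (wsol 2 x s) = cmod b" "cmod (wsol 3 x s) = cmod c"
    by simp_all
qed

text \<open>A strict gap in modulus identifies the isolated root; the other two remain
  unordered.\<close>

lemma wsol_unique3:
  assumes s: "s > 0" and f: "\<And>t. (t - a) * (t - b) * (t - c) = cubic s t - x * t"
    and "cmod a \<le> cmod b" "cmod b < cmod c"
  shows "wsol 3 x s = c" "{#wsol 1 x s, wsol 2 x s#} = {#a, b#}"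
proof -
  note m = wsol_mset[OF s f] and n = wsol_cmod[OF s f assms(3) less_imp_le[OF assms(4)]]
  have "c \<in># {#wsol 1 x s, wsol 2 x s, wsol 3 x s#}"
    unfolding m[symmetric] by simp
  then show *: "wsol 3 x s = c" using n assms by auto
  show "{#wsol 1 x s, wsol 2 x s#} = {#a, b#}"
    using m * by (metis add_mset_add_single add_mset_commute add_right_cancel)
qed

lemma wsol_unique1:
  assumes s: "s > 0" and f: "\<And>t. (t - a) * (t - b) * (t - c) = cubic s t - x * t"
    and "cmod a < cmod b" "cmod b \<le> cmod c"
  shows "wsol 1 x s = a" "{#wsol 2 x s, wsol 3 x s#} = {#b, c#}"
proof -
  note m = wsol_mset[OF s f] and n = wsol_cmod[OF s f less_imp_le[OF assms(3)] assms(4)]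
  have "a \<in># {#wsol 1 x s, wsol 2 x s, wsol 3 x s#}"
    unfolding m[symmetric] by simp
  then show *: "wsol 1 x s = a" using n assms by auto
  show "{#wsol 2 x s, wsol 3 x s#} = {#b, c#}"
    using m * by simp
qed

section \<open>The real root and the remaining pair\<close>

definition F :: "real \<Rightarrow> real \<Rightarrow> real" where
  "F x v = v - h v / x"

text \<open>The divided difference of \<open>h\<close>. Working with secants instead of
  \<open>h'\<close> gives injectivity, Lipschitz continuity and the derivative of the inverse
  function from a single estimate.\<close>

definition h_quot :: "real \<Rightarrow> real \<Rightarrow> real" where
  "h_quot v u = v^2 + v * u + u^2 + (2 * p + q) * (v + u) + p * (p + q)"

definition sqrt_qx :: "real \<Rightarrow> real" where
  "sqrt_qx x = sqrt (q^2 + 4 * x)"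

definition end_zero :: "real \<Rightarrow> real" where
  "end_zero x = (- (2 * p + q) - sqrt_qx x) / 2"

text \<open>
  For \<open>x < 0\<close> and for \<open>x > 0\<close> this is the half-line that ends at the extreme zero of \<open>F x\<close> and on
  which \<open>F x\<close> runs monotonically through \<open>[0, \<infinity>)\<close>.
\<close>

definition real_branch :: "real \<Rightarrow> real set" where
  "real_branch x = (if x < 0 then {0..} else {..end_zero x})"

text \<open>A lower bound for \<open>h_quot v u - x\<close> on \<open>real_branch x\<close>. For
  \<open>x > 0\<close> it is the value at \<open>v = u = end_zero x\<close>; for
  \<open>x < 0\<close> the positive constant \<open>p (p + q)\<close> in the value at 0 is
  dropped.\<close>

definition branch_gap :: "real \<Rightarrow> real" where
  "branch_gap x = (if x < 0 then - x else - end_zero x * sqrt_qx x)"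

lemma h_diff: "h v - h u = (v - u) * h_quot v u"
  by (simp add: h_def h_quot_def power2_eq_square algebra_simps)

lemma sqrt_qx_gt: "x > 0 \<Longrightarrow> sqrt_qx x > q"
  unfolding sqrt_qx_def using q_pos by (intro real_less_rsqrt) simp

lemma e_less: "x > 0 \<Longrightarrow> end_zero x < - (p + q)"
  using sqrt_qx_gt[of x] by (simp add: end_zero_def)

lemma sqrt_qx_sq: "x > 0 \<Longrightarrow> (sqrt_qx x)\<^sup>2 = q^2 + 4 * x"
  by (simp add: sqrt_qx_def)

lemma e_eq: "x > 0 \<Longrightarrow> (end_zero x + p) * (end_zero x + p + q) = x"
proof -
  assume "x > 0"
  then have r: "(sqrt_qx x)\<^sup>2 = q^2 + 4 * x" by (rule sqrt_qx_sq)
  have "(end_zero x + p) * (end_zero x + p + q) = ((sqrt_qx x)\<^sup>2 - q^2) / 4"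
    by (simp add: end_zero_def field_simps power2_eq_square)
  then show ?thesis using r by simp
qed

lemma branch_gap_pos: "x \<noteq> 0 \<Longrightarrow> branch_gap x > 0"
  using e_less[of x] sqrt_qx_gt[of x] p_pos q_pos by (auto simp: branch_gap_def mult_neg_pos)

text \<open>For \<open>x < 0\<close> every term of \<open>h_quot\<close> is nonnegative. For
  \<open>x > 0\<close>, expanding around \<open>end_zero x\<close> in the distances \<open>a\<close>
  and \<open>b\<close> to it leaves only nonnegative coefficients, with constant term
  \<open>branch_gap x\<close>.\<close>

lemma h_quot_lower:
  assumes x: "x \<noteq> 0" and v: "v \<in> real_branch x" and u: "u \<in> real_branch x"
  shows "h_quot v u - x \<ge> branch_gap x"
proof (cases "x < 0")
  case True
  then have "v \<ge> 0" "u \<ge> 0" using v u by (auto simp: real_branch_def)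
  then have "h_quot v u \<ge> 0" unfolding h_quot_def using p_pos q_pos by simp
  then show ?thesis using True by (simp add: branch_gap_def)
next
  case False
  then have x0: "x > 0" using x by simp
  define a b where "a = end_zero x - v" and "b = end_zero x - u"
  have ab: "a \<ge> 0" "b \<ge> 0" using v u False by (auto simp: real_branch_def a_def b_def)
  define e where "e = end_zero x"
  have vu: "v = e - a" "u = e - b" by (auto simp: a_def b_def e_def)
  have e: "e < - (p + q)" using e_less[OF x0] by (simp add: e_def)
  have ex: "x = (e + p) * (e + p + q)" using e_eq[OF x0] by (simp add: e_def)
  have sqrt_qx: "sqrt_qx x = - (2 * e + 2 * p + q)" by (simp add: e_def end_zero_def field_simps)
  have "h_quot v u - x = - e * sqrt_qx x + (- (3 * e + 2 * p + q)) * (a + b) + (a^2 + a * b + b^2)"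
    unfolding sqrt_qx h_quot_def vu by (subst ex) (simp add: power2_eq_square algebra_simps)
  moreover have "- (3 * e + 2 * p + q) * (a + b) \<ge> 0"
    using e ab p_pos q_pos by (intro mult_nonneg_nonneg) auto
  moreover have "a^2 + a * b + b^2 \<ge> 0" using ab by simp
  ultimately show ?thesis using False by (simp add: branch_gap_def e_def)
qed

lemma F_diff: "x \<noteq> 0 \<Longrightarrow> F x v - F x u = - (v - u) * (h_quot v u - x) / x"
proof -
  assume x: "x \<noteq> 0"
  have "F x v - F x u = (v - u) - (h v - h u) / x"
    by (simp add: F_def diff_divide_distrib)
  also have "\<dots> = - (v - u) * (h_quot v u - x) / x"
    unfolding h_diff using x by (simp add: field_simps)
  finally show ?thesis .
qed

lemma h_cont [continuous_intros]: "continuous_on A f \<Longrightarrow> continuous_on A (\<lambda>x. h (f x))"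
  unfolding h_def by (intro continuous_intros)

lemma F_surj:
  assumes x: "x \<noteq> 0" and s: "s \<ge> 0"
  shows "\<exists>v\<in>real_branch x. F x v = s"
proof -
  \<comment> \<open>Secants of \<open>F x\<close> have slope at least
    \<open>branch_gap x / \<bar>x\<bar>\<close> in absolute value, so after this distance from the
    endpoint the value \<open>s\<close> has been reached.\<close>
  define t where "t = s * \<bar>x\<bar> / branch_gap x"
  have t: "t \<ge> 0" using s branch_gap_pos[OF x] by (simp add: t_def)
  have cont: "continuous_on A (F x)" for A
    unfolding F_def by (intro continuous_intros) (use x in auto)
  show ?thesis
  proof (cases "x < 0")
    case True
    have F0: "F x 0 = 0" by (simp add: F_def h_def)
    have "F x t - F x 0 = t * (h_quot t 0 - x) / - x" using F_diff[OF x, of t 0] by simp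
    also have "\<dots> \<ge> t * branch_gap x / - x"
      using h_quot_lower[OF x, of t 0] True t by (intro divide_right_mono mult_left_mono) (auto simp: real_branch_def)
    finally have "F x t \<ge> s" using True branch_gap_pos[OF x] F0 by (simp add: t_def)
    then have "\<exists>v\<ge>0. v \<le> t \<and> F x v = s"
      using F0 s t cont by (intro IVT') auto
    then show ?thesis using True by (auto simp: real_branch_def)
  next
    case False
    then have x0: "x > 0" using x by simp
    let ?e = "end_zero x"
    have "h ?e = ?e * ((?e + p) * (?e + p + q))" by (simp add: h_def)
    then have F0: "F x ?e = 0" unfolding e_eq[OF x0] using x by (simp add: F_def)
    have "F x (?e - t) - F x ?e = t * (h_quot (?e - t) ?e - x) / x"
      using F_diff[OF x, of "?e - t" ?e] by simp
    also have "\<dots> \<ge> t * branch_gap x / x"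
      using h_quot_lower[OF x, of "?e - t" ?e] False x0 t
      by (intro divide_right_mono mult_left_mono) (auto simp: real_branch_def)
    finally have "F x (?e - t) \<ge> s" using x0 branch_gap_pos[OF x] F0 by (simp add: t_def)
    then have "\<exists>v\<ge>?e - t. v \<le> ?e \<and> F x v = s"
      using F0 s t cont by (intro IVT2') auto
    then show ?thesis using False by (auto simp: real_branch_def)
  qed
qed

lemma F_inj:
  assumes "x \<noteq> 0" "v \<in> real_branch x" "u \<in> real_branch x" "F x v = F x u"
  shows "v = u"
  using F_diff[of x v u] h_quot_lower[of x v u] branch_gap_pos[of x] assms by auto

text \<open>Only meaningful for \<open>x \<noteq> 0\<close> and \<open>s \<ge> 0\<close>.\<close>

definition v_real :: "real \<Rightarrow> real \<Rightarrow> real" where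
  "v_real s x = (THE v. v \<in> real_branch x \<and> F x v = s)"

lemma v_real_F: "x \<noteq> 0 \<Longrightarrow> v \<in> real_branch x \<Longrightarrow> v_real (F x v) x = v"
  unfolding v_real_def using F_inj by blast

lemma v_real_spec:
  assumes "x \<noteq> 0" "s \<ge> 0"
  shows "v_real s x \<in> real_branch x" "F x (v_real s x) = s"
  using F_surj[OF assms] v_real_F[OF assms(1)] by auto

lemma v_real_diff:
  assumes "x \<noteq> 0" "s \<ge> 0" "t \<ge> 0"
  shows "v_real s x - v_real t x = - x * (s - t) / (h_quot (v_real s x) (v_real t x) - x)"
  using F_diff[OF assms(1), of "v_real s x" "v_real t x"] v_real_spec[OF assms(1,2)] v_real_spec[OF assms(1,3)]
    h_quot_lower[OF assms(1), of "v_real s x" "v_real t x"] branch_gap_pos[OF assms(1)] assms(1)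
  by (simp add: field_simps)

lemma v_real_continuous:
  assumes x: "x \<noteq> 0"
  shows "continuous_on {0..} (\<lambda>s. v_real s x)"
proof -
  have "(\<bar>x\<bar> / branch_gap x)-lipschitz_on {0..} (\<lambda>s. v_real s x)"
  proof (rule lipschitz_onI)
    fix s t :: real assume st: "s \<in> {0..}" "t \<in> {0..}"
    let ?Q = "h_quot (v_real s x) (v_real t x) - x"
    have Q: "?Q \<ge> branch_gap x" using st by (intro h_quot_lower x v_real_spec) auto
    have "\<bar>v_real s x - v_real t x\<bar> = \<bar>x\<bar> * \<bar>s - t\<bar> / \<bar>?Q\<bar>"
      using v_real_diff[OF x, of s t] st by (simp add: abs_mult)
    also have "\<dots> \<le> \<bar>x\<bar> * \<bar>s - t\<bar> / branch_gap x"
      using Q branch_gap_pos[OF x] by (intro divide_left_mono mult_pos_pos) auto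
    finally show "dist (v_real s x) (v_real t x) \<le> \<bar>x\<bar> / branch_gap x * dist s t"
      by (simp add: dist_real_def)
  qed (use branch_gap_pos[OF x] in auto)
  then show ?thesis by (rule lipschitz_on_continuous_on)
qed

text \<open>
  The roots \<open>w\<close> are \<open>w_real\<close> and \<open>pair_mid \<plusminus> \<i> sqrt pair_disc\<close>; \<open>pair_shift\<close> is \<open>pair_mid - w_real\<close>.
\<close>

definition pair_shift :: "real \<Rightarrow> real \<Rightarrow> real" where
  "pair_shift s x = - (3 * v_real s x + 2 * p + q) / 2"

text \<open>Minus a quarter of the discriminant of the quadratic
  \<open>h_quot v (v_real s x) - x\<close> in \<open>v\<close>, which remains after the real root is
  split off. Hence the pair is nonreal iff this is positive.\<close>

definition pair_disc :: "real \<Rightarrow> real \<Rightarrow> real" where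
  "pair_disc s x = p * (p + q) - x + (v_real s x + 2 * p + q) * (3 * v_real s x - 2 * p - q) / 4"

definition pair_mid :: "real \<Rightarrow> real \<Rightarrow> real" where
  "pair_mid s x = - (v_real s x + 2 * p + q) / 2 - s"

definition w_real :: "real \<Rightarrow> real \<Rightarrow> real" where
  "w_real s x = v_real s x - s"

lemma pair_shift_eq: "pair_shift s x = pair_mid s x - w_real s x"
  by (simp add: pair_shift_def pair_mid_def w_real_def field_simps)

text \<open>Both sides are the derivative of the cubic equation at its real root, that is, the
  product of the differences between this root and the two members of the pair.\<close>

lemma h_quot_pair_shift: "h_quot (v_real s x) (v_real s x) - x = (pair_shift s x)\<^sup>2 + pair_disc s x"
  by (simp add: h_quot_def pair_shift_def pair_disc_def power2_eq_square field_simps)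

lemma v_real_neg: "x < 0 \<Longrightarrow> s \<ge> 0 \<Longrightarrow> v_real s x \<ge> 0"
  and v_real_pos: "x > 0 \<Longrightarrow> s \<ge> 0 \<Longrightarrow> v_real s x \<le> end_zero x"
  using v_real_spec(1)[of x s] by (auto simp: real_branch_def)

text \<open>This sign makes \<open>pair_disc\<close> increase with \<open>s\<close>, makes the
  densities positive, and settles the order of the pair off the real axis.\<close>

lemma pair_shift_sgn: "x \<noteq> 0 \<Longrightarrow> s \<ge> 0 \<Longrightarrow> x * pair_shift s x > 0"
proof -
  assume x: "x \<noteq> 0" and s: "s \<ge> 0"
  show ?thesis
  proof (cases "x < 0")
    case True
    then have "pair_shift s x < 0" using v_real_neg[OF True s] p_pos q_pos by (simp add: pair_shift_def)
    then show ?thesis using True by (simp add: mult_neg_neg)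
  next
    case False
    then have "pair_shift s x > 0" using v_real_pos[OF _ s, of x] e_less[of x] p_pos q_pos x by (simp add: pair_shift_def)
    then show ?thesis using False x by simp
  qed
qed

lemma pair_shift_pair_disc_pos:
  assumes "x \<noteq> 0" "s \<ge> 0"
  shows "(pair_shift s x)\<^sup>2 + pair_disc s x > 0"
  using h_quot_lower[OF assms(1) v_real_spec(1)[OF assms] v_real_spec(1)[OF assms]] branch_gap_pos[OF assms(1)]
  by (simp add: h_quot_pair_shift)

text \<open>The secant formula \<open>v_real_diff\<close> is exact, so the derivative is its limit
  by continuity alone.\<close>

lemma v_real_deriv:
  assumes x: "x \<noteq> 0" and s: "s > 0"
  shows "((\<lambda>s. v_real s x) has_real_derivative (- x / ((pair_shift s x)\<^sup>2 + pair_disc s x))) (at s)"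
proof -
  have c: "isCont (\<lambda>s. v_real s x) s"
    using continuous_on_interior[OF v_real_continuous[OF x], of s] s by simp
  have ne: "h_quot (v_real s x) (v_real s x) - x \<noteq> 0"
    unfolding h_quot_pair_shift using pair_shift_pair_disc_pos[OF x, of s] s by simp
  have c2: "isCont (\<lambda>t. - x / (h_quot (v_real t x) (v_real s x) - x)) s"
    using c ne unfolding h_quot_def by (intro continuous_intros) auto
  have "((\<lambda>t. - x / (h_quot (v_real t x) (v_real s x) - x)) \<longlongrightarrow> - x / ((pair_shift s x)\<^sup>2 + pair_disc s x)) (at s)"
    using c2 by (simp add: isCont_def h_quot_pair_shift)
  moreover have "eventually (\<lambda>t. - x / (h_quot (v_real t x) (v_real s x) - x) = (v_real t x - v_real s x) / (t - s)) (at s)"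
  proof -
    have "eventually (\<lambda>t. t > 0) (at s)"
      using s by (intro order_tendstoD(1)[OF tendsto_ident_at])
    moreover have "eventually (\<lambda>t. t \<noteq> s) (at s)" by (simp add: eventually_at_filter)
    ultimately show ?thesis
    proof eventually_elim
      case (elim t)
      have "h_quot (v_real t x) (v_real s x) - x > 0"
        using h_quot_lower[OF x v_real_spec(1)[OF x] v_real_spec(1)[OF x], of t s] branch_gap_pos[OF x] elim s by simp
      then show ?case using v_real_diff[OF x, of t s] elim s by simp
    qed
  qed
  ultimately show ?thesis
    unfolding has_field_derivative_iff by (rule Lim_transform_eventually)
qed

lemma h_v_real: "x \<noteq> 0 \<Longrightarrow> s \<ge> 0 \<Longrightarrow> h (v_real s x) = x * (v_real s x - s)"
  using v_real_spec(2)[of x s] by (simp add: F_def field_simps)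

lemma w_real_prod:
  assumes "x \<noteq> 0" "s \<ge> 0"
  shows "w_real s x * ((pair_mid s x)\<^sup>2 + pair_disc s x) = - h s"
proof -
  have "(pair_mid s x)\<^sup>2 + pair_disc s x = h_quot (v_real s x) s - x"
    by (simp add: pair_mid_def pair_disc_def h_quot_def power2_eq_square field_simps)
  then have "w_real s x * ((pair_mid s x)\<^sup>2 + pair_disc s x) = (h (v_real s x) - h s) - x * (v_real s x - s)"
    unfolding h_diff w_real_def by (simp add: right_diff_distrib mult.commute)
  then show ?thesis
    using h_v_real[OF assms] by simp
qed

lemma real_factor:
  assumes "x \<noteq> 0" "s \<ge> 0"
  shows "(t - of_real (w_real s x)) * ((t - of_real (pair_mid s x))\<^sup>2 + of_real (pair_disc s x)) = cubic s t - of_real x * t"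
proof -
  have e1: "w_real s x + 2 * pair_mid s x = - (3 * s + 2 * p + q)"
    by (simp add: w_real_def pair_mid_def field_simps)
  have e2: "2 * pair_mid s x * w_real s x + (pair_mid s x)\<^sup>2 + pair_disc s x = s * (s+p) + s * (s+p+q) + (s+p) * (s+p+q) - x"
    by (simp add: w_real_def pair_mid_def pair_disc_def power2_eq_square field_simps)
  have "(t - of_real (w_real s x)) * ((t - of_real (pair_mid s x))\<^sup>2 + of_real (pair_disc s x)) =
     t^3 - of_real (w_real s x + 2 * pair_mid s x) * t^2 + of_real (2 * pair_mid s x * w_real s x + (pair_mid s x)\<^sup>2 + pair_disc s x) * t
     - of_real (w_real s x * ((pair_mid s x)\<^sup>2 + pair_disc s x))"
    by (simp add: power2_eq_square power3_eq_cube algebra_simps)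
  then show ?thesis
    unfolding e1 e2 w_real_prod[OF assms] cubic_expand by (simp add: algebra_simps)
qed

lemma w_real_neg:
  assumes x: "x \<noteq> 0" and s: "s > 0"
  shows "w_real s x < 0"
proof (cases "x < 0")
  case True
  have v: "v_real s x \<ge> 0" using v_real_neg True s by simp
  have "v_real s x \<noteq> 0" using h_v_real[OF x, of s] s x by (auto simp: h_def)
  then have "h (v_real s x) > 0" using v h_pos by simp
  then show ?thesis using h_v_real[OF x, of s] s True by (simp add: w_real_def zero_less_mult_iff)
next
  case False
  then show ?thesis using v_real_pos[of x s] e_less[of x] p_pos q_pos x s by (simp add: w_real_def)
qed

lemma pair_mid_pair_disc_pos:
  assumes "x \<noteq> 0" "s > 0"
  shows "(pair_mid s x)\<^sup>2 + pair_disc s x > 0"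
proof -
  have "w_real s x * ((pair_mid s x)\<^sup>2 + pair_disc s x) < 0"
    using w_real_prod[of x s] h_pos[of s] assms by simp
  then show ?thesis
    using w_real_neg[OF assms] by (simp add: mult_less_0_iff)
qed

lemma F_factor_pos:
  assumes x: "x > 0"
  shows "F x u = - (u * (u - end_zero x) * (u - (sqrt_qx x - (2 * p + q)) / 2)) / x"
proof -
  have "(u - end_zero x) * (u - (sqrt_qx x - (2 * p + q)) / 2) = ((2 * u + 2 * p + q)\<^sup>2 - (sqrt_qx x)\<^sup>2) / 4"
    by (simp add: end_zero_def field_simps power2_eq_square)
  also have "\<dots> = (u + p) * (u + p + q) - x"
    unfolding sqrt_qx_sq[OF x] by (simp add: field_simps power2_eq_square)
  finally have "u * (u - end_zero x) * (u - (sqrt_qx x - (2 * p + q)) / 2) = u * ((u + p) * (u + p + q) - x)"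
    unfolding mult.assoc by (rule arg_cong)
  also have "\<dots> = h u - u * x"
    by (simp add: h_def algebra_simps)
  finally have "u * (u - end_zero x) * (u - (sqrt_qx x - (2 * p + q)) / 2) = h u - u * x" .
  then show ?thesis
    unfolding F_def using x by (simp only:) (simp add: field_simps)
qed

section \<open>Comparison of the moduli of the pair and of the real root\<close>

text \<open>The product of the three roots is \<open>- h s\<close>. For \<open>x > 0\<close> the
  real root has modulus above \<open>s + p + q\<close>, the largest factor of \<open>h s\<close>;
  for \<open>x < 0\<close> it is at most \<open>s\<close>, the smallest. The product of the pair
  then lies on the other side. For a conjugate pair this product is the squared modulus.\<close>

lemma pair_complex:
  assumes x: "x \<noteq> 0" and s: "s > 0"
  shows "x > 0 \<Longrightarrow> (pair_mid s x)\<^sup>2 + pair_disc s x < (w_real s x)\<^sup>2"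
    and "x < 0 \<Longrightarrow> (pair_mid s x)\<^sup>2 + pair_disc s x > (w_real s x)\<^sup>2"
proof -
  define w where "w = - w_real s x"
  define P where "P = (pair_mid s x)\<^sup>2 + pair_disc s x"
  have w: "w > 0" using w_real_neg[OF x s] by (simp add: w_def)
  have P: "w * P = s * (s + p) * (s + p + q)" using w_real_prod[OF x, of s] s by (simp add: w_def P_def h_def)
  { assume "x > 0"
    then have l: "w > s + p + q" using v_real_pos[of x s] e_less[of x] s by (simp add: w_def w_real_def)
    have "w * P < s * (s + p) * w"
      unfolding P using l s p_pos by (intro mult_strict_left_mono) auto
    then have "P < s * (s + p)" using w by (simp add: mult.commute)
    also have "\<dots> \<le> w * w" using l s p_pos q_pos by (intro mult_mono) auto
    finally show "(pair_mid s x)\<^sup>2 + pair_disc s x < (w_real s x)\<^sup>2" by (simp add: P_def w_def power2_eq_square) }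
  { assume "x < 0"
    then have l: "w \<le> s" using v_real_neg[of x s] s by (simp add: w_def w_real_def)
    have "w * (w * w) \<le> s * (s * s)" using l w s by (intro mult_mono) auto
    also have "\<dots> < s * ((s + p) * (s + p + q))" using s p_pos q_pos
      by (intro mult_strict_left_mono mult_strict_mono) auto
    also have "\<dots> = w * P" using P by (simp add: mult.assoc)
    finally have "w * w < P" using w by simp
    then show "(pair_mid s x)\<^sup>2 + pair_disc s x > (w_real s x)\<^sup>2" by (simp add: P_def w_def power2_eq_square) }
qed

text \<open>A real member of the pair, shifted by \<open>s\<close>, is a zero of
  \<open>h_quot (v_real s x) v - x\<close>, which is positive throughout the branch.\<close>

lemma real_pair_root:
  assumes x: "x \<noteq> 0" and s: "s \<ge> 0" and D: "(a - pair_mid s x)\<^sup>2 = - pair_disc s x"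
  shows "F x (a + s) = s" "a + s \<notin> real_branch x"
proof -
  define v where "v = v_real s x"
  have Q: "h_quot v (a + s) = x"
  proof -
    have "4 * (h_quot v (a + s) - x) = 4 * ((a - pair_mid s x)\<^sup>2 + pair_disc s x)"
      by (simp add: h_quot_def pair_mid_def pair_disc_def v_def[symmetric] power2_eq_square field_simps)
    then show ?thesis using D by simp
  qed
  then show "F x (a + s) = s"
    using F_diff[OF x, of v "a + s"] v_real_spec(2)[OF x s] by (simp add: v_def)
  show "a + s \<notin> real_branch x"
    using h_quot_lower[OF x v_real_spec(1)[OF x s], of "a + s"] Q branch_gap_pos[OF x] by (auto simp: v_def)
qed

text \<open>For a real pair the product does not control the single moduli, so the sign of
  \<open>F x\<close> locates each member. For \<open>x > 0\<close> it lies beyond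
  \<open>end_zero x\<close>, where \<open>F x\<close> is positive only strictly between its other
  two zeros, 0 and \<open>a0\<close>. For \<open>x < 0\<close> it lies left of \<open>- s\<close>,
  while the real root is at least \<open>- s\<close>.\<close>

lemma pair_real:
  assumes x: "x \<noteq> 0" and s: "s > 0" and D: "(a - pair_mid s x)\<^sup>2 = - pair_disc s x"
  shows "x > 0 \<Longrightarrow> \<bar>a\<bar> < - w_real s x"
    and "x < 0 \<Longrightarrow> \<bar>a\<bar> > - w_real s x"
proof -
  note r = real_pair_root[OF x _ D]
  { assume x: "x > 0"
    define a0 where "a0 = (sqrt_qx x - (2 * p + q)) / 2"
    have ge: "a + s > end_zero x" using r(2) x s by (simp add: real_branch_def)
    have "a0 > - p" using sqrt_qx_gt[OF x] by (simp add: a0_def)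
    have a0e: "end_zero x = - a0 - (2 * p + q)" by (simp add: a0_def end_zero_def field_simps)
    have "- ((a + s) * (a + s - end_zero x) * (a + s - a0)) / x > 0"
      using r(1) F_factor_pos[OF x, of "a + s"] s by (simp add: a0_def)
    then have "(a + s) * (a + s - end_zero x) * (a + s - a0) < 0"
      using x by (simp add: divide_less_0_iff)
    then have "(a + s) * (a + s - a0) < 0"
      using ge by (simp add: mult_less_0_iff zero_less_mult_iff)
    then have "(a + s > 0 \<and> a + s < a0) \<or> (a + s < 0 \<and> a + s > a0)"
      by (auto simp: mult_less_0_iff)
    moreover have "- w_real s x \<ge> s - end_zero x" using v_real_pos[OF x, of s] s by (simp add: w_real_def)
    ultimately show "\<bar>a\<bar> < - w_real s x" using \<open>a0 > - p\<close> a0e s p_pos q_pos by linarith }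
  { assume x: "x < 0"
    then have "a + s < 0" using r(2) s by (simp add: real_branch_def)
    then show "\<bar>a\<bar> > - w_real s x" using v_real_neg[OF x, of s] s by (simp add: w_real_def) }
qed

lemma mset_pair_eq_iff: "{#a, b#} = {#c, d#} \<longleftrightarrow> (a = c \<and> b = d) \<or> (a = d \<and> b = c)"
  by (auto simp: add_eq_conv_ex)

section \<open>The pair at \<open>s = 0\<close> and the monotonicity of
  \<open>pair_disc\<close>\<close>

definition branch_end :: "real \<Rightarrow> real" where
  "branch_end x = (if x < 0 then 0 else end_zero x)"

lemma branch_end_in: "branch_end x \<in> real_branch x"
  by (simp add: branch_end_def real_branch_def)

lemma F_branch_end: "x \<noteq> 0 \<Longrightarrow> F x (branch_end x) = 0"
proof -
  assume x: "x \<noteq> 0"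
  show ?thesis
  proof (cases "x < 0")
    case False
    then have x0: "x > 0" using x by simp
    have "h (end_zero x) = end_zero x * ((end_zero x + p) * (end_zero x + p + q))" by (simp add: h_def)
    then show ?thesis unfolding e_eq[OF x0] using False x by (simp add: F_def branch_end_def)
  qed (simp add: branch_end_def F_def h_def)
qed

lemma v_real_zero: "x \<noteq> 0 \<Longrightarrow> v_real 0 x = branch_end x"
  using v_real_F[OF _ branch_end_in, of x] F_branch_end[of x] by simp

lemma F_nonneg: "x \<noteq> 0 \<Longrightarrow> v \<in> real_branch x \<Longrightarrow> F x v \<ge> 0"
proof -
  assume x: "x \<noteq> 0" and v: "v \<in> real_branch x"
  have "F x v = - (v - branch_end x) * (h_quot v (branch_end x) - x) / x"
    using F_diff[OF x, of v "branch_end x"] F_branch_end[OF x] by simp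
  moreover have "h_quot v (branch_end x) - x > 0"
    using h_quot_lower[OF x v branch_end_in] branch_gap_pos[OF x] by simp
  moreover have "(v - branch_end x) * x \<le> 0"
    using v x by (auto simp: real_branch_def branch_end_def mult_le_0_iff split: if_splits)
  ultimately show ?thesis
    using x by (auto simp: mult_le_0_iff divide_le_0_iff zero_le_divide_iff zero_le_mult_iff)
qed

text \<open>At \<open>s = 0\<close> the equation is \<open>h v = x v\<close>. For
  \<open>x < 0\<close> the real root is 0 and the pair solves
  \<open>(v + p) (v + p + q) = x\<close>; for \<open>x > 0\<close> the real root is
  \<open>end_zero x\<close> and the pair consists of 0 and the other solution of that quadratic, so
  it is always real.\<close>

lemma pair_disc_zero: "x < 0 \<Longrightarrow> pair_disc 0 x = - (q^2 + 4 * x) / 4"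
  "x > 0 \<Longrightarrow> pair_disc 0 x = - ((sqrt_qx x - (2 * p + q)) / 4)\<^sup>2"
proof -
  show "x < 0 \<Longrightarrow> pair_disc 0 x = - (q^2 + 4 * x) / 4"
    by (simp add: pair_disc_def v_real_zero branch_end_def power2_eq_square field_simps)
  assume x: "x > 0"
  define r where "r = sqrt_qx x"
  have xr: "x = (r\<^sup>2 - q\<^sup>2) / 4" using sqrt_qx_sq[OF x] by (simp add: r_def)
  have e: "end_zero x = (- (2 * p + q) - r) / 2" by (simp add: end_zero_def r_def)
  have "pair_disc 0 x = p * (p + q) - x + (end_zero x + 2 * p + q) * (3 * end_zero x - 2 * p - q) / 4"
    using x by (simp add: pair_disc_def v_real_zero branch_end_def)
  also have "\<dots> = - ((r - (2 * p + q)) / 4)\<^sup>2"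
    unfolding e by (subst xr) (simp add: power2_eq_square field_simps)
  finally show "pair_disc 0 x = - ((sqrt_qx x - (2 * p + q)) / 4)\<^sup>2" by (simp add: r_def)
qed

lemma pair_disc_continuous:
  assumes x: "x \<noteq> 0" shows "continuous_on {0..} (\<lambda>s. pair_disc s x)"
  unfolding pair_disc_def by (intro continuous_intros v_real_continuous x) auto

lemma pair_disc_deriv:
  assumes x: "x \<noteq> 0" and s: "s > 0"
  shows "((\<lambda>s. pair_disc s x) has_real_derivative (x * pair_shift s x / ((pair_shift s x)\<^sup>2 + pair_disc s x))) (at s)"
proof -
  define E where "E = (pair_shift s x)\<^sup>2 + pair_disc s x"
  have E: "E \<noteq> 0" using pair_shift_pair_disc_pos[OF x, of s] s by (simp add: E_def)
  note [derivative_intros] = v_real_deriv[OF x s]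
  have "((\<lambda>s. pair_disc s x) has_real_derivative
     ((- x / E) * (3 * v_real s x - 2 * p - q) + (v_real s x + 2 * p + q) * (3 * (- x / E))) / 4) (at s)"
    unfolding pair_disc_def E_def[symmetric]
    by (rule derivative_eq_intros refl | simp add: E_def mult.commute)+
  also have "((- x / E) * (3 * v_real s x - 2 * p - q) + (v_real s x + 2 * p + q) * (3 * (- x / E))) / 4 = x * pair_shift s x / E"
    using E by (simp add: pair_shift_def field_simps)
  finally show ?thesis by (simp add: E_def)
qed

text \<open>Strict growth means that along \<open>s\<close> the pair can pass from real to nonreal
  only once and never back.\<close>

lemma pair_disc_less:
  assumes x: "x \<noteq> 0" and st: "0 \<le> s" "s < t"
  shows "pair_disc s x < pair_disc t x"
proof (rule DERIV_pos_imp_increasing_open[OF st(2)])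
  fix u assume u: "s < u" "u < t"
  show "\<exists>y. ((\<lambda>s. pair_disc s x) has_real_derivative y) (at u) \<and> y > 0"
  proof (intro exI conjI)
    show "((\<lambda>s. pair_disc s x) has_real_derivative (x * pair_shift u x / ((pair_shift u x)\<^sup>2 + pair_disc u x))) (at u)"
      using pair_disc_deriv[OF x, of u] u st by simp
    show "x * pair_shift u x / ((pair_shift u x)\<^sup>2 + pair_disc u x) > 0"
      using pair_shift_sgn[OF x, of u] pair_shift_pair_disc_pos[OF x, of u] u st by simp
  qed
qed (use st in \<open>auto intro: continuous_on_subset[OF pair_disc_continuous[OF x]]\<close>)

lemma pair_disc_zero_exists:
  assumes x: "x \<noteq> 0" and D: "pair_disc 0 x < 0"
  shows "\<exists>S>0. pair_disc S x = 0"
proof -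
  \<comment> \<open>Points of the branch at which the formula for \<open>pair_disc\<close> is
    visibly nonnegative. For \<open>x < 0\<close> the product of the two linear factors becomes a
    square; for \<open>x > 0\<close> it is at least \<open>3 (x + 1)^2\<close>, which exceeds
    \<open>4 x\<close>. The parameter belonging to \<open>v\<close> is \<open>F x v\<close>.\<close>
  define v where "v = (if x < 0 then 2 * p + q else min (end_zero x) (- (2 * p + q) - x - 1))"
  have v: "v \<in> real_branch x" using p_pos q_pos by (simp add: real_branch_def v_def)
  have D2: "p * (p + q) - x + (v + 2 * p + q) * (3 * v - 2 * p - q) / 4 \<ge> 0"
  proof (cases "x < 0")
    case True
    then have "(v + 2 * p + q) * (3 * v - 2 * p - q) = (2 * v) * (2 * v)"
      by (simp add: v_def algebra_simps)
    moreover have "p * (p + q) > 0" using p_pos q_pos by simp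
    ultimately show ?thesis using True by simp
  next
    case False
    then have vl: "v \<le> - (2 * p + q) - x - 1" and x0: "x > 0" using x by (auto simp: v_def)
    have "(x + 1) * (3 * (x + 1)) \<le> (- (v + 2 * p + q)) * (- (3 * v - 2 * p - q))"
      using vl x0 p_pos q_pos by (intro mult_mono) auto
    moreover have "4 * x \<le> (x + 1) * (3 * (x + 1))" using x0 by (simp add: algebra_simps)
    moreover have "p * (p + q) > 0" using p_pos q_pos by simp
    moreover have "(- (v + 2 * p + q)) * (- (3 * v - 2 * p - q)) = (v + 2 * p + q) * (3 * v - 2 * p - q)"
      by (rule minus_mult_minus)
    ultimately show ?thesis by linarith
  qed
  define T where "T = F x v"
  have T: "T \<ge> 0" using F_nonneg[OF x v] by (simp add: T_def)
  have DT: "pair_disc T x \<ge> 0" using D2 unfolding pair_disc_def T_def v_real_F[OF x v] .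
  have "\<exists>S\<ge>0. S \<le> T \<and> pair_disc S x = 0"
    using T D DT by (intro IVT' continuous_on_subset[OF pair_disc_continuous[OF x]]) auto
  then show ?thesis using D by (metis less_eq_real_def less_irrefl)
qed

text \<open>The complex square root lets one factorisation serve both real and conjugate
  pairs.\<close>

definition pair_sqrt :: "real \<Rightarrow> real \<Rightarrow> complex" where
  "pair_sqrt s x = csqrt (of_real (- pair_disc s x))"

lemma pair_sqrt_nonneg: "pair_disc s x \<ge> 0 \<Longrightarrow> pair_sqrt s x = \<i> * of_real (sqrt (pair_disc s x))"
  unfolding pair_sqrt_def by (subst csqrt_of_real_nonpos) auto

lemma pair_sqrt_neg: "pair_disc s x \<le> 0 \<Longrightarrow> pair_sqrt s x = of_real (sqrt (- pair_disc s x))"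
  unfolding pair_sqrt_def by (subst csqrt_of_real_nonneg) auto

lemma pair_factor:
  assumes "x \<noteq> 0" "s > 0"
  shows "(t - of_real (w_real s x)) * (t - (of_real (pair_mid s x) + pair_sqrt s x)) * (t - (of_real (pair_mid s x) - pair_sqrt s x))
    = cubic s t - of_real x * t"
proof -
  have "pair_sqrt s x ^ 2 = of_real (- pair_disc s x)" by (simp add: pair_sqrt_def)
  then have "(t - (of_real (pair_mid s x) + pair_sqrt s x)) * (t - (of_real (pair_mid s x) - pair_sqrt s x))
      = (t - of_real (pair_mid s x))\<^sup>2 + of_real (pair_disc s x)"
    by (simp add: power2_eq_square algebra_simps)
  then show ?thesis
    using real_factor[of x s t] assms by (simp add: mult.assoc)
qed

lemma pair_cmod_nonneg:
  assumes "pair_disc s x \<ge> 0"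
  shows "cmod (of_real (pair_mid s x) + pair_sqrt s x) = sqrt ((pair_mid s x)\<^sup>2 + pair_disc s x)"
    "cmod (of_real (pair_mid s x) - pair_sqrt s x) = sqrt ((pair_mid s x)\<^sup>2 + pair_disc s x)"
  using assms by (simp_all add: pair_sqrt_nonneg cmod_def)

lemma pair_cmod_neg:
  assumes "pair_disc s x \<le> 0"
  shows "cmod (of_real (pair_mid s x) + pair_sqrt s x) = \<bar>pair_mid s x + sqrt (- pair_disc s x)\<bar>"
    "cmod (of_real (pair_mid s x) - pair_sqrt s x) = \<bar>pair_mid s x - sqrt (- pair_disc s x)\<bar>"
  unfolding pair_sqrt_neg[OF assms] by (metis norm_of_real of_real_add of_real_diff)+

lemma pair_cmod:
  assumes x: "x \<noteq> 0" and s: "s > 0"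
  shows "x > 0 \<Longrightarrow> cmod (of_real (pair_mid s x) + pair_sqrt s x) < - w_real s x"
    and "x > 0 \<Longrightarrow> cmod (of_real (pair_mid s x) - pair_sqrt s x) < - w_real s x"
    and "x < 0 \<Longrightarrow> cmod (of_real (pair_mid s x) + pair_sqrt s x) > - w_real s x"
    and "x < 0 \<Longrightarrow> cmod (of_real (pair_mid s x) - pair_sqrt s x) > - w_real s x"
proof -
  let ?r = "sqrt ((pair_mid s x)\<^sup>2 + pair_disc s x)" and ?d = "sqrt (- pair_disc s x)"
  have wn: "w_real s x < 0" using w_real_neg[OF x s] .
  have 1: "x > 0 \<Longrightarrow> ?r < - w_real s x"
    using pair_complex(1)[OF x s] wn by (intro real_less_lsqrt) auto
  have 2: "x < 0 \<Longrightarrow> ?r > - w_real s x"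
    using pair_complex(2)[OF x s] wn by (intro real_less_rsqrt) auto
  have D: "(pair_mid s x + ?d - pair_mid s x)\<^sup>2 = - pair_disc s x" "(pair_mid s x - ?d - pair_mid s x)\<^sup>2 = - pair_disc s x"
    if "pair_disc s x \<le> 0" using that by simp_all
  note 3 = pair_real[OF x s D(1)] pair_real[OF x s D(2)]
  show "x > 0 \<Longrightarrow> cmod (of_real (pair_mid s x) + pair_sqrt s x) < - w_real s x"
    "x > 0 \<Longrightarrow> cmod (of_real (pair_mid s x) - pair_sqrt s x) < - w_real s x"
    "x < 0 \<Longrightarrow> cmod (of_real (pair_mid s x) + pair_sqrt s x) > - w_real s x"
    "x < 0 \<Longrightarrow> cmod (of_real (pair_mid s x) - pair_sqrt s x) > - w_real s x"
    using 1 2 3 pair_cmod_nonneg[of s x] pair_cmod_neg[of s x] by (cases "pair_disc s x \<ge> 0"; simp)+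
qed

text \<open>
  For \<open>x > 0\<close> the pair has smaller modulus than the real root, for \<open>x < 0\<close> larger modulus. So the
  pair consists of the solutions number \<open>pair_index x\<close> and \<open>pair_index x + 1\<close>.
\<close>

definition pair_index :: "real \<Rightarrow> nat" where
  "pair_index x = (if x > 0 then 1 else 2)"

definition single_index :: "real \<Rightarrow> nat" where
  "single_index x = (if x > 0 then 3 else 1)"

text \<open>Only the real root gets a definite value; the pair is left unordered because its moduli
  may coincide.\<close>

lemma pair_wsol:
  assumes x: "x \<noteq> 0" and s: "s > 0"
  shows "wsol (single_index x) (of_real x) s = of_real (w_real s x)"
    and "{#wsol (pair_index x) (of_real x) s, wsol (pair_index x + 1) (of_real x) s#}
      = {#of_real (pair_mid s x) + pair_sqrt s x, of_real (pair_mid s x) - pair_sqrt s x#}"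
proof -
  let ?a = "of_real (pair_mid s x) + pair_sqrt s x" and ?b = "of_real (pair_mid s x) - pair_sqrt s x"
  let ?w = "complex_of_real (w_real s x)"
  have wn: "cmod ?w = - w_real s x" using w_real_neg[OF x s] by simp
  note f = pair_factor[OF x s]
  have f1: "(t - ?a) * (t - ?b) * (t - ?w) = cubic s t - of_real x * t" for t
    unfolding f[symmetric] by (simp only: mult_ac)
  have f2: "(t - ?b) * (t - ?a) * (t - ?w) = cubic s t - of_real x * t" for t
    unfolding f[symmetric] by (simp only: mult_ac)
  have f3: "(t - ?w) * (t - ?b) * (t - ?a) = cubic s t - of_real x * t" for t
    unfolding f[symmetric] by (simp only: mult_ac)
  have c: "cmod ?a \<le> cmod ?b \<or> cmod ?b \<le> cmod ?a" by linarith
  have "wsol (single_index x) (of_real x) s = ?w \<and> 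
    {#wsol (pair_index x) (of_real x) s, wsol (pair_index x + 1) (of_real x) s#} = {#?a, ?b#}"
  proof (cases "x > 0")
    case True
    show ?thesis
      using c wsol_unique3[OF s f1] wsol_unique3[OF s f2] pair_cmod[OF x s] True wn
      by (auto simp: pair_index_def single_index_def numeral_2_eq_2 add_mset_commute)
  next
    case False
    then have "x < 0" using x by simp
    show ?thesis
      using c wsol_unique1[OF s f] wsol_unique1[OF s f3] pair_cmod[OF x s] \<open>x < 0\<close> False wn
      by (auto simp: pair_index_def single_index_def numeral_3_eq_3 numeral_2_eq_2 add_mset_commute)
  qed
  then show "wsol (single_index x) (of_real x) s = ?w" 
    "{#wsol (pair_index x) (of_real x) s, wsol (pair_index x + 1) (of_real x) s#} = {#?a, ?b#}" by auto
qed

text \<open>Two distinct real members have equal modulus only if they are opposite, that is, if the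
  midpoint is 0; but \<open>pair_mid^2 > - pair_disc\<close> excludes this.\<close>

lemma pair_cmod_eq_iff:
  assumes x: "x \<noteq> 0" and s: "s > 0"
  shows "cmod (of_real (pair_mid s x) + pair_sqrt s x) = cmod (of_real (pair_mid s x) - pair_sqrt s x) \<longleftrightarrow> pair_disc s x \<ge> 0"
proof (cases "pair_disc s x \<ge> 0")
  case True
  then show ?thesis by (simp add: pair_cmod_nonneg)
next
  case False
  then have "pair_mid s x \<noteq> 0" using pair_mid_pair_disc_pos[OF x s] by auto
  then show ?thesis using False pair_cmod_neg[of s x] by (auto simp: abs_eq_iff)
qed

lemma in_Gam_iff:
  assumes s: "s > 0" and j: "j \<in> {1, 2}"
  shows "x \<in> Gam p q j s \<longleftrightarrow> cmod (wsol j x s) = cmod (wsol (j + 1) x s)"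
proof -
  have "cmod (zsol p q j x s) = h s / cmod (wsol j x s)"
    "cmod (zsol p q (j + 1) x s) = h s / cmod (wsol (j + 1) x s)"
    "wsol j x s \<noteq> 0" "wsol (j + 1) x s \<noteq> 0"
    using zsol_wsol[OF s] wsol_nonzero[OF s] h_pos[OF s] j by (auto simp: norm_divide numeral_3_eq_3 numeral_2_eq_2)
  note eq = this(1,2)
  show ?thesis
    unfolding Gam_def mem_Collect_eq eq using h_pos[OF s] by simp
qed

lemma Gam_real_iff:
  assumes x: "x \<noteq> 0" and s: "s > 0" and j: "j \<in> {1, 2}"
  shows "of_real x \<in> Gam p q j s \<longleftrightarrow> j = pair_index x \<and> pair_disc s x \<ge> 0"
proof -
  let ?a = "of_real (pair_mid s x) + pair_sqrt s x" and ?b = "of_real (pair_mid s x) - pair_sqrt s x"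
  have wn: "cmod (of_real (w_real s x)) = - w_real s x" using w_real_neg[OF x s] by simp
  note P = pair_wsol[OF x s] and G = in_Gam_iff[OF s j, of "of_real x"] and C = pair_cmod[OF x s]
  have 2: "(wsol (pair_index x) (of_real x) s = ?a \<and> wsol (pair_index x + 1) (of_real x) s = ?b) \<or>
     (wsol (pair_index x) (of_real x) s = ?b \<and> wsol (pair_index x + 1) (of_real x) s = ?a)"
    using P(2) unfolding mset_pair_eq_iff by blast
  show ?thesis
  proof (cases "j = pair_index x")
    case True
    then show ?thesis using 2 G pair_cmod_eq_iff[OF x s] by auto
  next
    case False
    have "cmod (wsol j (of_real x) s) \<noteq> cmod (wsol (j + 1) (of_real x) s)"
    proof (cases "x > 0")
      case True
      then have "j = 2" using j False by (auto simp: pair_index_def)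
      then show ?thesis using True 2 P(1) C wn by (auto simp: pair_index_def single_index_def numeral_3_eq_3 numeral_2_eq_2)
    next
      case F: False
      then have "x < 0" "j = 1" using x j False by (auto simp: pair_index_def)
      then show ?thesis using F 2 P(1) C wn by (auto simp: pair_index_def single_index_def numeral_3_eq_3 numeral_2_eq_2)
    qed
    then show ?thesis using G False by simp
  qed
qed

text \<open>The absolute value absorbs the unknown order of the pair: \<open>zsol\<close> is sorted,
  so the integrand is the nonnegative one of the two differences.\<close>

lemma V_integrand_eq:
  assumes x: "x \<noteq> 0" and s: "s > 0"
  shows "V_integrand p q (pair_index x) (of_real x) s
    = \<bar>ln (cmod (of_real (pair_mid s x) + pair_sqrt s x)) - ln (cmod (of_real (pair_mid s x) - pair_sqrt s x))\<bar>"
proof -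
  let ?a = "of_real (pair_mid s x) + pair_sqrt s x" and ?b = "of_real (pair_mid s x) - pair_sqrt s x"
  let ?j = "pair_index x"
  have j: "?j \<in> {1,2}" by (simp add: pair_index_def)
  have le: "cmod (wsol ?j (of_real x) s) \<le> cmod (wsol (?j + 1) (of_real x) s)"
    using wsol_sorted[OF s] by (auto simp: pair_index_def numeral_3_eq_3 numeral_2_eq_2)
  have nz: "wsol ?j (of_real x) s \<noteq> 0" "wsol (?j + 1) (of_real x) s \<noteq> 0"
    using wsol_nonzero[OF s] by (auto simp: pair_index_def)
  have 2: "(wsol (pair_index x) (of_real x) s = ?a \<and> wsol (pair_index x + 1) (of_real x) s = ?b) \<or>
     (wsol (pair_index x) (of_real x) s = ?b \<and> wsol (pair_index x + 1) (of_real x) s = ?a)"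
    using pair_wsol(2)[OF x s] unfolding mset_pair_eq_iff by blast
  have "zsol p q ?j (of_real x) s / zsol p q (?j + 1) (of_real x) s
     = wsol (?j + 1) (of_real x) s / wsol ?j (of_real x) s"
    using zsol_wsol[OF s, of ?j] zsol_wsol[OF s, of "?j + 1"] h_pos[OF s] j by auto
  then have "V_integrand p q ?j (of_real x) s
     = ln (cmod (wsol (?j + 1) (of_real x) s)) - ln (cmod (wsol ?j (of_real x) s))"
    using nz by (simp add: V_integrand_def norm_divide ln_div)
  moreover have "ln (cmod (wsol ?j (of_real x) s)) \<le> ln (cmod (wsol (?j + 1) (of_real x) s))"
    using le nz by simp
  ultimately show ?thesis using 2 by auto
qed

end

section \<open>External fields\<close>

lemma DERIV_ln_nonzero:
  fixes x :: real
  assumes "x \<noteq> 0"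
  shows "(ln has_real_derivative 1 / x) (at x)"
proof (cases "x > 0")
  case True
  then show ?thesis by (rule DERIV_ln_divide)
next
  case False
  then have "((\<lambda>x. ln (- x)) has_real_derivative 1 / x) (at x)"
    using assms by (auto intro!: derivative_eq_intros)
  then show ?thesis by (simp add: ln_minus)
qed

lemma ln_abs: "ln \<bar>x\<bar> = ln (x :: real)"
  by (simp add: abs_if ln_minus)

text \<open>At 0 the factor \<open>v\<close> annihilates the default value of \<open>ln 0\<close>.
  This is needed because for \<open>x > 0\<close> one real branch starts at
  \<open>v = 0\<close>.\<close>

lemma isCont_mult_ln: "isCont (\<lambda>v. v * ln v) (v :: real)"
proof (cases "v = 0")
  case True
  have "((\<lambda>y::real. - (ln y / y)) \<longlongrightarrow> 0) at_top"
    using tendsto_minus[OF ln_x_over_x_tendsto_0] by simp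
  then have "((\<lambda>y. - (ln (inverse y) / inverse y)) \<longlongrightarrow> 0) (at_right (0::real))"
    by (rule filterlim_compose[OF _ filterlim_inverse_at_top_right])
  then have R: "((\<lambda>y. y * ln y) \<longlongrightarrow> 0) (at_right (0::real))"
    by (simp add: ln_inverse divide_inverse) (simp add: mult.commute)
  then have "((\<lambda>y. - (- y * ln (- y))) \<longlongrightarrow> - 0) (at_left (0::real))"
    unfolding at_left_minus filterlim_filtermap by (intro tendsto_minus) (simp add: minus_zero)
  then have "((\<lambda>y. y * ln y) \<longlongrightarrow> 0) (at_left (0::real))" by (simp add: ln_minus)
  then show ?thesis using True R unfolding isCont_def by (simp add: filterlim_split_at)
next
  case False
  then show ?thesis by (intro continuous_intros) auto
qed

context symbol_params
begin

text \<open>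
  \<open>Psi x\<close> is a primitive of \<open>F x \<cdot> h' / h\<close>, so \<open>Phi x\<close> is one of \<open>(F x)' ln \<bar>h / x\<bar>\<close>. No absolute
  values are needed because the real logarithm of HOL is even.
\<close>

definition Psi :: "real \<Rightarrow> real \<Rightarrow> real" where
  "Psi x v = 3 * v - p * ln (v + p) - (p + q) * ln (v + p + q) - h v / x"

definition Phi :: "real \<Rightarrow> real \<Rightarrow> real" where
  "Phi x v = F x v * ln (h v / x) - Psi x v"

lemma h_deriv: "(h has_real_derivative ((v + p) * (v + p + q) + v * (v + p + q) + v * (v + p))) (at v)"
  unfolding h_def by (auto intro!: derivative_eq_intros simp: algebra_simps)

text \<open>The product rule yields two terms; the one carrying \<open>F x\<close> cancels against
  the derivative of \<open>Psi x\<close>.\<close>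

lemma Phi_deriv:
  assumes x: "x \<noteq> 0" and v: "h v \<noteq> 0" and F': "(F x has_real_derivative F') (at v)"
  shows "(Phi x has_real_derivative F' * ln (h v / x)) (at v)"
proof -
  define h' where "h' = (v + p) * (v + p + q) + v * (v + p + q) + v * (v + p)"
  have nz: "v \<noteq> 0" "v + p \<noteq> 0" "v + p + q \<noteq> 0" using v by (auto simp: h_def)
  have hd: "(h has_real_derivative h') (at v)" unfolding h'_def by (rule h_deriv)
  have 1: "((\<lambda>v. ln (h v / x)) has_real_derivative h' / h v) (at v)"
    using DERIV_chain2[OF DERIV_ln_nonzero DERIV_cdivide[OF hd, of x]] x v by simp
  have 2: "((\<lambda>v. ln (v + p)) has_real_derivative 1 / (v + p)) (at v)"
  proof -
    have "((\<lambda>v. v + p) has_real_derivative 1) (at v)" by (auto intro!: derivative_eq_intros)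
    from DERIV_chain2[OF DERIV_ln_nonzero[OF nz(2)] this] show ?thesis by simp
  qed
  have 3: "((\<lambda>v. ln (v + p + q)) has_real_derivative 1 / (v + p + q)) (at v)"
  proof -
    have "((\<lambda>v. v + p + q) has_real_derivative 1) (at v)" by (auto intro!: derivative_eq_intros)
    from DERIV_chain2[OF DERIV_ln_nonzero[OF nz(3)] this] show ?thesis by simp
  qed
  have "(Psi x has_real_derivative (3 * 1 - p * (1 / (v + p)) - (p + q) * (1 / (v + p + q)) - h' / x)) (at v)"
    unfolding Psi_def by (intro DERIV_diff DERIV_cmult DERIV_cdivide DERIV_ident 2 3 hd)
  then have "(Psi x has_real_derivative (3 - p / (v + p) - (p + q) / (v + p + q) - h' / x)) (at v)"
    by simp
  moreover have "3 - p / (v + p) - (p + q) / (v + p + q) - h' / x = F x v * (h' / h v)"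
  proof -
    have "v * h' / h v = 1 + v / (v + p) + v / (v + p + q)"
      unfolding h'_def h_def using nz by (simp add: divide_simps) (simp add: algebra_simps)
    also have "\<dots> = 3 - p / (v + p) - (p + q) / (v + p + q)"
      using nz by (simp add: divide_simps) (simp add: algebra_simps)
    finally have "v * h' / h v = 3 - p / (v + p) - (p + q) / (v + p + q)" .
    moreover have "F x v * (h' / h v) = v * h' / h v - h' / x"
      using v x by (simp add: F_def field_simps)
    ultimately show ?thesis by simp
  qed
  ultimately have P: "(Psi x has_real_derivative F x v * (h' / h v)) (at v)" by simp
  have "(Phi x has_real_derivative F' * ln (h v / x) + h' / h v * F x v - F x v * (h' / h v)) (at v)"
    unfolding Phi_def by (intro DERIV_diff DERIV_mult 1 P F')
  then show ?thesis by simp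
qed

text \<open>The critical point is \<open>v = 0\<close>, where \<open>ln (h v / x)\<close> is
  singular but \<open>F x v\<close> vanishes as well.\<close>

lemma Phi_cont:
  assumes x: "x \<noteq> 0" and v: "v + p \<noteq> 0" "v + p + q \<noteq> 0"
  shows "isCont (Phi x) v"
proof -
  have "isCont (Psi x) v"
    unfolding Psi_def h_def using v x by (intro continuous_intros) auto
  moreover have "isCont (\<lambda>v. F x v * ln (h v / x)) v"
  proof -
    \<comment> \<open>Splitting \<open>h u / x\<close> into \<open>u\<close> and a factor that does
      not vanish near \<open>v\<close> isolates the singularity in the continuous function
      \<open>u ln u\<close>.\<close>
    have ev: "eventually (\<lambda>u. (u * ln u) * (1 - (u + p) * (u + p + q) / x)
        + F x u * ln ((u + p) * (u + p + q) / x) = F x u * ln (h u / x)) (nhds v)"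
    proof -
      have "eventually (\<lambda>u. u + p \<noteq> 0 \<and> u + p + q \<noteq> 0) (nhds v)"
      proof (intro eventually_conj)
        have "((\<lambda>u. u + p) \<longlongrightarrow> v + p) (nhds v)" "((\<lambda>u. u + p + q) \<longlongrightarrow> v + p + q) (nhds v)"
          by (auto intro!: tendsto_intros filterlim_ident)
        then show "eventually (\<lambda>u. u + p \<noteq> 0) (nhds v)" "eventually (\<lambda>u. u + p + q \<noteq> 0) (nhds v)"
          using v by (auto intro: tendsto_imp_eventually_ne)
      qed
      then show ?thesis
      proof eventually_elim
        case (elim u)
        show ?case
        proof (cases "u = 0")
          case False
          have "h u / x = u * ((u + p) * (u + p + q) / x)" by (simp add: h_def)
          then have "ln (h u / x) = ln u + ln ((u + p) * (u + p + q) / x)"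
            using False elim x by (simp only: ln_mult) auto
          moreover have "F x u = u * (1 - (u + p) * (u + p + q) / x)"
            by (simp add: F_def h_def algebra_simps)
          ultimately show ?thesis by (simp only:) (simp only: ring_distribs mult_1_left mult_1_right ac_simps right_diff_distrib left_diff_distrib)
        qed (simp add: F_def h_def)
      qed
    qed
    have "isCont (\<lambda>u. (u * ln u) * (1 - (u + p) * (u + p + q) / x)
        + F x u * ln ((u + p) * (u + p + q) / x)) v"
      unfolding F_def h_def using v x
      by (intro continuous_add continuous_mult[OF isCont_mult_ln] continuous_intros) auto
    then show ?thesis using isCont_cong[OF ev] by blast
  qed
  ultimately show ?thesis unfolding Phi_def by (rule continuous_diff[rotated])
qed

text \<open>At the zeros \<open>- p\<close> and \<open>- p - q\<close> of \<open>h\<close>, the map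
  \<open>F x\<close> is the identity, so it takes negative values there.\<close>

lemma root_not_pole:
  assumes "x \<noteq> 0" "s \<ge> 0" "F x v = s"
  shows "v + p \<noteq> 0" "v + p + q \<noteq> 0"
proof -
  have "F x (- p) = - p" "F x (- p - q) = - p - q" by (simp_all add: F_def h_def)
  then show "v + p \<noteq> 0" "v + p + q \<noteq> 0"
    using assms p_pos q_pos by (auto simp: add_eq_0_iff2 add.assoc)
qed

lemma root_h_nonzero:
  assumes "x \<noteq> 0" "s > 0" "F x v = s"
  shows "h v \<noteq> 0" "h v / x = v - s"
proof -
  show *: "h v / x = v - s" using assms(3) unfolding F_def by linarith
  show "h v \<noteq> 0"
  proof
    assume "h v = 0"
    then have "v = s" using * by simp
    then show False using h_pos[OF assms(2)] \<open>h v = 0\<close> by simp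
  qed
qed

text \<open>Along a branch \<open>F x (v t) = t\<close>, so the chain-rule factor
  \<open>(F x)' v'\<close> is 1, and what remains is \<open>ln (h v / x)\<close> with
  \<open>h v / x = v - s\<close>, the root \<open>w\<close> itself.\<close>

lemma Phi_branch_deriv:
  assumes x: "x \<noteq> 0" and s: "s > 0" and ev: "eventually (\<lambda>t. F x (v t) = t) (nhds s)"
    and v': "(v has_real_derivative v') (at s)"
  shows "((\<lambda>t. Phi x (v t)) has_real_derivative ln (v s - s)) (at s)"
proof -
  have Fs: "F x (v s) = s" using eventually_nhds_x_imp_x[OF ev] .
  note hn = root_h_nonzero[OF x s Fs]
  obtain F' where F': "(F x has_real_derivative F') (at (v s))"
  proof -
    have "(F x has_real_derivative (1 - ((v s + p) * (v s + p + q) + v s * (v s + p + q) + v s * (v s + p)) / x)) (at (v s))"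
      unfolding F_def using x by (auto intro!: derivative_eq_intros h_deriv)
    then show ?thesis by (rule that)
  qed
  have "((\<lambda>t. F x (v t)) has_real_derivative F' * v') (at s)"
    by (rule DERIV_chain2[OF F' v'])
  moreover have "((\<lambda>t. F x (v t)) has_real_derivative 1) (at s)"
    using DERIV_cong_ev[OF refl ev refl, of 1] by simp
  ultimately have "F' * v' = 1" by (rule DERIV_unique)
  moreover have "((\<lambda>t. Phi x (v t)) has_real_derivative (F' * ln (h (v s) / x)) * v') (at s)"
    by (rule DERIV_chain2[OF Phi_deriv[OF x hn(1) F'] v'])
  moreover have "(F' * ln (h (v s) / x)) * v' = (F' * v') * ln (h (v s) / x)" by simp
  ultimately show ?thesis unfolding hn(2) by (metis mult_1)
qed

lemma V_zero:
  assumes x: "x \<noteq> 0" and D: "pair_disc 0 x \<ge> 0"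
  shows "set_integrable lborel {0<..} (V_integrand p q (pair_index x) (of_real x))"
    "V_field p q (pair_index x) (of_real x) = 0"
proof -
  have z: "V_integrand p q (pair_index x) (of_real x) s = 0" if "s \<in> {0<..}" for s
  proof -
    have "pair_disc s x \<ge> 0" using pair_disc_less[OF x, of 0 s] that D by simp
    then show ?thesis using V_integrand_eq[OF x, of s] that by (simp add: pair_cmod_nonneg)
  qed
  have eq: "(\<lambda>s. indicator {0<..} s *\<^sub>R V_integrand p q (pair_index x) (of_real x) s) = (\<lambda>s. 0)"
    using z by (auto simp: indicator_def)
  show "set_integrable lborel {0<..} (V_integrand p q (pair_index x) (of_real x))"
    unfolding set_integrable_def eq by simp
  show "V_field p q (pair_index x) (of_real x) = 0"
    unfolding V_field_def set_lebesgue_integral_def eq by simp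
qed

lemma pair_mid_zero_nonzero:
  assumes x: "x \<noteq> 0" and D: "pair_disc 0 x < 0"
  shows "pair_mid 0 x \<noteq> 0"
proof (cases "x < 0")
  case True
  then show ?thesis using p_pos q_pos by (simp add: pair_mid_def v_real_zero branch_end_def)
next
  case False
  then have x0: "x > 0" using x by simp
  have "w_real 0 x < 0" using e_less[OF x0] p_pos q_pos x0 by (simp add: w_real_def v_real_zero branch_end_def)
  then have "(pair_mid 0 x)\<^sup>2 + pair_disc 0 x = 0" using w_real_prod[OF x, of 0] by (simp add: h_def)
  then show ?thesis using D by auto
qed

text \<open>The sign \<open>k\<close> selects the member of larger modulus:
  \<open>pair_mid + k d\<close> lies farther from 0 than \<open>pair_mid - k d\<close>.\<close>

lemma V_main:
  assumes x: "x \<noteq> 0" and D: "pair_disc 0 x < 0"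
  defines "k \<equiv> sgn (pair_mid 0 x)" and "d \<equiv> sqrt (- pair_disc 0 x)"
  shows "set_integrable lborel {0<..} (V_integrand p q (pair_index x) (of_real x))" (is ?int)
    "V_field p q (pair_index x) (of_real x) = Psi x (pair_mid 0 x + k * d) - Psi x (pair_mid 0 x - k * d)" (is ?val)
proof -
  \<comment> \<open>The two real branches meet at \<open>S\<close>; beyond it the pair is conjugate
    and the integrand vanishes.\<close>
  obtain S where S: "S > 0" "pair_disc S x = 0" using pair_disc_zero_exists[OF x D] by blast
  have Dneg: "pair_disc s x < 0" if "0 \<le> s" "s < S" for s using pair_disc_less[OF x that] S by simp
  have Dnn: "pair_disc s x \<ge> 0" if "s \<ge> S" for s using pair_disc_less[OF x, of S s] S that by (cases "s = S") auto
  have rho0: "pair_mid 0 x \<noteq> 0" using pair_mid_zero_nonzero[OF x D] .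
  have rne: "pair_mid s x \<noteq> 0" if "0 \<le> s" "s < S" for s
    using pair_mid_pair_disc_pos[OF x, of s] Dneg[OF that] that rho0 by (cases "s = 0") auto
  have k: "k = 1 \<or> k = -1" using rho0 by (auto simp: k_def sgn_if)
  have kk: "k * k = 1" using k by auto
  have rc: "continuous_on {0..} (\<lambda>s. pair_mid s x)"
    unfolding pair_mid_def by (intro continuous_intros v_real_continuous x) auto
  \<comment> \<open>The midpoint cannot vanish while the pair is real and distinct, so it keeps the
    sign that it has at \<open>s = 0\<close>, and the choice of \<open>k\<close> stays valid up to
    \<open>S\<close>.\<close>
  have kr: "k * pair_mid s x > 0" if "0 \<le> s" "s < S" for s
  proof (rule ccontr)
    assume "\<not> ?thesis"
    moreover have "k * pair_mid 0 x > 0" using rho0 by (simp add: k_def sgn_if)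
    ultimately have "\<exists>t\<ge>0. t \<le> s \<and> k * pair_mid t x = 0"
      using that by (intro IVT2' continuous_intros continuous_on_subset[OF rc]) auto
    then show False using rne that k by auto
  qed
  define vv where "vv = (\<lambda>c s. pair_mid s x + c * sqrt (- pair_disc s x) + s)"
  have vc: "continuous_on {0..} (vv c)" for c
    unfolding vv_def by (intro continuous_intros rc pair_disc_continuous x)
  have Fv: "F x (vv c s) = s" if "c = 1 \<or> c = -1" "0 \<le> s" "s \<le> S" for c s
  proof -
    have "pair_disc s x \<le> 0" using Dneg[of s] S that by (cases "s = S") auto
    then have "((pair_mid s x + c * sqrt (- pair_disc s x)) - pair_mid s x)\<^sup>2 = - pair_disc s x"
      using that(1) by (auto simp: power_mult_distrib)
    from real_pair_root(1)[OF x that(2) this] show ?thesis by (simp add: vv_def)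
  qed
  have vd: "\<exists>v'. (vv c has_real_derivative v') (at s)" if "0 < s" "s < S" for c s
  proof -
    note [derivative_intros] = v_real_deriv[OF x that(1)] pair_disc_deriv[OF x that(1)]
    have "- pair_disc s x > 0" using Dneg[of s] that by simp
    then show ?thesis unfolding vv_def pair_mid_def
      by (intro exI) (rule derivative_eq_intros refl | simp)+
  qed
  have Phid: "((\<lambda>s. Phi x (vv c s)) has_real_derivative ln (pair_mid s x + c * sqrt (- pair_disc s x))) (at s)"
    if c: "c = 1 \<or> c = -1" and s: "0 < s" "s < S" for c s
  proof -
    have "eventually (\<lambda>t. t \<in> {0<..<S}) (nhds s)"
      using s by (intro eventually_nhds_in_open) auto
    then have "eventually (\<lambda>t. F x (vv c t) = t) (nhds s)"
      by eventually_elim (use Fv c in auto)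
    moreover obtain v' where "(vv c has_real_derivative v') (at s)" using vd s by blast
    ultimately show ?thesis using Phi_branch_deriv[OF x s(1), of "vv c" v'] by (simp add: vv_def)
  qed
  define G where "G = (\<lambda>s. Phi x (vv k s) - Phi x (vv (- k) s))"
  define f where "f = (\<lambda>s. ln (pair_mid s x + k * sqrt (- pair_disc s x)) - ln (pair_mid s x - k * sqrt (- pair_disc s x)))"
  have Gd: "(G has_real_derivative f s) (at s)" if "0 < s" "s < S" for s
    using DERIV_diff[OF Phid[OF _ that, of k] Phid[OF _ that, of "- k"]] k by (auto simp: G_def f_def)
  have Gc: "continuous_on {0..S} G"
  proof -
    have "continuous_on {0..S} (\<lambda>s. Phi x (vv c s))" if c: "c = 1 \<or> c = -1" for c
    proof (rule continuous_on_compose2[of "vv c ` {0..S}" "Phi x"])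
      show "continuous_on (vv c ` {0..S}) (Phi x)"
      proof (rule continuous_at_imp_continuous_on, clarify)
        fix s assume "s \<in> {0..S}"
        then have "F x (vv c s) = s" "s \<ge> 0" using Fv[OF c] by auto
        then show "isCont (Phi x) (vv c s)"
          using root_not_pole[OF x] by (intro Phi_cont x) auto
      qed
    qed (auto intro: continuous_on_subset[OF vc])
    then show ?thesis unfolding G_def using k by (intro continuous_intros) auto
  qed
  have fc: "isCont f s" if "0 < s" "s < S" for s
  proof -
    have D0: "pair_disc s x < 0" using Dneg that by simp
    have "isCont (\<lambda>s. pair_mid s x) s" "isCont (\<lambda>s. pair_disc s x) s"
      using continuous_on_interior[OF rc, of s] continuous_on_interior[OF pair_disc_continuous[OF x], of s] that
      by auto
    moreover have "(pair_mid s x + k * sqrt (- pair_disc s x)) * (pair_mid s x - k * sqrt (- pair_disc s x)) \<noteq> 0"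
    proof -
      have "(pair_mid s x + k * sqrt (- pair_disc s x)) * (pair_mid s x - k * sqrt (- pair_disc s x))
          = pair_mid s x ^ 2 - (k * k) * (sqrt (- pair_disc s x))\<^sup>2"
        by (simp add: power2_eq_square algebra_simps)
      also have "\<dots> = pair_mid s x ^ 2 + pair_disc s x" using D0 by (simp add: kk)
      finally show ?thesis using pair_mid_pair_disc_pos[OF x, of s] that by simp
    qed
    ultimately show ?thesis unfolding f_def by (intro continuous_intros) auto
  qed
  have feq: "V_integrand p q (pair_index x) (of_real x) s = f s" and fnn: "f s \<ge> 0" if s: "0 < s" "s < S" for s
  proof -
    have D0: "pair_disc s x < 0" using Dneg s by simp
    let ?d = "sqrt (- pair_disc s x)"
    have d0: "?d > 0" using D0 by simp
    have "(pair_mid s x)\<^sup>2 - ?d\<^sup>2 > 0" using pair_mid_pair_disc_pos[OF x s(1)] D0 by simp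
    then have "\<bar>?d\<bar> < \<bar>pair_mid s x\<bar>" using abs_le_square_iff[of "pair_mid s x" ?d] by linarith
    moreover have kr: "k * pair_mid s x > 0" using kr s by simp
    ultimately have ab: "\<bar>pair_mid s x - k * ?d\<bar> \<le> \<bar>pair_mid s x + k * ?d\<bar>" "\<bar>pair_mid s x - k * ?d\<bar> > 0"
      using k
    proof (atomize (full), elim disjE)
      assume k1: "k = 1"
      then have "?d < pair_mid s x" using \<open>\<bar>?d\<bar> < \<bar>pair_mid s x\<bar>\<close> d0 kr by simp
      then have "pair_mid s x + ?d > 0" "pair_mid s x - ?d > 0" using d0 by linarith+
      then have "\<bar>pair_mid s x + ?d\<bar> = pair_mid s x + ?d" "\<bar>pair_mid s x - ?d\<bar> = pair_mid s x - ?d" "pair_mid s x - ?d > 0"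
        by (simp_all only: abs_of_pos)
      then show "\<bar>pair_mid s x - k * ?d\<bar> \<le> \<bar>pair_mid s x + k * ?d\<bar> \<and> \<bar>pair_mid s x - k * ?d\<bar> > 0"
        unfolding k1 using d0 by (simp only: mult_1, intro conjI TrueI, linarith)
    next
      assume k1: "k = - 1"
      then have "?d < - pair_mid s x" using \<open>\<bar>?d\<bar> < \<bar>pair_mid s x\<bar>\<close> d0 kr by simp
      then have "pair_mid s x + ?d < 0" "pair_mid s x - ?d < 0" using d0 by linarith+
      then have "\<bar>pair_mid s x + ?d\<bar> = - (pair_mid s x + ?d)" "\<bar>pair_mid s x - ?d\<bar> = - (pair_mid s x - ?d)" "pair_mid s x + ?d < 0"
        by (simp_all only: abs_of_neg)
      then show "\<bar>pair_mid s x - k * ?d\<bar> \<le> \<bar>pair_mid s x + k * ?d\<bar> \<and> \<bar>pair_mid s x - k * ?d\<bar> > 0"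
        unfolding k1 using d0 by (simp only: mult_1 mult_minus1 diff_minus_eq_add add_uminus_conv_diff) linarith
    qed
    then have "ln \<bar>pair_mid s x - k * ?d\<bar> \<le> ln \<bar>pair_mid s x + k * ?d\<bar>" by (intro ln_mono)
    then show fnn: "f s \<ge> 0" by (simp add: f_def ln_abs)
    have "V_integrand p q (pair_index x) (of_real x) s = \<bar>ln (pair_mid s x + ?d) - ln (pair_mid s x - ?d)\<bar>"
      using V_integrand_eq[OF x s(1)] pair_cmod_neg[of s x] D0 by (simp add: ln_abs)
    also have "\<dots> = \<bar>f s\<bar>" using k by (auto simp: f_def)
    finally show "V_integrand p q (pair_index x) (of_real x) s = f s" using fnn by simp
  qed
  have fz: "V_integrand p q (pair_index x) (of_real x) s = 0" if "s \<ge> S" for s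
    using V_integrand_eq[OF x, of s] Dnn[OF that] that S by (simp add: pair_cmod_nonneg)
  \<comment> \<open>For \<open>x > 0\<close> the integrand is unbounded near 0, since one root tends
    to 0 there. The fundamental theorem on the open interval needs only limits of \<open>G\<close>
    at the ends, and nonnegativity of \<open>f\<close> also yields integrability.\<close>
  have F: "set_integrable lborel (einterval (ereal 0) (ereal S)) f"
    "(LBINT s=ereal 0..ereal S. f s) = G S - G 0"
  proof -
    have lim: "((G \<circ> real_of_ereal) \<longlongrightarrow> G 0) (at_right (ereal 0))" "((G \<circ> real_of_ereal) \<longlongrightarrow> G S) (at_left (ereal S))"
      unfolding ereal_tendsto_simps
      using Gc S unfolding continuous_on_Icc_at_rightD
      by (auto dest: continuous_on_Icc_at_rightD continuous_on_Icc_at_leftD)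
    show "set_integrable lborel (einterval (ereal 0) (ereal S)) f"
      by (rule interval_integral_FTC_nonneg(1)[OF _ Gd fc _ lim]) (use S fnn in auto)
    show "(LBINT s=ereal 0..ereal S. f s) = G S - G 0"
      by (rule interval_integral_FTC_nonneg(2)[OF _ Gd fc _ lim]) (use S fnn in auto)
  qed
  have eq: "(\<lambda>s. indicator {0<..} s *\<^sub>R V_integrand p q (pair_index x) (of_real x) s) = (\<lambda>s. indicator {0<..<S} s *\<^sub>R f s)"
  proof
    fix s show "indicator {0<..} s *\<^sub>R V_integrand p q (pair_index x) (of_real x) s = indicator {0<..<S} s *\<^sub>R f s"
      using feq[of s] fz[of s] by (auto simp: indicator_def)
  qed
  show ?int using F(1) unfolding set_integrable_def eq by simp
  have "V_field p q (pair_index x) (of_real x) = G S - G 0"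
    using F(2) S unfolding V_field_def set_lebesgue_integral_def eq
    by (simp add: interval_lebesgue_integral_le_eq set_lebesgue_integral_def)
  \<comment> \<open>The branches coincide at \<open>S\<close>. At \<open>s = 0\<close> both values
    of \<open>F x\<close> vanish, so the logarithmic part of \<open>Phi\<close> drops out and only
    \<open>Psi\<close> survives.\<close>
  also have "G S = 0" using S by (simp add: G_def vv_def)
  also have "0 - G 0 = Psi x (pair_mid 0 x + k * d) - Psi x (pair_mid 0 x - k * d)"
    using Fv[of k 0] Fv[of "- k" 0] k S by (auto simp: G_def Phi_def vv_def d_def)
  finally show ?val .
qed

lemma Psi_root: "x \<noteq> 0 \<Longrightarrow> (v + p) * (v + p + q) = x \<Longrightarrow>
    Psi x v = 2 * v - p * ln (v + p) - (p + q) * ln (v + p + q)"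
proof -
  assume "x \<noteq> 0" and 1: "(v + p) * (v + p + q) = x"
  have "h v = v * ((v + p) * (v + p + q))" by (simp add: h_def)
  then show ?thesis using \<open>x \<noteq> 0\<close> unfolding 1 by (simp add: Psi_def)
qed

lemma V1_value:
  assumes x: "x > 0"
  shows "set_integrable lborel {0<..} (V_integrand p q 1 (of_real x))" (is ?int)
    "V_field p q 1 (of_real x) = sqrt (q^2 + 4 * x) - p * ln (4 * x) - q * ln (sqrt (q^2 + 4 * x) + q) - 2 * p - q
            + p * ln (4 * p^2 + 4 * p * q) + q * ln (2 * p + 2 * q)" (is "_ = ?rhs")
proof -
  \<comment> \<open>The pair at \<open>s = 0\<close> is 0 and \<open>a\<close>. The sign of
    \<open>a\<close> depends on \<open>x\<close>, but \<open>sgn (a / 2)\<close> times the half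
    distance is \<open>a / 2\<close> in either case, so the final formula has no case
    distinction.\<close>
  define a where "a = (sqrt_qx x - (2 * p + q)) / 2"
  have r: "sqrt_qx x = 2 * a + 2 * p + q" by (simp add: a_def field_simps)
  have ap: "a + p > 0" using sqrt_qx_gt[OF x] by (simp add: a_def field_simps)
  have ax: "(a + p) * (a + p + q) = x"
  proof -
    have "(a + p) * (a + p + q) = ((sqrt_qx x)\<^sup>2 - q\<^sup>2) / 4"
      unfolding r by (simp add: field_simps power2_eq_square)
    then show ?thesis unfolding sqrt_qx_sq[OF x] by simp
  qed
  have l1: "ln (4 * x) = ln 4 + (ln (a + p) + ln (a + p + q))"
    unfolding ax[symmetric] using ap q_pos by (simp add: ln_mult)
  have l2: "ln (sqrt (q^2 + 4 * x) + q) = ln 2 + ln (a + p + q)"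
  proof -
    have "sqrt (q^2 + 4 * x) + q = 2 * (a + p + q)" using r by (simp add: sqrt_qx_def)
    then show ?thesis using ap q_pos by (simp only: ln_mult) auto
  qed
  have l3: "ln (4 * p^2 + 4 * p * q) = ln 4 + (ln p + ln (p + q))"
  proof -
    have "4 * p^2 + 4 * p * q = 4 * (p * (p + q))" by (simp add: power2_eq_square algebra_simps)
    then show ?thesis using p_pos q_pos by (simp only: ln_mult) auto
  qed
  have l4: "ln (2 * p + 2 * q) = ln 2 + ln (p + q)"
  proof -
    have "2 * p + 2 * q = 2 * (p + q)" by simp
    then show ?thesis using p_pos q_pos by (simp only: ln_mult) auto
  qed
  have rhs: "?rhs = Psi x a - Psi x 0"
    unfolding l1 l2 l3 l4 unfolding Psi_root[OF _ ax, OF less_imp_neq[OF x, symmetric]] sqrt_qx_def[symmetric] r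
    by (simp add: Psi_def h_def algebra_simps)
  have j: "pair_index x = 1" using x by (simp add: pair_index_def)
  have D0: "pair_disc 0 x = - (a / 2)\<^sup>2" using pair_disc_zero(2)[OF x] by (simp add: a_def)
  have r0: "pair_mid 0 x = a / 2" using x by (simp add: pair_mid_def v_real_zero branch_end_def end_zero_def r field_simps)
  have "?int \<and> V_field p q 1 (of_real x) = Psi x a - Psi x 0"
  proof (cases "a = 0")
    case True
    then show ?thesis using V_zero[of x] x j D0 by simp
  next
    case False
    then have D: "pair_disc 0 x < 0" using D0 by simp
    have "sgn (a / 2) * sqrt ((a / 2)\<^sup>2) = a / 2" by (simp only: real_sqrt_abs sgn_mult_abs)
    then show ?thesis
      using V_main[of x, OF _ D] x j unfolding r0 D0 by simp
  qed
  then show ?int "V_field p q 1 (of_real x) = ?rhs" unfolding rhs by auto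
qed

lemma V2_value:
  assumes x: "x < 0"
  shows "set_integrable lborel {0<..} (V_integrand p q 2 (of_real x))" (is ?int)
    "V_field p q 2 (of_real x) = (if x < - (q^2) / 4 then 0
           else - 2 * sqrt (q^2 + 4 * x)
                  + q * ln ((q + sqrt (q^2 + 4 * x)) / (q - sqrt (q^2 + 4 * x))))" (is "_ = ?rhs")
proof -
  have j: "pair_index x = 2" using x by (simp add: pair_index_def)
  have D0: "pair_disc 0 x = - (q^2 + 4 * x) / 4" using pair_disc_zero(1)[OF x] .
  have "?int \<and> V_field p q 2 (of_real x) = ?rhs"
  proof (cases "q^2 + 4 * x \<le> 0")
    case True
    then have "?rhs = 0" using q_pos by (cases "q^2 + 4 * x = 0") auto
    then show ?thesis using V_zero[of x] x j D0 True by simp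
  next
    case False
    then have D: "pair_disc 0 x < 0" using D0 by simp
    define r where "r = sqrt_qx x"
    have r2: "r\<^sup>2 = q^2 + 4 * x" using False by (simp add: r_def sqrt_qx_def)
    have r0: "r > 0" using False by (simp add: r_def sqrt_qx_def)
    have rq: "r < q" using r2 x q_pos r0 by (intro power2_less_imp_less[of r q]) auto
    have d: "sqrt (- pair_disc 0 x) = r / 2"
    proof -
      have "- pair_disc 0 x = (q^2 + 4 * x) / 4" unfolding D0 by linarith
      then show ?thesis by (simp only: r_def sqrt_qx_def real_sqrt_divide) simp
    qed
    have rho0: "pair_mid 0 x = - (2 * p + q) / 2" using x by (simp add: pair_mid_def v_real_zero branch_end_def)
    have k: "sgn (pair_mid 0 x) = - 1" unfolding rho0 using p_pos q_pos by simp
    \<comment> \<open>The midpoint is negative, so \<open>b\<close>, the lower of the two roots, has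
      the larger modulus.\<close>
    define a b where "a = - (2 * p + q) / 2 + r / 2" and "b = - (2 * p + q) / 2 - r / 2"
    have xr: "x = (r\<^sup>2 - q\<^sup>2) / 4" using r2 by simp
    have ax: "(a + p) * (a + p + q) = x" "(b + p) * (b + p + q) = x"
      unfolding xr a_def b_def by (simp_all add: field_simps power2_eq_square)
    have l: "ln (a + p) = ln ((q - r) / 2)" "ln (a + p + q) = ln ((q + r) / 2)"
       "ln (b + p) = ln ((q + r) / 2)" "ln (b + p + q) = ln ((q - r) / 2)"
    proof -
      have "a + p = - ((q - r) / 2)" "b + p = - ((q + r) / 2)" by (simp_all add: a_def b_def field_simps)
      then show "ln (a + p) = ln ((q - r) / 2)" "ln (b + p) = ln ((q + r) / 2)"
        by (simp_all only: ln_minus)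
      show "ln (a + p + q) = ln ((q + r) / 2)" "ln (b + p + q) = ln ((q - r) / 2)"
      proof -
        have "a + p + q = (q + r) / 2" "b + p + q = (q - r) / 2" by (simp_all add: a_def b_def field_simps)
        then show "ln (a + p + q) = ln ((q + r) / 2)" "ln (b + p + q) = ln ((q - r) / 2)" by (simp_all only:)
      qed
    qed
    have L: "ln ((q + r) / (q - r)) = ln ((q + r) / 2) - ln ((q - r) / 2)"
      using rq r0 by (simp add: ln_div)
    have "V_field p q 2 (of_real x) = Psi x b - Psi x a"
      using V_main(2)[of x, OF _ D] x unfolding j k d unfolding rho0 by (simp add: a_def b_def)
    also have "\<dots> = - 2 * r + q * ln ((q + r) / (q - r))"
      unfolding L Psi_root[OF less_imp_neq[OF x] ax(1)] Psi_root[OF less_imp_neq[OF x] ax(2)] l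
      by (simp add: a_def b_def field_simps)
    finally show ?thesis using V_main(1)[of x, OF _ D] x j False by (simp add: r_def sqrt_qx_def)
  qed
  then show ?int "V_field p q 2 (of_real x) = ?rhs" by auto
qed

end

section \<open>Boundary values of the solutions\<close>

lemma prod3_small:
  fixes a b c \<eta> :: real
  assumes "a \<ge> 0" "b \<ge> 0" "c \<ge> 0" "\<eta> > 0" "a * b * c < \<eta> ^ 3"
  shows "a < \<eta> \<or> b < \<eta> \<or> c < \<eta>"
proof (rule ccontr)
  assume "\<not> ?thesis"
  then have "\<eta> * \<eta> * \<eta> \<le> a * b * c"
    using assms by (intro mult_mono) auto
  then show False using assms by (simp add: power3_eq_cube)
qed

lemma Re_of_real_mult: "Re (of_real r * c) = r * Re c"
  by simp

context symbol_params
begin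

definition root_sum :: "real \<Rightarrow> real" where
  "root_sum s = 3 * s + 2 * p + q"

definition pair_im :: "real \<Rightarrow> real \<Rightarrow> real" where
  "pair_im s x = sqrt (pair_disc s x)"

lemma wsol_root:
  assumes "s > 0" "j \<in> {1,2,3}"
  shows "cubic s (wsol j x s) = x * wsol j x s"
  using wsol_factor[OF assms(1), of "wsol j x s" x] assms(2) by auto

lemma wsol_vieta:
  assumes s: "s > 0"
  shows "wsol 1 x s + wsol 2 x s + wsol 3 x s = - of_real (root_sum s)"
    and "wsol 1 x s * wsol 2 x s * wsol 3 x s = - of_real (h s)"
proof -
  define a b c where "a = wsol 1 x s" and "b = wsol 2 x s" and "c = wsol 3 x s"
  define S E H where "S = complex_of_real (3 * s + 2 * p + q)"
    and "E = complex_of_real (s*(s+p) + s*(s+p+q) + (s+p)*(s+p+q))" and "H = complex_of_real (h s)"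
  have f: "(t - a) * (t - b) * (t - c) = t^3 + S * t^2 + E * t + H - x * t" for t
    using wsol_factor[OF s, of t x] unfolding cubic_expand a_def b_def c_def S_def E_def H_def .
  have 0: "- (a * b * c) = H" using f[of 0] by simp
  then have 3: "a * b * c = - H" by (metis minus_minus)
  have "(1 - a) * (1 - b) * (1 - c) = 1 + S + E + H - x"
    "(- 1 - a) * (- 1 - b) * (- 1 - c) = - 1 + S - E + H + x"
    using f[of 1] f[of "- 1"] by simp_all
  then have "a + b + c = - S" using 3 by algebra
  then show "wsol 1 x s + wsol 2 x s + wsol 3 x s = - of_real (root_sum s)"
    by (simp add: a_def b_def c_def S_def root_sum_def)
  show "wsol 1 x s * wsol 2 x s * wsol 3 x s = - of_real (h s)"
    using 3 by (simp add: a_def b_def c_def H_def)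
qed

lemma pair_vieta:
  assumes s: "s > 0"
  shows "wsol (pair_index x) z s + wsol (pair_index x + 1) z s = - of_real (root_sum s) - wsol (single_index x) z s"
    and "wsol (pair_index x) z s * wsol (pair_index x + 1) z s = - of_real (h s) / wsol (single_index x) z s"
  using wsol_vieta[OF s, of z] wsol_nonzero[OF s, of _ z]
  by (auto simp: pair_index_def single_index_def field_simps numeral_3_eq_3 numeral_2_eq_2 eq_neg_iff_add_eq_0 add_ac)

text \<open>For larger \<open>t\<close> each factor of \<open>cubic s t\<close> has modulus at least
  \<open>cmod t / 2\<close>, which makes the cubic exceed \<open>x * t\<close>.\<close>

lemma root_bound:
  assumes s: "s > 0" and r: "cubic s t = x * t"
  shows "cmod t \<le> 2 * (s + p + q) + 8 * cmod x + 1"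
proof (rule ccontr)
  assume n: "\<not> ?thesis"
  define M where "M = s + p + q"
  have M: "M > 0" using s p_pos q_pos by (simp add: M_def)
  have t: "cmod t > 2 * M" "cmod t > 8 * cmod x + 1" "cmod t > 0"
  proof -
    have "cmod t > 2 * M + 8 * cmod x + 1" "cmod x \<ge> 0" using n by (simp_all add: M_def)
    then show "cmod t > 2 * M" "cmod t > 8 * cmod x + 1" "cmod t > 0" using M by linarith+
  qed
  have lb: "cmod (t + of_real a) \<ge> cmod t / 2" if "0 \<le> a" "a \<le> M" for a
  proof -
    have "cmod (t + of_real a) \<ge> cmod t - cmod (complex_of_real a)" by (rule norm_diff_ineq)
    then show ?thesis using that t by simp
  qed
  have "cmod t / 2 * (cmod t / 2) * (cmod t / 2) \<le> cmod (cubic s t)"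
    unfolding cubic_def norm_mult using s p_pos q_pos
    by (intro mult_mono lb) (auto simp: M_def)
  then have "cmod t * (cmod t * cmod t) \<le> cmod t * (8 * cmod x)"
    unfolding r norm_mult by (simp add: mult_ac)
  then have "cmod t * cmod t \<le> 8 * cmod x" using t(3) by simp
  moreover have "1 \<le> cmod t" using t(2) norm_ge_zero[of x] by linarith
  then have "cmod t * 1 \<le> cmod t * cmod t" by (intro mult_left_mono) auto
  ultimately show False using t by simp
qed

lemma wsol_bounded:
  assumes s: "s > 0" and j: "j \<in> {1,2,3}"
  shows "eventually (\<lambda>z. cmod (wsol j z s) \<le> 2 * (s + p + q) + 8 * (cmod x + 1) + 1) (at x)"
proof -
  have "eventually (\<lambda>z. dist z x < 1) (at x)"
    by (simp add: eventually_at) (auto intro: exI[of _ 1])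
  then show ?thesis
  proof eventually_elim
    case (elim z)
    have "cmod z \<le> cmod x + 1"
      using elim norm_triangle_ineq2[of z x] by (simp add: dist_norm)
    then show ?case using root_bound[OF s wsol_root[OF s j], of z] by simp
  qed
qed

text \<open>Continuity of roots without labels: inserting a root for one parameter into the cubic of
  the other leaves \<open>x - z\<close> or \<open>z - x\<close> times a bounded root. So every old
  root has a new one nearby, and conversely.\<close>

lemma wsol_prod_tendsto:
  assumes s: "s > 0" and j: "j \<in> {1,2,3}"
  shows "((\<lambda>z. (wsol j x s - wsol 1 z s) * (wsol j x s - wsol 2 z s) * (wsol j x s - wsol 3 z s)) \<longlongrightarrow> 0) (at x)"
    and "((\<lambda>z. (wsol j z s - wsol 1 x s) * (wsol j z s - wsol 2 x s) * (wsol j z s - wsol 3 x s)) \<longlongrightarrow> 0) (at x)"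
proof -
  have lim: "((\<lambda>z. x - z) \<longlongrightarrow> 0) (at x)" "((\<lambda>z. z - x) \<longlongrightarrow> 0) (at x)"
    by (auto intro!: tendsto_eq_intros)
  have "(wsol j x s - wsol 1 z s) * (wsol j x s - wsol 2 z s) * (wsol j x s - wsol 3 z s) = (x - z) * wsol j x s" for z
    using wsol_factor[OF s, of "wsol j x s" z] wsol_root[OF s j, of x] by (simp add: algebra_simps)
  then show "((\<lambda>z. (wsol j x s - wsol 1 z s) * (wsol j x s - wsol 2 z s) * (wsol j x s - wsol 3 z s)) \<longlongrightarrow> 0) (at x)"
    using tendsto_mult[OF lim(1) tendsto_const[of "wsol j x s"]] by simp
  have "(wsol j z s - wsol 1 x s) * (wsol j z s - wsol 2 x s) * (wsol j z s - wsol 3 x s) = (z - x) * wsol j z s" for z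
    using wsol_factor[OF s, of "wsol j z s" x] wsol_root[OF s j, of z] by (simp add: algebra_simps)
  moreover have "((\<lambda>z. (z - x) * wsol j z s) \<longlongrightarrow> 0) (at x)"
    by (rule lim_null_mult_right_bounded[OF lim(2) wsol_bounded[OF s j]])
  ultimately show "((\<lambda>z. (wsol j z s - wsol 1 x s) * (wsol j z s - wsol 2 x s) * (wsol j z s - wsol 3 x s)) \<longlongrightarrow> 0) (at x)"
    by simp
qed

lemma cmod_pair:
  assumes x: "x \<noteq> 0" and s: "s > 0" and D: "pair_disc s x \<ge> 0"
  shows "cmod (wsol (pair_index x) (of_real x) s) = sqrt ((pair_mid s x)\<^sup>2 + pair_disc s x)"
    "cmod (wsol (pair_index x + 1) (of_real x) s) = sqrt ((pair_mid s x)\<^sup>2 + pair_disc s x)"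
    "cmod (wsol (single_index x) (of_real x) s) = - w_real s x"
proof -
  have "(wsol (pair_index x) (of_real x) s = of_real (pair_mid s x) + pair_sqrt s x
      \<and> wsol (pair_index x + 1) (of_real x) s = of_real (pair_mid s x) - pair_sqrt s x) \<or>
     (wsol (pair_index x) (of_real x) s = of_real (pair_mid s x) - pair_sqrt s x
      \<and> wsol (pair_index x + 1) (of_real x) s = of_real (pair_mid s x) + pair_sqrt s x)"
    using pair_wsol(2)[OF x s] unfolding mset_pair_eq_iff by blast
  then show "cmod (wsol (pair_index x) (of_real x) s) = sqrt ((pair_mid s x)\<^sup>2 + pair_disc s x)"
    "cmod (wsol (pair_index x + 1) (of_real x) s) = sqrt ((pair_mid s x)\<^sup>2 + pair_disc s x)"
    using pair_cmod_nonneg[OF D] by auto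
  show "cmod (wsol (single_index x) (of_real x) s) = - w_real s x"
    using pair_wsol(1)[OF x s] w_real_neg[OF x s] by simp
qed

text \<open>
  The root near \<open>w_real\<close> keeps its place in the ordering since \<open>w_real\<close> is strictly separated from
  the pair by its modulus.
\<close>

lemma isolated_tendsto:
  assumes x: "x \<noteq> 0" and s: "s > 0" and D: "pair_disc s x \<ge> 0"
  shows "((\<lambda>z. wsol (single_index x) z s) \<longlongrightarrow> of_real (w_real s x)) (at (of_real x))"
proof (rule tendstoI)
  fix \<eta>0 :: real assume \<eta>0: "\<eta>0 > 0"
  let ?X = "complex_of_real x"
  define m where "m = sqrt ((pair_mid s x)\<^sup>2 + pair_disc s x)"
  define a where "a = - w_real s x"
  have am: "x > 0 \<Longrightarrow> m < a" "x < 0 \<Longrightarrow> a < m"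
    using pair_cmod(1)[OF x s] pair_cmod(3)[OF x s] pair_cmod_nonneg(1)[OF D] by (auto simp: m_def a_def)
  \<comment> \<open>Half the gap between the moduli: a number within \<open>\<eta>\<close> of
    modulus \<open>a\<close> and one within \<open>\<eta>\<close> of modulus \<open>m\<close> are
    still ordered like \<open>a\<close> and \<open>m\<close>.\<close>
  define \<eta> where "\<eta> = min \<eta>0 (\<bar>a - m\<bar> / 2)"
  have \<eta>: "\<eta> > 0" "\<eta> \<le> \<eta>0" "2 * \<eta> \<le> \<bar>a - m\<bar>" 
  proof -
    have "a \<noteq> m" using am x by (cases "x > 0") auto
    then show "\<eta> > 0" "\<eta> \<le> \<eta>0" using \<eta>0 by (auto simp: \<eta>_def)
    have "\<eta> \<le> \<bar>a - m\<bar> / 2" unfolding \<eta>_def by (rule min.cobounded2)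
    then show "2 * \<eta> \<le> \<bar>a - m\<bar>" by simp
  qed
  let ?w = "\<lambda>j. wsol j ?X s"
  have k: "single_index x \<in> {1,2,3}" "pair_index x \<in> {1,2,3}" "pair_index x + 1 \<in> {1,2,3}" by (auto simp: single_index_def pair_index_def)
  have e1: "eventually (\<lambda>z. dist ((?w (single_index x) - wsol 1 z s) * (?w (single_index x) - wsol 2 z s) * (?w (single_index x) - wsol 3 z s)) 0 < \<eta> ^ 3) (at ?X)"
    using wsol_prod_tendsto(1)[OF s k(1)] by (rule tendstoD) (use \<eta> in simp)
  have e2: "eventually (\<lambda>z. dist ((wsol (single_index x) z s - ?w 1) * (wsol (single_index x) z s - ?w 2) * (wsol (single_index x) z s - ?w 3)) 0 < \<eta> ^ 3) (at ?X)"
    using wsol_prod_tendsto(2)[OF s k(1)] by (rule tendstoD) (use \<eta> in simp)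
  show "eventually (\<lambda>z. dist (wsol (single_index x) z s) (of_real (w_real s x)) < \<eta>0) (at ?X)"
    using e1 e2
  proof eventually_elim
    case (elim z)
    note c = cmod_pair[OF x s D, folded m_def a_def]
    from elim(1) have "\<exists>j\<in>{1,2,3}. cmod (?w (single_index x) - wsol j z s) < \<eta>"
      using prod3_small[OF norm_ge_zero norm_ge_zero norm_ge_zero \<eta>(1)]
      by (simp add: norm_mult)
    then obtain j where j: "j \<in> {1,2,3}" "cmod (?w (single_index x) - wsol j z s) < \<eta>" by blast
    from elim(2) have "\<exists>i\<in>{1,2,3}. cmod (wsol (single_index x) z s - ?w i) < \<eta>"
      using prod3_small[OF norm_ge_zero norm_ge_zero norm_ge_zero \<eta>(1)]
      by (simp add: norm_mult)
    then obtain i where i: "i \<in> {1,2,3}" "cmod (wsol (single_index x) z s - ?w i) < \<eta>" by blast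
    \<comment> \<open>Otherwise the extremal root at \<open>z\<close> would have a modulus near
      \<open>m\<close> while some root has a modulus near \<open>a\<close>, against the
      sorting.\<close>
    have "i = single_index x"
    proof (rule ccontr)
      assume "i \<noteq> single_index x"
      then have "i = pair_index x \<or> i = pair_index x + 1" using i(1) by (auto simp: single_index_def pair_index_def split: if_splits)
      then have im: "cmod (?w i) = m" using c by auto
      have n1: "\<bar>cmod (wsol (single_index x) z s) - m\<bar> < \<eta>"
        using i(2) norm_triangle_ineq3[of "wsol (single_index x) z s" "?w i"] im by simp
      have n2: "\<bar>a - cmod (wsol j z s)\<bar> < \<eta>"
        using j(2) norm_triangle_ineq3[of "?w (single_index x)" "wsol j z s"] c by simp
      show False
      proof (cases "x > 0")
        case True
        then have "cmod (wsol j z s) \<le> cmod (wsol (single_index x) z s)"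
          using wsol_sorted[OF s, of z] j(1) by (auto simp: single_index_def)
        then show False using n1 n2 am(1)[OF True] \<eta> by linarith
      next
        case False
        then have x0: "x < 0" using x by simp
        then have "cmod (wsol j z s) \<ge> cmod (wsol (single_index x) z s)"
          using wsol_sorted[OF s, of z] j(1) by (auto simp: single_index_def)
        then show False using n1 n2 am(2)[OF x0] \<eta> by linarith
      qed
    qed
    then show ?case using i(2) \<eta>(2) pair_wsol(1)[OF x s] by (simp add: dist_norm)
  qed
qed

lemma pair_mid_vieta:
  assumes "x \<noteq> 0" "s > 0"
  shows "2 * pair_mid s x = - root_sum s - w_real s x" "(pair_mid s x)\<^sup>2 + pair_disc s x = - h s / w_real s x"
  using w_real_prod[of x s] w_real_neg[of x s] assms by (simp_all add: pair_mid_def root_sum_def w_real_def field_simps)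

text \<open>Vieta transfers convergence from the isolated root to the symmetric functions of the
  pair, which do not depend on its order.\<close>

lemma pair_sum_tendsto:
  assumes x: "x \<noteq> 0" and s: "s > 0" and D: "pair_disc s x \<ge> 0"
  shows "((\<lambda>z. wsol (pair_index x) z s + wsol (pair_index x + 1) z s) \<longlongrightarrow> of_real (2 * pair_mid s x)) (at (of_real x))"
    and "((\<lambda>z. wsol (pair_index x) z s * wsol (pair_index x + 1) z s) \<longlongrightarrow> of_real ((pair_mid s x)\<^sup>2 + pair_disc s x)) (at (of_real x))"
  unfolding pair_vieta[OF s] pair_mid_vieta[OF x s]
  using w_real_neg[OF x s] by (auto intro!: tendsto_eq_intros isolated_tendsto[OF x s D])

lemma pair_quad_tendsto:
  assumes x: "x \<noteq> 0" and s: "s > 0" and D: "pair_disc s x \<ge> 0" and i: "i = pair_index x \<or> i = pair_index x + 1"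
  shows "((\<lambda>z. (wsol i z s - Complex (pair_mid s x) (pair_im s x)) * (wsol i z s - Complex (pair_mid s x) (- pair_im s x))) \<longlongrightarrow> 0) (at (of_real x))"
proof -
  let ?S = "\<lambda>z. wsol (pair_index x) z s + wsol (pair_index x + 1) z s" and ?P = "\<lambda>z. wsol (pair_index x) z s * wsol (pair_index x + 1) z s"
  let ?r = "of_real (2 * pair_mid s x)" and ?q = "of_real ((pair_mid s x)\<^sup>2 + pair_disc s x)"
  have i3: "i \<in> {1,2,3}" using i by (auto simp: pair_index_def numeral_3_eq_3 numeral_2_eq_2 split: if_splits)
  have eq: "(wsol i z s - Complex (pair_mid s x) (pair_im s x)) * (wsol i z s - Complex (pair_mid s x) (- pair_im s x))
      = (?S z - ?r) * wsol i z s - (?P z - ?q)" for z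
  proof -
    have y2: "of_real (pair_im s x) * of_real (pair_im s x) = complex_of_real (pair_disc s x)"
      using D by (simp add: pair_im_def flip: of_real_mult)
    have C: "Complex (pair_mid s x) y = of_real (pair_mid s x) + \<i> * of_real y" for y by (simp add: complex_eq_iff)
    have 1: "(t - Complex (pair_mid s x) (pair_im s x)) * (t - Complex (pair_mid s x) (- pair_im s x)) = t * t - ?r * t + ?q" for t
      unfolding C using y2 by (simp add: algebra_simps power2_eq_square)
    have 2: "wsol i z s * wsol i z s = ?S z * wsol i z s - ?P z"
      using i by (auto simp: algebra_simps)
    show ?thesis unfolding 1 2 by (simp add: algebra_simps)
  qed
  have "((\<lambda>z. ?S z - ?r) \<longlongrightarrow> 0) (at (of_real x))" "((\<lambda>z. ?P z - ?q) \<longlongrightarrow> 0) (at (of_real x))"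
    using pair_sum_tendsto[OF x s D] by (simp_all only: LIM_zero_iff)
  then have "((\<lambda>z. (?S z - ?r) * wsol i z s - (?P z - ?q)) \<longlongrightarrow> 0 - 0) (at (of_real x))"
    by (intro tendsto_diff lim_null_mult_right_bounded[OF _ wsol_bounded[OF s i3]])
  then show ?thesis unfolding eq by simp
qed

lemma cubic_cnj: "cubic s (cnj t) = cnj (cubic s t)"
  by (simp add: cubic_def)

lemma root_nonzero: "s > 0 \<Longrightarrow> cubic s t = z * t \<Longrightarrow> t \<noteq> 0"
  using h_pos[of s] by (auto simp: cubic_expand)

text \<open>The second factor is the divided difference of \<open>cubic s t / t\<close>, whose value
  at a root is its parameter.\<close>

lemma root_pair_difference:
  assumes s: "s > 0" and u: "cubic s u = z * u" and v: "cubic s v = z' * v"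
  shows "(u - v) * (u + v + of_real (root_sum s) - of_real (h s) / (u * v)) = z - z'"
proof -
  define E where "E = complex_of_real (s*(s+p) + s*(s+p+q) + (s+p)*(s+p+q))"
  have nz: "u \<noteq> 0" "v \<noteq> 0" using root_nonzero[OF s u] root_nonzero[OF s v] .
  have 1: "z = u^2 + of_real (root_sum s) * u + E + of_real (h s) / u"
    using u nz by (simp add: cubic_expand root_sum_def E_def field_simps power2_eq_square power3_eq_cube)
  have 2: "z' = v^2 + of_real (root_sum s) * v + E + of_real (h s) / v"
    using v nz by (simp add: cubic_expand root_sum_def E_def field_simps power2_eq_square power3_eq_cube)
  show ?thesis
    unfolding 1 2 using nz by (simp add: field_simps power2_eq_square)
qed

text \<open>
  The derivative at the pair root \<open>W\<close> of \<open>w \<mapsto> cubic s w / w\<close>, in the two-variable form that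
  occurs in the difference quotient.
\<close>

lemma difference_quotient_at_pair:
  assumes x: "x \<noteq> 0" and s: "s > 0" and D: "pair_disc s x > 0" and k: "k = 1 \<or> k = -1"
  defines "W \<equiv> Complex (pair_mid s x) (k * pair_im s x)"
  shows "W * (W + W + of_real (root_sum s) - of_real (h s) / (W * W))
     = 2 * \<i> * of_real (k * pair_im s x) * Complex (pair_shift s x) (k * pair_im s x)"
proof -
  define V where "V = Complex (pair_mid s x) (- k * pair_im s x)"
  define w where "w = complex_of_real (w_real s x)"
  have y2: "pair_im s x * pair_im s x = pair_disc s x" using D by (simp add: pair_im_def)
  have nz: "W \<noteq> 0" "w \<noteq> 0" using D k w_real_neg[OF x s] by (auto simp: W_def w_def pair_im_def complex_eq_iff)
  have "W * V = of_real ((pair_mid s x)\<^sup>2 + pair_disc s x)"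
    unfolding W_def V_def using y2 k by (auto simp: complex_eq_iff power2_eq_square)
  also have "\<dots> = - of_real (h s) / w"
    unfolding pair_mid_vieta(2)[OF x s] by (simp add: w_def)
  finally have p: "of_real (h s) = - (w * (W * V))" using nz by (simp add: field_simps)
  have "W + V = of_real (2 * pair_mid s x)" by (simp add: W_def V_def complex_eq_iff)
  also have "\<dots> = - of_real (root_sum s) - w" unfolding pair_mid_vieta(1)[OF x s] by (simp add: w_def)
  finally have S: "of_real (root_sum s) = - (W + V + w)" by (simp add: algebra_simps)
  have "W * (W + W + of_real (root_sum s) - of_real (h s) / (W * W)) = (W - V) * (W - w)"
    unfolding p S using nz by (simp add: field_simps)
  also have "W - V = 2 * \<i> * of_real (k * pair_im s x)"
    using k by (auto simp: W_def V_def complex_eq_iff)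
  also have "W - w = Complex (pair_shift s x) (k * pair_im s x)"
    by (simp add: W_def w_def complex_eq_iff pair_shift_eq)
  finally show ?thesis .
qed

text \<open>
  If \<open>u\<close> and \<open>a\<close> are the roots near the two members of the pair, then \<open>u\<close> and \<open>cnj a\<close> solve the
  equation for \<open>z\<close> and \<open>cnj z\<close>, so \<open>u - cnj a\<close> is \<open>2 \<i> Im z\<close> divided by a difference quotient that
  is known in the limit. This decides the sign of \<open>(cmod u)\<^sup>2 - (cmod a)\<^sup>2\<close>.
\<close>

lemma cmod_order_near_pair:
  assumes x: "x \<noteq> 0" and s: "s > 0" and D: "pair_disc s x > 0"
  obtains \<eta> where "\<eta> > 0"
    and "\<And>z u a. cubic s u = z * u \<Longrightarrow> cubic s a = z * a \<Longrightarrow> cmod (u - Complex (pair_mid s x) (pair_im s x)) < \<eta>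
      \<Longrightarrow> cmod (a - Complex (pair_mid s x) (- pair_im s x)) < \<eta> \<Longrightarrow> x * Im z > 0 \<Longrightarrow> cmod a < cmod u"
    and "\<And>z u a. cubic s u = z * u \<Longrightarrow> cubic s a = z * a \<Longrightarrow> cmod (u - Complex (pair_mid s x) (pair_im s x)) < \<eta>
      \<Longrightarrow> cmod (a - Complex (pair_mid s x) (- pair_im s x)) < \<eta> \<Longrightarrow> x * Im z < 0 \<Longrightarrow> cmod u < cmod a"
proof -
  define W where "W = Complex (pair_mid s x) (pair_im s x)"
  define M where "M = (\<lambda>uv :: complex \<times> complex. fst uv + snd uv + of_real (root_sum s) - of_real (h s) / (fst uv * snd uv))"
  \<comment> \<open>With \<open>v = cnj a\<close>, the difference of squared moduli is
    \<open>Re ((u - v) * cnj (u + v))\<close>; \<open>K\<close> is what is left of it after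
    \<open>2 * Im z\<close> has been taken out.\<close>
  define K where "K = (\<lambda>uv :: complex \<times> complex. Re (\<i> * cnj (fst uv + snd uv) / M uv))"
  have y: "pair_im s x > 0" using D by (simp add: pair_im_def)
  have Wnz: "W \<noteq> 0" using y by (auto simp: W_def complex_eq_iff)
  have WM: "W * M (W, W) = 2 * \<i> * of_real (pair_im s x) * Complex (pair_shift s x) (pair_im s x)"
    using difference_quotient_at_pair[OF x s D, of 1] by (simp add: M_def W_def)
  have Mnz: "M (W, W) \<noteq> 0"
  proof
    assume "M (W, W) = 0"
    then show False using WM y by (auto simp: complex_eq_iff)
  qed
  have KW: "x * K (W, W) > 0"
  proof -
    have "\<i> * cnj (W + W) / M (W, W) = \<i> * 2 * (W * cnj W) / (W * M (W, W))"
      using Wnz Mnz by (simp add: field_simps)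
    also have "\<dots> = of_real ((cmod W)\<^sup>2) / (of_real (pair_im s x) * Complex (pair_shift s x) (pair_im s x))"
      unfolding WM complex_norm_square[symmetric] using y by (simp add: field_simps)
    also have "\<dots> = of_real ((cmod W)\<^sup>2 / pair_im s x) * (1 / Complex (pair_shift s x) (pair_im s x))"
      using y by (simp add: field_simps)
    finally have "K (W, W) = Re (of_real ((cmod W)\<^sup>2 / pair_im s x) * (1 / Complex (pair_shift s x) (pair_im s x)))"
      unfolding K_def fst_conv snd_conv by (rule arg_cong)
    also have "\<dots> = (cmod W)\<^sup>2 / pair_im s x * Re (1 / Complex (pair_shift s x) (pair_im s x))"
      by (rule Re_of_real_mult)
    also have "Re (1 / Complex (pair_shift s x) (pair_im s x)) = pair_shift s x / ((pair_shift s x)\<^sup>2 + (pair_im s x)\<^sup>2)"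
      by (simp add: Re_divide)
    finally have "K (W, W) = (cmod W)\<^sup>2 / pair_im s x * (pair_shift s x / ((pair_shift s x)\<^sup>2 + (pair_im s x)\<^sup>2))" .
    then have "x * K (W, W) = (cmod W)\<^sup>2 / pair_im s x * (x * pair_shift s x) / ((pair_shift s x)\<^sup>2 + (pair_im s x)\<^sup>2)"
      by (simp add: field_simps)
    moreover have "(cmod W)\<^sup>2 / pair_im s x > 0" "(pair_shift s x)\<^sup>2 + (pair_im s x)\<^sup>2 > 0" "x * pair_shift s x > 0"
      using pair_shift_sgn[OF x, of s] s y Wnz by (auto intro: add_nonneg_pos)
    then have "(cmod W)\<^sup>2 / pair_im s x * (x * pair_shift s x) / ((pair_shift s x)\<^sup>2 + (pair_im s x)\<^sup>2) > 0"
      by (metis divide_pos_pos mult_pos_pos)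
    ultimately show ?thesis by simp
  qed
  have "isCont (\<lambda>uv. x * K uv) (W, W)"
    unfolding K_def M_def using Wnz Mnz unfolding M_def
    by (intro continuous_intros) auto
  then have "\<exists>d>0. \<forall>uv. dist uv (W, W) < d \<longrightarrow> dist (x * K uv) (x * K (W, W)) < x * K (W, W)"
    using KW unfolding continuous_at_eps_delta by blast
  then obtain d where d: "d > 0" "\<And>uv. dist uv (W, W) < d \<Longrightarrow> x * K uv > 0"
    by (force simp: dist_real_def)
  have key: "\<exists>c>0. (cmod u)\<^sup>2 - (cmod a)\<^sup>2 = c * (x * Im z)"
    if r: "cubic s u = z * u" "cubic s a = z * a"
      and n: "cmod (u - Complex (pair_mid s x) (pair_im s x)) < d / 2" "cmod (a - Complex (pair_mid s x) (- pair_im s x)) < d / 2"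
    for z u a
  proof -
    define v where "v = cnj a"
    have "cnj (a - Complex (pair_mid s x) (- pair_im s x)) = v - W"
      by (simp add: v_def W_def complex_eq_iff)
    then have n2: "cmod (v - W) < d / 2" using n(2) complex_mod_cnj by metis
    have "dist (u, v) (W, W) \<le> dist u W + dist v W"
      unfolding dist_Pair_Pair by (rule sqrt_sum_squares_le_sum) auto
    then have pos: "x * K (u, v) > 0"
      using n(1) n2 by (intro d(2)) (simp add: dist_norm W_def)
    have Mn: "M (u, v) \<noteq> 0"
    proof
      assume "M (u, v) = 0"
      then show False using pos by (simp add: K_def)
    qed
    have rv: "cubic s v = cnj z * v" unfolding v_def cubic_cnj r(2) by simp
    have "(u - v) * M (u, v) = z - cnj z"
      using root_pair_difference[OF s r(1) rv] by (simp add: M_def)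
    also have "\<dots> = 2 * \<i> * of_real (Im z)" by (simp add: complex_eq_iff)
    finally have uv: "u - v = 2 * \<i> * of_real (Im z) / M (u, v)" using Mn by (simp add: field_simps)
    have "(cmod u)\<^sup>2 - (cmod a)\<^sup>2 = (cmod u)\<^sup>2 - (cmod v)\<^sup>2" by (simp add: v_def)
    also have "\<dots> = Re ((u - v) * cnj (u + v))"
      by (simp add: cmod_power2) (simp add: algebra_simps power2_eq_square)
    also have "\<dots> = Re (of_real (2 * Im z) * (\<i> * cnj (u + v) / M (u, v)))"
      unfolding uv by (simp add: field_simps)
    also have "\<dots> = 2 * Im z * K (u, v)"
      unfolding K_def fst_conv snd_conv by (rule Re_of_real_mult)
    also have "\<dots> = (2 * (x * K (u, v)) / x\<^sup>2) * (x * Im z)"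
      using x by (simp add: field_simps power2_eq_square)
    finally show ?thesis using pos x by (intro exI[of _ "2 * (x * K (u, v)) / x\<^sup>2"]) auto
  qed
  show thesis
  proof (rule that[of "d / 2"])
    show "d / 2 > 0" using d by simp
  next
    fix z u a
    assume "cubic s u = z * u" "cubic s a = z * a" "cmod (u - Complex (pair_mid s x) (pair_im s x)) < d / 2"
      "cmod (a - Complex (pair_mid s x) (- pair_im s x)) < d / 2" "x * Im z > 0"
    then have "(cmod u)\<^sup>2 - (cmod a)\<^sup>2 > 0" using key by (metis mult_pos_pos)
    then show "cmod a < cmod u" by (simp add: power_less_imp_less_base)
  next
    fix z u a
    assume "cubic s u = z * u" "cubic s a = z * a" "cmod (u - Complex (pair_mid s x) (pair_im s x)) < d / 2"
      "cmod (a - Complex (pair_mid s x) (- pair_im s x)) < d / 2" "x * Im z < 0"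
    then have "(cmod u)\<^sup>2 - (cmod a)\<^sup>2 < 0" using key by (metis mult_pos_neg)
    then show "cmod u < cmod a" by (simp add: power_less_imp_less_base)
  qed
qed

text \<open>The sign \<open>k\<close> names the half-plane. The product of the distances of the
  solution to both members tends to 0, so it suffices to keep it away from the wrong member
  \<open>O'\<close>.\<close>

lemma pair_tendsto:
  assumes x: "x \<noteq> 0" and s: "s > 0" and D: "pair_disc s x \<ge> 0" and k: "k = 1 \<or> k = -1"
  shows "((\<lambda>z. wsol (pair_index x) z s) \<longlongrightarrow> Complex (pair_mid s x) (- k * sgn x * pair_im s x))
    (at (of_real x) within {z. k * Im z > 0})"
proof -
  let ?H = "at (complex_of_real x) within {z. k * Im z > 0}"
  define T O' where "T = Complex (pair_mid s x) (- k * sgn x * pair_im s x)" and "O' = Complex (pair_mid s x) (k * sgn x * pair_im s x)"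
  have sx: "sgn x = 1 \<or> sgn x = -1" using x by (simp add: sgn_if)
  define a b where "a = (\<lambda>z. wsol (pair_index x) z s)" and "b = (\<lambda>z. wsol (pair_index x + 1) z s)"
  have lim: "(f \<longlongrightarrow> l) ?H" if "(f \<longlongrightarrow> l) (at (complex_of_real x))" for f :: "complex \<Rightarrow> complex" and l
    by (rule tendsto_within_subset[OF that]) auto
  have ab: "((\<lambda>z. (a z - T) * (a z - O')) \<longlongrightarrow> 0) ?H"
    using lim[OF pair_quad_tendsto[OF x s D, of "pair_index x"]] k sx
    unfolding a_def T_def O'_def by (auto simp: mult.commute)
  have sum: "((\<lambda>z. a z + b z) \<longlongrightarrow> T + O') ?H"
  proof -
    have "T + O' = of_real (2 * pair_mid s x)" by (simp add: T_def O'_def complex_eq_iff)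
    then show ?thesis using lim[OF pair_sum_tendsto(1)[OF x s D]] by (simp add: a_def b_def)
  qed
  have "(a \<longlongrightarrow> T) ?H"
  proof (cases "pair_disc s x = 0")
    case True
    then have "T = O'" by (simp add: T_def O'_def pair_im_def)
    then have "((\<lambda>z. (a z - T)\<^sup>2) \<longlongrightarrow> 0) ?H" using ab by (simp add: power2_eq_square)
    then have "((\<lambda>z. cmod (a z - T) ^ 2) \<longlongrightarrow> 0) ?H"
      using tendsto_norm_zero[of "\<lambda>z. (a z - T)\<^sup>2"] by (simp add: norm_power)
    then have "((\<lambda>z. sqrt (cmod (a z - T) ^ 2)) \<longlongrightarrow> sqrt 0) ?H" by (intro tendsto_real_sqrt)
    then have "((\<lambda>z. cmod (a z - T)) \<longlongrightarrow> 0) ?H" by simp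
    then have "((\<lambda>z. a z - T) \<longlongrightarrow> 0) ?H" by (rule tendsto_norm_zero_cancel)
    then show ?thesis by (simp add: LIM_zero_iff)
  next
    case False
    then have D1: "pair_disc s x > 0" using D by simp
    obtain \<eta>0 where \<eta>0: "\<eta>0 > 0"
      "\<And>z u a. cubic s u = z * u \<Longrightarrow> cubic s a = z * a \<Longrightarrow> cmod (u - Complex (pair_mid s x) (pair_im s x)) < \<eta>0
        \<Longrightarrow> cmod (a - Complex (pair_mid s x) (- pair_im s x)) < \<eta>0 \<Longrightarrow> x * Im z > 0 \<Longrightarrow> cmod a < cmod u"
      "\<And>z u a. cubic s u = z * u \<Longrightarrow> cubic s a = z * a \<Longrightarrow> cmod (u - Complex (pair_mid s x) (pair_im s x)) < \<eta>0
        \<Longrightarrow> cmod (a - Complex (pair_mid s x) (- pair_im s x)) < \<eta>0 \<Longrightarrow> x * Im z < 0 \<Longrightarrow> cmod u < cmod a"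
      by (rule cmod_order_near_pair[OF x s D1]) (rule that)
    \<comment> \<open>Two errors below \<open>\<eta>\<close> add up: one from the sum of the pair,
      one from the distance to \<open>O'\<close>.\<close>
    define \<eta> where "\<eta> = \<eta>0 / 2"
    have \<eta>: "\<eta> > 0" using \<eta>0 by (simp add: \<eta>_def)
    have e1: "eventually (\<lambda>z. dist (a z + b z) (T + O') < \<eta>) ?H" using sum \<eta> by (rule tendstoD)
    have e2: "eventually (\<lambda>z. k * Im z > 0) ?H" by (simp add: eventually_at_filter)
    \<comment> \<open>If the first solution were near \<open>O'\<close>, the sum would put the
      second one near \<open>T\<close>, and \<open>cmod_order_near_pair\<close> would contradict the
      sorting.\<close>
    have far: "eventually (\<lambda>z. cmod (a z - O') \<ge> \<eta>) ?H"
      using e1 e2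
    proof eventually_elim
      case (elim z)
      show ?case
      proof (rule ccontr)
        assume "\<not> \<eta> \<le> cmod (a z - O')"
        then have aO: "cmod (a z - O') < \<eta>" by simp
        have "b z - T = (a z + b z - (T + O')) - (a z - O')" by simp
        then have "cmod (b z - T) \<le> cmod (a z + b z - (T + O')) + cmod (a z - O')"
          by (metis norm_triangle_ineq4)
        then have bT: "cmod (b z - T) < \<eta>0" using elim(1) aO by (simp add: dist_norm \<eta>_def)
        have aO': "cmod (a z - O') < \<eta>0" using aO \<eta>0(1) by (simp add: \<eta>_def)
        have le: "cmod (a z) \<le> cmod (b z)"
          using wsol_sorted[OF s, of z] unfolding a_def b_def by (auto simp: pair_index_def numeral_3_eq_3 numeral_2_eq_2)
        have ra: "cubic s (a z) = z * a z" unfolding a_def by (rule wsol_root[OF s]) (simp add: pair_index_def)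
        have rb: "cubic s (b z) = z * b z" unfolding b_def by (rule wsol_root[OF s]) (simp add: pair_index_def)
        consider "k * sgn x = 1" | "k * sgn x = -1" using k sx by auto
        then show False
        proof cases
          case 1
          then have "O' = Complex (pair_mid s x) (pair_im s x)" "T = Complex (pair_mid s x) (- pair_im s x)"
            by (simp_all add: T_def O'_def)
          moreover have "x * Im z > 0"
            using 1 elim(2) x k by (auto simp: sgn_if mult_less_0_iff zero_less_mult_iff split: if_splits)
          ultimately show False using \<eta>0(2)[OF ra rb] aO' bT le by auto
        next
          case 2
          then have "T = Complex (pair_mid s x) (pair_im s x)" "O' = Complex (pair_mid s x) (- pair_im s x)"
            by (simp_all add: T_def O'_def)
          moreover have "x * Im z < 0"
            using 2 elim(2) x k by (auto simp: sgn_if mult_less_0_iff zero_less_mult_iff split: if_splits)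
          ultimately show False using \<eta>0(3)[OF rb ra] aO' bT le by auto
        qed
      qed
    qed
    have "((\<lambda>z. ((a z - T) * (a z - O')) * (1 / (a z - O'))) \<longlongrightarrow> 0) ?H"
    proof (rule lim_null_mult_right_bounded[OF ab])
      show "eventually (\<lambda>z. norm (1 / (a z - O')) \<le> 1 / \<eta>) ?H"
        using far by eventually_elim (use \<eta> in \<open>auto simp: norm_divide intro!: divide_left_mono mult_pos_pos\<close>)
    qed
    moreover have "eventually (\<lambda>z. ((a z - T) * (a z - O')) * (1 / (a z - O')) = a z - T) ?H"
      using far by eventually_elim (use \<eta> in auto)
    ultimately have "((\<lambda>z. a z - T) \<longlongrightarrow> 0) ?H" by (rule Lim_transform_eventually)
    then show ?thesis by (simp add: LIM_zero_iff)
  qed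
  then show ?thesis by (simp add: a_def T_def)
qed

lemma half_plane_limit_point:
  assumes k: "k = 1 \<or> k = (-1::real)"
  shows "at (complex_of_real x) within {z. k * Im z > 0} \<noteq> bot"
proof -
  have "complex_of_real x islimpt {z. k * Im z > 0}"
    unfolding islimpt_approachable
  proof (intro allI impI)
    fix e :: real assume "e > 0"
    then show "\<exists>x'\<in>{z. k * Im z > 0}. x' \<noteq> of_real x \<and> dist x' (of_real x) < e"
      using k by (intro bexI[of _ "Complex x (k * e / 2)"])
        (auto simp: dist_norm complex_eq_iff cmod_def)
  qed
  then show ?thesis by (simp add: trivial_limit_within)
qed

lemma z_pm_eq:
  assumes x: "x \<noteq> 0" and s: "s > 0" and D: "pair_disc s x \<ge> 0"
  shows "z_plus p q (pair_index x) x s = of_real (h s) / Complex (pair_mid s x) (- sgn x * pair_im s x)"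
    and "z_minus p q (pair_index x) x s = of_real (h s) / Complex (pair_mid s x) (sgn x * pair_im s x)"
proof -
  have j: "pair_index x \<in> {1,2,3}" by (simp add: pair_index_def)
  have nz: "Complex (pair_mid s x) (c * pair_im s x) \<noteq> 0" if c: "c = 1 \<or> c = -1" for c
  proof
    assume "Complex (pair_mid s x) (c * pair_im s x) = 0"
    then have "pair_mid s x = 0" "pair_im s x = 0" using c by (auto simp: complex_eq_iff)
    then show False using pair_mid_pair_disc_pos[OF x s] D by (simp add: pair_im_def)
  qed
  have sx: "sgn x = 1 \<or> sgn x = -1" using x by (simp add: sgn_if)
  have "((\<lambda>z. zsol p q (pair_index x) z s) \<longlongrightarrow> of_real (h s) / Complex (pair_mid s x) (- k * sgn x * pair_im s x))
    (at (of_real x) within {z. k * Im z > 0})" if k: "k = 1 \<or> k = -1" for k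
    unfolding zsol_wsol[OF s j]
    using nz[of "- k * sgn x"] k sx
    by (intro tendsto_divide tendsto_const pair_tendsto[OF x s D k]) auto
  from this[of 1] this[of "-1"] show
    "z_plus p q (pair_index x) x s = of_real (h s) / Complex (pair_mid s x) (- sgn x * pair_im s x)"
    "z_minus p q (pair_index x) x s = of_real (h s) / Complex (pair_mid s x) (sgn x * pair_im s x)"
    unfolding z_plus_def z_minus_def
    using half_plane_limit_point[of 1 x] half_plane_limit_point[of "-1" x]
    by (auto intro!: tendsto_Lim)
qed

section \<open>The measures\<close>

definition e2_const :: "real \<Rightarrow> real" where
  "e2_const s = s * (s + p) + s * (s + p + q) + (s + p) * (s + p + q)"

text \<open>
  The discriminant of the cubic. Being polynomial in \<open>x\<close>, it shows that the condition on the sign of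
  \<open>pair_disc\<close> is open or closed, also at \<open>x = 0\<close>, where \<open>pair_disc\<close> has no meaning.
\<close>

definition disc :: "real \<Rightarrow> real \<Rightarrow> real" where
  "disc s x = (root_sum s)\<^sup>2 * (e2_const s - x)\<^sup>2 - 4 * (e2_const s - x) ^ 3 - 4 * (root_sum s) ^ 3 * h s - 27 * (h s)\<^sup>2
     + 18 * root_sum s * (e2_const s - x) * h s"

text \<open>The discriminant is the product of the squared differences of the roots, written with
  the real root and the conjugate pair.\<close>

lemma disc_eq:
  assumes "x \<noteq> 0" "s \<ge> 0"
  shows "disc s x = - 4 * pair_disc s x * ((pair_shift s x)\<^sup>2 + pair_disc s x)\<^sup>2"
proof -
  define w r D where "w = w_real s x" and "r = pair_mid s x" and "D = pair_disc s x"
  have e1: "root_sum s = - (w + 2 * r)"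
    by (simp add: w_real_def pair_mid_def root_sum_def w_def r_def field_simps)
  have e2: "e2_const s - x = 2 * r * w + r^2 + D"
    by (simp add: w_real_def pair_mid_def pair_disc_def e2_const_def w_def r_def D_def power2_eq_square field_simps)
  have e3: "h s = - (w * (r^2 + D))"
    using w_real_prod[OF assms] by (simp add: w_def r_def D_def)
  have t: "pair_shift s x = r - w" by (simp add: pair_shift_eq w_def r_def)
  show ?thesis
    unfolding disc_def e1 e2 e3 t D_def[symmetric]
    by (simp add: power2_eq_square power3_eq_cube algebra_simps)
qed

text \<open>For \<open>x = 0\<close> the roots are \<open>- s\<close>, \<open>- s - p\<close> and
  \<open>- s - p - q\<close>. The value is positive, which keeps 0 out of the supports.\<close>

lemma disc_zero: "disc s 0 = (p * q * (p + q))\<^sup>2"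
  unfolding disc_def root_sum_def e2_const_def h_def
  by (simp add: power2_eq_square power3_eq_cube algebra_simps)

lemma disc_sign:
  assumes "x \<noteq> 0" "s \<ge> 0"
  shows "disc s x < 0 \<longleftrightarrow> pair_disc s x > 0" "disc s x = 0 \<longleftrightarrow> pair_disc s x = 0"
    "disc s x \<le> 0 \<longleftrightarrow> pair_disc s x \<ge> 0"
proof -
  have "((pair_shift s x)\<^sup>2 + pair_disc s x)\<^sup>2 > 0" using pair_shift_pair_disc_pos[OF assms] by simp
  then show "disc s x < 0 \<longleftrightarrow> pair_disc s x > 0" "disc s x = 0 \<longleftrightarrow> pair_disc s x = 0" "disc s x \<le> 0 \<longleftrightarrow> pair_disc s x \<ge> 0"
    unfolding disc_eq[OF assms] by (auto simp: mult_less_0_iff mult_le_0_iff zero_less_mult_iff zero_le_mult_iff)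
qed

lemma disc_cont [continuous_intros]: "continuous_on A f \<Longrightarrow> continuous_on A (\<lambda>x. disc s (f x))"
  unfolding disc_def by (intro continuous_intros)

lemma finite_disc_zero: "finite {x. disc s x = 0}"
proof -
  define P where "P = [:- 4 * (root_sum s) ^ 3 * h s - 27 * (h s)\<^sup>2, 18 * root_sum s * h s, (root_sum s)\<^sup>2, - 4:]"
  have "disc s x = poly P (e2_const s - x)" for x
    unfolding disc_def P_def by (simp add: power2_eq_square power3_eq_cube algebra_simps)
  then have "{x. disc s x = 0} = (\<lambda>u. e2_const s - u) ` {u. poly P u = 0}"
    by (force intro: image_eqI[of _ _ "e2_const s - _"])
  moreover have "P \<noteq> 0" by (simp add: P_def)
  ultimately show ?thesis using poly_roots_finite[of P] by simp
qed

definition pair_pt :: "real \<Rightarrow> real \<Rightarrow> real \<Rightarrow> complex" where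
  "pair_pt k s x = Complex (pair_mid s x) (k * pair_im s x)"

lemma pair_pt_root:
  assumes x: "x \<noteq> 0" and s: "s > 0" and D: "pair_disc s x \<ge> 0" and k: "k = 1 \<or> k = -1"
  shows "cubic s (pair_pt k s x) = of_real x * pair_pt k s x"
proof -
  have "(pair_pt k s x - of_real (pair_mid s x))\<^sup>2 = - of_real (pair_disc s x)"
  proof -
    have "pair_pt k s x - of_real (pair_mid s x) = \<i> * of_real (k * pair_im s x)" by (simp add: pair_pt_def complex_eq_iff)
    moreover have "(\<i> * complex_of_real c)\<^sup>2 = - of_real (c\<^sup>2)" for c by (simp add: power_mult_distrib)
    moreover have "(k * pair_im s x)\<^sup>2 = pair_disc s x" using k D by (auto simp: pair_im_def power_mult_distrib)
    ultimately show ?thesis by (simp only:)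
  qed
  then show ?thesis using real_factor[of x s "pair_pt k s x"] x s by simp
qed

lemma open_oval: "open {x. x \<noteq> 0 \<and> disc s x < 0}"
proof -
  have "open {x. disc s x < 0}" by (intro open_Collect_less continuous_intros)
  moreover have "open (- {0::real})" by auto
  moreover have "{x. x \<noteq> 0 \<and> disc s x < 0} = - {0} \<inter> {x. disc s x < 0}" by auto
  ultimately show ?thesis by (metis open_Int)
qed

lemma eventually_oval:
  assumes x: "x \<noteq> 0" and s: "s > 0" and D: "pair_disc s x > 0"
  shows "eventually (\<lambda>t. t \<noteq> 0 \<and> sgn t = sgn x \<and> pair_disc s t > 0) (nhds x)"
proof -
  have "eventually (\<lambda>t. t \<in> {x. x \<noteq> 0 \<and> disc s x < 0}) (nhds x)"
    using x s D disc_sign(1)[OF x] by (intro eventually_nhds_in_open open_oval) auto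
  moreover have "eventually (\<lambda>t. t \<in> {t. x * t > 0}) (nhds x)"
    using x by (intro eventually_nhds_in_open open_Collect_less continuous_intros) (auto simp: zero_less_mult_iff)
  ultimately show ?thesis
    by eventually_elim (use s disc_sign(1) in \<open>auto simp: sgn_if zero_less_mult_iff\<close>)
qed

text \<open>The cubic for \<open>t\<close>, evaluated at the pair point for \<open>x\<close>, equals
  \<open>(x - t)\<close> times that point. Two of its three linear factors have modulus at least
  \<open>pair_im s x\<close>, because their other endpoint is real or in the opposite
  half-plane.\<close>

lemma pair_pt_lipschitz:
  assumes x: "x \<noteq> 0" "t \<noteq> 0" and s: "s > 0" and D: "pair_disc s x > 0" "pair_disc s t > 0" and k: "k = 1 \<or> k = -1"
  shows "cmod (pair_pt k s t - pair_pt k s x) \<le> \<bar>t - x\<bar> * cmod (pair_pt k s x) / (pair_im s x)\<^sup>2"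
proof -
  let ?W = "pair_pt k s x" and ?V = "pair_pt k s t" and ?U = "pair_pt (- k) s t"
  have y: "pair_im s x > 0" "pair_im s t > 0" using D by (auto simp: pair_im_def)
  have VU: "(z - of_real (pair_mid s t))\<^sup>2 + of_real (pair_disc s t) = (z - ?V) * (z - ?U)" for z
  proof -
    have y2: "of_real (k * pair_im s t) * of_real (k * pair_im s t) = complex_of_real (pair_disc s t)"
      using D k by (auto simp: pair_im_def simp flip: of_real_mult)
    have "?V = of_real (pair_mid s t) + \<i> * of_real (k * pair_im s t)" "?U = of_real (pair_mid s t) - \<i> * of_real (k * pair_im s t)"
      by (simp_all add: pair_pt_def complex_eq_iff)
    then have "(z - ?V) * (z - ?U) = (z - of_real (pair_mid s t))\<^sup>2 + of_real (k * pair_im s t) * of_real (k * pair_im s t)"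
      by (simp only:) (simp add: power2_eq_square algebra_simps)
    then show ?thesis unfolding y2 by simp
  qed
  have "(?W - of_real (w_real s t)) * ((?W - ?V) * (?W - ?U)) = cubic s ?W - of_real t * ?W"
    using real_factor[of t s ?W] x s unfolding VU by simp
  also have "\<dots> = of_real (x - t) * ?W"
    using pair_pt_root[OF x(1) s _ k] D by (simp add: algebra_simps)
  finally have "cmod (?W - of_real (w_real s t)) * (cmod (?W - ?V) * cmod (?W - ?U)) = \<bar>x - t\<bar> * cmod ?W"
    by (metis norm_mult norm_of_real)
  moreover have "pair_im s x \<le> cmod (?W - of_real (w_real s t))"
    using abs_Im_le_cmod[of "?W - of_real (w_real s t)"] k y by (auto simp: pair_pt_def)
  moreover have "pair_im s x \<le> cmod (?W - ?U)"
    using abs_Im_le_cmod[of "?W - ?U"] k y by (auto simp: pair_pt_def)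
  ultimately have "pair_im s x * (cmod (?W - ?V) * pair_im s x) \<le> \<bar>x - t\<bar> * cmod ?W"
    using y by (metis mult_mono norm_ge_zero less_imp_le mult_nonneg_nonneg order_refl)
  then have "cmod (?W - ?V) \<le> \<bar>x - t\<bar> * cmod ?W / (pair_im s x)\<^sup>2"
    using y by (simp add: field_simps power2_eq_square)
  then show ?thesis by (simp add: norm_minus_commute abs_minus_commute)
qed

text \<open>By \<open>root_pair_difference\<close> the increment is exactly
  \<open>(t - x) / M t\<close>, and \<open>M\<close> is continuous at \<open>x\<close> once
  \<open>pair_pt\<close> is.\<close>

lemma pair_pt_deriv:
  assumes x: "x \<noteq> 0" and s: "s > 0" and D: "pair_disc s x > 0" and k: "k = 1 \<or> k = -1"
  shows "(pair_pt k s has_vector_derivative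
     (pair_pt k s x / (2 * \<i> * of_real (k * pair_im s x) * Complex (pair_shift s x) (k * pair_im s x)))) (at x)"
proof -
  let ?W = "pair_pt k s x"
  define M where "M = (\<lambda>t. pair_pt k s t + ?W + of_real (root_sum s) - of_real (h s) / (pair_pt k s t * ?W))"
  have y: "pair_im s x > 0" using D by (simp add: pair_im_def)
  have Wnz: "?W \<noteq> 0" using y k by (auto simp: pair_pt_def complex_eq_iff)
  have ev: "eventually (\<lambda>t. t \<noteq> 0 \<and> sgn t = sgn x \<and> pair_disc s t > 0) (at x)"
    using eventually_oval[OF x s D] by (auto simp: eventually_at_filter elim: eventually_mono)
  have lim: "(pair_pt k s \<longlongrightarrow> ?W) (at x)"
  proof (rule LIM_zero_cancel, rule Lim_null_comparison)
    show "eventually (\<lambda>t. norm (pair_pt k s t - ?W) \<le> \<bar>t - x\<bar> * cmod ?W / (pair_im s x)\<^sup>2) (at x)"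
      using ev by eventually_elim (use pair_pt_lipschitz[OF x _ s D _ k] in auto)
    show "((\<lambda>t. \<bar>t - x\<bar> * cmod ?W / (pair_im s x)\<^sup>2) \<longlongrightarrow> 0) (at x)"
      using y by (auto intro!: tendsto_eq_intros)
  qed
  have WM: "?W * M x = 2 * \<i> * of_real (k * pair_im s x) * Complex (pair_shift s x) (k * pair_im s x)"
    using difference_quotient_at_pair[OF x s D k] by (simp add: M_def pair_pt_def)
  moreover have "2 * \<i> * of_real (k * pair_im s x) * Complex (pair_shift s x) (k * pair_im s x) \<noteq> 0"
    using y k by (auto simp: complex_eq_iff)
  ultimately have Mnz: "M x \<noteq> 0" by auto
  have Mlim: "(M \<longlongrightarrow> M x) (at x)"
    unfolding M_def by (intro tendsto_intros lim) (use Wnz in auto)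
  have eq: "eventually (\<lambda>t. (pair_pt k s t - ?W) * M t = of_real (t - x)) (at x)"
    using ev
  proof eventually_elim
    case (elim t)
    then show ?case
      using root_pair_difference[OF s pair_pt_root[of t s k] pair_pt_root[of x s k]] x s D k
      by (simp add: M_def)
  qed
  have q: "((\<lambda>t. 1 / M t - 1 / M x) \<longlongrightarrow> 0) (at x)"
    using Mlim Mnz by (auto intro!: tendsto_eq_intros)
  have Mne: "eventually (\<lambda>t. M t \<noteq> 0) (at x)"
    using tendsto_imp_eventually_ne[OF Mlim Mnz] .
  have "(pair_pt k s has_vector_derivative 1 / M x) (at x)"
    unfolding has_vector_derivative_def has_derivative_iff_norm
  proof (intro conjI)
    show "bounded_linear (\<lambda>t. t *\<^sub>R (1 / M x))" by (rule bounded_linear_scaleR_left)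
    have "((\<lambda>t. norm (1 / M t - 1 / M x)) \<longlongrightarrow> 0) (at x)" using tendsto_norm_zero[OF q] .
    moreover have "eventually (\<lambda>t. norm (1 / M t - 1 / M x)
        = norm (pair_pt k s t - ?W - (t - x) *\<^sub>R (1 / M x)) / norm (t - x)) (at x)"
    proof -
      have "eventually (\<lambda>t. t \<noteq> x) (at x)" by (simp add: eventually_at_filter)
      with eq Mne show ?thesis
      proof eventually_elim
        case (elim t)
        then have "pair_pt k s t - ?W = of_real (t - x) / M t" by (simp add: field_simps)
        then have "pair_pt k s t - ?W - (t - x) *\<^sub>R (1 / M x) = of_real (t - x) * (1 / M t - 1 / M x)"
          by (simp only: scaleR_conv_of_real right_diff_distrib) (simp del: of_real_diff)
        then show ?case using elim by (simp add: norm_mult del: of_real_diff)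
      qed
    qed
    ultimately show "((\<lambda>t. norm (pair_pt k s t - ?W - (t - x) *\<^sub>R (1 / M x)) / norm (t - x)) \<longlongrightarrow> 0) (at x)"
      by (rule Lim_transform_eventually)
  qed
  moreover have "1 / M x = ?W / (2 * \<i> * of_real (k * pair_im s x) * Complex (pair_shift s x) (k * pair_im s x))"
    unfolding WM[symmetric] using Wnz by simp
  ultimately show ?thesis by simp
qed

definition mu_kernel :: "real \<Rightarrow> real \<Rightarrow> real" where
  "mu_kernel s x = \<bar>pair_shift s x\<bar> / (2 * pi * sqrt (pair_disc s x) * ((pair_shift s x)\<^sup>2 + pair_disc s x))"

text \<open>Since \<open>z\<close> is \<open>h s\<close> divided by the pair point, its logarithmic
  derivative is minus that of the pair point.\<close>

lemma log_deriv_quotient: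
  assumes x: "x \<noteq> 0" and s: "s > 0" and D: "pair_disc s x > 0" and k: "k = 1 \<or> k = -1"
    and f: "\<And>t. t \<noteq> 0 \<Longrightarrow> sgn t = sgn x \<Longrightarrow> pair_disc s t \<ge> 0 \<Longrightarrow> f t = of_real (h s) / pair_pt k s t"
  shows "vector_derivative f (at x) / f x
     = - 1 / (2 * \<i> * of_real (k * pair_im s x) * Complex (pair_shift s x) (k * pair_im s x))"
proof -
  let ?W = "pair_pt k s x"
  define E where "E = 2 * \<i> * of_real (k * pair_im s x) * Complex (pair_shift s x) (k * pair_im s x)"
  have y: "pair_im s x > 0" using D by (simp add: pair_im_def)
  have Wnz: "?W \<noteq> 0" using y k by (auto simp: pair_pt_def complex_eq_iff)
  have H: "of_real (h s) \<noteq> (0 :: complex)" using h_pos[OF s] by simp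
  have "((\<lambda>w. of_real (h s) / w) has_field_derivative - of_real (h s) / (?W * ?W)) (at ?W)"
    using Wnz by (auto intro!: derivative_eq_intros)
  from field_vector_diff_chain_at[OF pair_pt_deriv[OF x s D k] this]
  have "((\<lambda>t. of_real (h s) / pair_pt k s t) has_vector_derivative ?W / E * (- of_real (h s) / (?W * ?W))) (at x)"
    by (simp add: o_def E_def)
  moreover have "eventually (\<lambda>t. of_real (h s) / pair_pt k s t = f t) (nhds x)"
    using eventually_oval[OF x s D] by eventually_elim (use f in auto)
  ultimately have "(f has_vector_derivative ?W / E * (- of_real (h s) / (?W * ?W))) (at x)"
    using has_vector_derivative_cong_ev[of UNIV "\<lambda>t. of_real (h s) / pair_pt k s t" f x] f x D
    by (simp add: eventually_mono)
  then have "vector_derivative f (at x) = ?W / E * (- of_real (h s) / (?W * ?W))"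
    by (rule vector_derivative_at)
  moreover have "f x = of_real (h s) / ?W" using f x D by simp
  ultimately show ?thesis unfolding E_def[symmetric] using Wnz H by (simp add: field_simps)
qed

lemma mu_dens_eq:
  assumes x: "x \<noteq> 0" and s: "s > 0" and D: "pair_disc s x > 0"
  shows "mu_dens p q (pair_index x) s x = of_real (mu_kernel s x)"
proof -
  \<comment> \<open>The boundary values from above and below trade the two conjugates when
    \<open>x\<close> changes sign; \<open>e\<close> records this and also turns
    \<open>pair_shift\<close> into its absolute value.\<close>
  define e where "e = sgn x"
  have e: "e = 1 \<or> e = -1" using x by (simp add: e_def sgn_if)
  have je: "pair_index t = pair_index x" if "sgn t = sgn x" "t \<noteq> 0" for t
    using that x by (auto simp: pair_index_def sgn_if split: if_splits)
  have y: "pair_im s x > 0" using D by (simp add: pair_im_def)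
  have y2: "(pair_im s x)\<^sup>2 = pair_disc s x" using D by (simp add: pair_im_def)
  have te: "\<bar>pair_shift s x\<bar> = e * pair_shift s x"
    using pair_shift_sgn[OF x, of s] s by (auto simp: e_def sgn_if zero_less_mult_iff)
  have zp: "z_plus p q (pair_index x) t s = of_real (h s) / pair_pt (- e) s t"
    "z_minus p q (pair_index x) t s = of_real (h s) / pair_pt e s t"
    if "t \<noteq> 0" "sgn t = sgn x" "pair_disc s t \<ge> 0" for t
    using z_pm_eq[OF that(1) s that(3)] unfolding je[OF that(2,1)] that(2) by (simp_all add: pair_pt_def e_def)
  have 1: "vector_derivative (\<lambda>t. z_plus p q (pair_index x) t s) (at x) / z_plus p q (pair_index x) x s
     = - 1 / (2 * \<i> * of_real (- e * pair_im s x) * Complex (pair_shift s x) (- e * pair_im s x))"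
    by (rule log_deriv_quotient[OF x s D _ zp(1)]) (use e in auto)
  have 2: "vector_derivative (\<lambda>t. z_minus p q (pair_index x) t s) (at x) / z_minus p q (pair_index x) x s
     = - 1 / (2 * \<i> * of_real (e * pair_im s x) * Complex (pair_shift s x) (e * pair_im s x))"
    by (rule log_deriv_quotient[OF x s D e zp(2)])
  define T Y where "T = complex_of_real (pair_shift s x)" and "Y = complex_of_real (pair_im s x)"
  have Ynz: "Y \<noteq> 0" using y by (simp add: Y_def)
  have pos: "T\<^sup>2 + Y\<^sup>2 \<noteq> 0"
  proof -
    have "(pair_shift s x)\<^sup>2 + (pair_im s x)\<^sup>2 > 0" using pair_shift_pair_disc_pos[OF x, of s] s y2 by simp
    moreover have "T\<^sup>2 + Y\<^sup>2 = of_real ((pair_shift s x)\<^sup>2 + (pair_im s x)\<^sup>2)" by (simp add: T_def Y_def)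
    ultimately show ?thesis by (metis less_irrefl of_real_eq_0_iff)
  qed
  have f: "T\<^sup>2 + Y\<^sup>2 = (T + \<i> * Y) * (T - \<i> * Y)" by (simp add: power2_eq_square algebra_simps)
  then have nz: "T + \<i> * Y \<noteq> 0" "T - \<i> * Y \<noteq> 0" using pos by auto
  have core: "1 / (2 * of_real pi * \<i>) * (- 1 / (2 * \<i> * Y * (T + \<i> * Y)) - - 1 / (2 * \<i> * (- Y) * (T - \<i> * Y)))
      = T / (2 * of_real pi * Y * (T\<^sup>2 + Y\<^sup>2))"
  proof -
    have "- 1 / (2 * \<i> * Y * A) - - 1 / (2 * \<i> * (- Y) * B) = - (1 / (2 * \<i> * Y)) * (1 / A + 1 / B)" for A B
      by (simp add: distrib_left mult.assoc)
    note this[of "T + \<i> * Y" "T - \<i> * Y"]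
    also have "1 / (T + \<i> * Y) + 1 / (T - \<i> * Y) = 2 * T / (T\<^sup>2 + Y\<^sup>2)"
      unfolding f using nz by (simp add: field_simps)
    finally have E: "- 1 / (2 * \<i> * Y * (T + \<i> * Y)) - - 1 / (2 * \<i> * (- Y) * (T - \<i> * Y))
        = - (1 / (2 * \<i> * Y)) * (2 * T / (T\<^sup>2 + Y\<^sup>2))" .
    define S where "S = T\<^sup>2 + Y\<^sup>2"
    show ?thesis unfolding E S_def[symmetric] using Ynz pos[folded S_def] by (simp add: field_simps)
  qed
  have C: "Complex (pair_shift s x) (pair_im s x) = T + \<i> * Y" "Complex (pair_shift s x) (- pair_im s x) = T - \<i> * Y"
    by (simp_all add: T_def Y_def complex_eq_iff)
  have "mu_dens p q (pair_index x) s x = of_real e * T / (2 * of_real pi * Y * (T\<^sup>2 + Y\<^sup>2))"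
    unfolding mu_dens_def 1 2
  proof (cases "e = 1")
    case True
    then show "1 / (2 * complex_of_real pi * \<i>) * (- 1 / (2 * \<i> * of_real (e * pair_im s x) * Complex (pair_shift s x) (e * pair_im s x))
      - - 1 / (2 * \<i> * of_real (- e * pair_im s x) * Complex (pair_shift s x) (- e * pair_im s x)))
      = of_real e * T / (2 * of_real pi * Y * (T\<^sup>2 + Y\<^sup>2))"
      using core by (simp add: C Y_def[symmetric])
  next
    case False
    then have "e = -1" using e by simp
    moreover have "1 / (2 * complex_of_real pi * \<i>) * (- 1 / (2 * \<i> * (- Y) * (T - \<i> * Y)) - - 1 / (2 * \<i> * Y * (T + \<i> * Y)))
      = - (T / (2 * of_real pi * Y * (T\<^sup>2 + Y\<^sup>2)))"
      unfolding core[symmetric] by (simp add: algebra_simps)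
    ultimately show "1 / (2 * complex_of_real pi * \<i>) * (- 1 / (2 * \<i> * of_real (e * pair_im s x) * Complex (pair_shift s x) (e * pair_im s x))
      - - 1 / (2 * \<i> * of_real (- e * pair_im s x) * Complex (pair_shift s x) (- e * pair_im s x)))
      = of_real e * T / (2 * of_real pi * Y * (T\<^sup>2 + Y\<^sup>2))"
      by (simp add: C Y_def[symmetric])
  qed
  also have "\<dots> = of_real (e * pair_shift s x / (2 * pi * pair_im s x * ((pair_shift s x)\<^sup>2 + (pair_im s x)\<^sup>2)))"
    by (simp add: T_def Y_def)
  also have "e * pair_shift s x / (2 * pi * pair_im s x * ((pair_shift s x)\<^sup>2 + (pair_im s x)\<^sup>2)) = mu_kernel s x"
    unfolding mu_kernel_def te y2 by (simp add: pair_im_def)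
  finally show ?thesis .
qed

section \<open>Joint measurability in \<open>s\<close> and \<open>x\<close>, and the density of
  \<open>mu\<close>\<close>

lemma F_le_iff:
  assumes x: "x \<noteq> 0" and v: "v \<in> real_branch x" and u: "u \<in> real_branch x"
  shows "x < 0 \<Longrightarrow> F x v \<le> F x u \<longleftrightarrow> v \<le> u" "x > 0 \<Longrightarrow> F x v \<le> F x u \<longleftrightarrow> u \<le> v"
proof -
  define Q where "Q = h_quot v u - x"
  have Q: "Q > 0" using h_quot_lower[OF x v u] branch_gap_pos[OF x] by (simp add: Q_def)
  have d: "F x v - F x u = (u - v) * (Q / x)" using F_diff[OF x, of v u] by (simp add: Q_def)
  have "x < 0 \<Longrightarrow> Q / x < 0" "x > 0 \<Longrightarrow> Q / x > 0" using Q by (auto simp: divide_pos_neg)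
  then have "x < 0 \<Longrightarrow> (u - v) * (Q / x) \<le> 0 \<longleftrightarrow> v \<le> u" "x > 0 \<Longrightarrow> (u - v) * (Q / x) \<le> 0 \<longleftrightarrow> u \<le> v"
    by (auto simp only: mult_le_0_iff) auto
  then show "x < 0 \<Longrightarrow> F x v \<le> F x u \<longleftrightarrow> v \<le> u" "x > 0 \<Longrightarrow> F x v \<le> F x u \<longleftrightarrow> u \<le> v"
    unfolding d[symmetric] by auto
qed

text \<open>By monotonicity of \<open>F x\<close>, a bound on the implicitly defined root becomes an
  explicit inequality in \<open>s\<close> and \<open>x\<close>, which gives joint
  measurability.\<close>

lemma v_real_le_iff:
  assumes x: "x \<noteq> 0" and s: "s \<ge> 0"
  shows "v_real s x \<le> a \<longleftrightarrow> (x < 0 \<and> 0 \<le> a \<and> s \<le> F x a) \<or> (x > 0 \<and> (end_zero x \<le> a \<or> F x a \<le> s))"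
proof (cases "x < 0")
  case True
  then show ?thesis
    using F_le_iff(1)[OF x v_real_spec(1)[OF x s], of a] v_real_neg[OF True s] v_real_spec(2)[OF x s]
    by (cases "a \<ge> 0") (auto simp: real_branch_def)
next
  case False
  then have x0: "x > 0" using x by simp
  then show ?thesis
    using F_le_iff(2)[OF x _ v_real_spec(1)[OF x s], of a] v_real_pos[OF x0 s] v_real_spec(2)[OF x s]
    by (cases "a < end_zero x") (auto simp: real_branch_def)
qed

definition v_real_total :: "real \<times> real \<Rightarrow> real" where
  "v_real_total z = (if fst z > 0 \<and> snd z \<noteq> 0 then v_real (fst z) (snd z) else 0)"

lemma v_real_total_measurable [measurable]: "v_real_total \<in> borel_measurable (borel \<Otimes>\<^sub>M borel)"
proof (rule borel_measurable_iff_le[THEN iffD2], rule allI)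
  fix a :: real
  have "{z \<in> space (borel \<Otimes>\<^sub>M borel). v_real_total z \<le> a} =
    {z \<in> space (borel \<Otimes>\<^sub>M borel). (fst z > 0 \<and> snd z < 0 \<and> 0 \<le> a \<and> fst z \<le> a - h a / snd z) \<or>
       (fst z > 0 \<and> snd z > 0 \<and> ((- (2 * p + q) - sqrt (q^2 + 4 * snd z)) / 2 \<le> a \<or> a - h a / snd z \<le> fst z)) \<or>
       ((fst z \<le> 0 \<or> snd z = 0) \<and> 0 \<le> a)}"
    by (auto simp: v_real_total_def v_real_le_iff F_def end_zero_def sqrt_qx_def)
  also have "\<dots> \<in> sets (borel \<Otimes>\<^sub>M borel)" by measurable
  finally show "{z \<in> space (borel \<Otimes>\<^sub>M borel). v_real_total z \<le> a} \<in> sets (borel \<Otimes>\<^sub>M borel)" .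
qed

definition mu_kernel_on :: "nat \<Rightarrow> real \<Rightarrow> real \<Rightarrow> real" where
  "mu_kernel_on j s x = (if s > 0 \<and> x \<noteq> 0 \<and> j = pair_index x \<and> pair_disc s x > 0 then mu_kernel s x else 0)"

lemma mu_kernel_on_nonneg: "mu_kernel_on j s x \<ge> 0"
  by (auto simp: mu_kernel_on_def mu_kernel_def intro!: divide_nonneg_nonneg mult_nonneg_nonneg add_nonneg_nonneg)

lemma mu_kernel_on_measurable [measurable]: "case_prod (mu_kernel_on j) \<in> borel_measurable (borel \<Otimes>\<^sub>M borel)"
proof -
  define T where "T = (\<lambda>z. - (3 * v_real_total z + 2 * p + q) / 2)"
  define D where "D = (\<lambda>z. p * (p + q) - snd z + (v_real_total z + 2 * p + q) * (3 * v_real_total z - 2 * p - q) / 4)"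
  have [measurable]: "T \<in> borel_measurable (borel \<Otimes>\<^sub>M borel)" "D \<in> borel_measurable (borel \<Otimes>\<^sub>M borel)"
    unfolding T_def D_def by measurable
  have "case_prod (mu_kernel_on j) = (\<lambda>z. if fst z > 0 \<and> snd z \<noteq> 0 \<and> ((j = 1 \<and> snd z > 0) \<or> (j = 2 \<and> \<not> snd z > 0)) \<and> D z > 0
     then \<bar>T z\<bar> / (2 * pi * sqrt (D z) * ((T z)\<^sup>2 + D z)) else 0)"
    by (auto simp: mu_kernel_on_def fun_eq_iff pair_index_def T_def D_def v_real_total_def mu_kernel_def pair_shift_def pair_disc_def)
  also have "\<dots> \<in> borel_measurable (borel \<Otimes>\<^sub>M borel)" by measurable
  finally show ?thesis .
qed

lemma mu_kernel_on_measurable_snd [measurable]: "mu_kernel_on j s \<in> borel_measurable borel"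
  and mu_kernel_on_measurable_fst [measurable]: "(\<lambda>s. mu_kernel_on j s x) \<in> borel_measurable borel"
proof -
  have 1: "(\<lambda>x. (s, x)) \<in> borel \<rightarrow>\<^sub>M borel \<Otimes>\<^sub>M (borel :: real measure)" by measurable
  have 2: "(\<lambda>s. (s, x)) \<in> borel \<rightarrow>\<^sub>M (borel :: real measure) \<Otimes>\<^sub>M borel" by measurable
  show "mu_kernel_on j s \<in> borel_measurable borel"
    using measurable_compose[OF 1 mu_kernel_on_measurable[of j]] by simp
  show "(\<lambda>s. mu_kernel_on j s x) \<in> borel_measurable borel"
    using measurable_compose[OF 2 mu_kernel_on_measurable[of j]] by simp
qed

text \<open>The defining integrand rests on an arbitrary choice of order, so its measurability is
  not evident. It agrees with the kernel off the finite set \<open>X\<close>, and this yields both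
  measurability and equality of the measures.\<close>

lemma mu_eq:
  assumes s: "s > 0" and j: "j \<in> {1, 2}"
  shows "mu p q j s = density lborel (\<lambda>x. ennreal (mu_kernel_on j s x))"
proof -
  define X where "X = insert 0 {x. disc s x = 0}"
  define f where "f = (\<lambda>x. ennreal (Re (mu_dens p q j s x)) * indicator {x. complex_of_real x \<in> Gam p q j s} x)"
  have fin: "finite X" using finite_disc_zero by (simp add: X_def)
  have eq: "f x = ennreal (mu_kernel_on j s x)" if "x \<notin> X" for x
  proof -
    have x: "x \<noteq> 0" and D: "pair_disc s x \<noteq> 0" using that disc_sign(2)[of x s] s by (auto simp: X_def)
    show ?thesis
    proof (cases "j = pair_index x \<and> pair_disc s x > 0")
      case True
      then show ?thesis
        using Gam_real_iff[OF x s j] mu_dens_eq[OF x s] x s by (auto simp: f_def mu_kernel_on_def)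
    next
      case False
      then show ?thesis using Gam_real_iff[OF x s j] D by (auto simp: f_def mu_kernel_on_def)
    qed
  qed
  have g: "(\<lambda>x. ennreal (mu_kernel_on j s x)) \<in> borel_measurable lborel" by measurable
  have f: "f \<in> borel_measurable lborel"
    by (rule measurable_discrete_difference[OF g, of X]) (use fin eq in \<open>auto simp: countable_finite\<close>)
  have "AE x in lborel. x \<notin> X"
    using finite_imp_null_set_lborel[OF fin] by (rule AE_not_in)
  then have "AE x in lborel. f x = ennreal (mu_kernel_on j s x)"
    by eventually_elim (rule eq)
  then show ?thesis unfolding mu_def f_def[symmetric] by (rule density_cong[OF f g])
qed

section \<open>Averaging over \<open>s\<close> and the supports\<close>

definition pair_im_pos :: "real \<Rightarrow> real \<Rightarrow> real" where
  "pair_im_pos s x = sqrt (max 0 (pair_disc s x))"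

text \<open>The density before division by \<open>\<xi>\<close>: the increment from 0 to
  \<open>\<xi>\<close> of the primitive of \<open>mu_kernel\<close>. The clipping in
  \<open>pair_im_pos\<close> removes the parameters with a real pair.\<close>

definition nu_dens :: "nat \<Rightarrow> real \<Rightarrow> real \<Rightarrow> real" where
  "nu_dens j \<xi> x = (if x \<noteq> 0 \<and> j = pair_index x then (pair_im_pos \<xi> x - pair_im_pos 0 x) / (pi * \<bar>x\<bar>) else 0)"

lemma nu_dens_nonneg: "\<xi> > 0 \<Longrightarrow> nu_dens j \<xi> x \<ge> 0"
  using pair_disc_less[of x 0 \<xi>] by (auto simp: nu_dens_def pair_im_pos_def intro!: divide_nonneg_nonneg)

text \<open>The exact derivative behind the averaging; the factor \<open>\<bar>x\<bar>\<close>
  cancels because \<open>x * pair_shift s x\<close> is positive.\<close>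

lemma pair_im_deriv:
  assumes x: "x \<noteq> 0" and s: "s > 0" and D: "pair_disc s x > 0"
  shows "((\<lambda>s. sqrt (pair_disc s x) / (pi * \<bar>x\<bar>)) has_real_derivative mu_kernel s x) (at s)"
proof -
  define E where "E = (pair_shift s x)\<^sup>2 + pair_disc s x"
  have E: "E > 0" using pair_shift_pair_disc_pos[OF x, of s] s by (simp add: E_def)
  have "((\<lambda>s. sqrt (pair_disc s x)) has_real_derivative (inverse (sqrt (pair_disc s x)) / 2 * (x * pair_shift s x / E))) (at s)"
    using DERIV_chain2[OF DERIV_real_sqrt[OF D] pair_disc_deriv[OF x s]] by (simp add: E_def)
  from DERIV_cdivide[OF this, of "pi * \<bar>x\<bar>"]
  have "((\<lambda>s. sqrt (pair_disc s x) / (pi * \<bar>x\<bar>)) has_real_derivative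
     (inverse (sqrt (pair_disc s x)) / 2 * (x * pair_shift s x / E) / (pi * \<bar>x\<bar>))) (at s)" .
  moreover have "x * pair_shift s x = \<bar>x\<bar> * \<bar>pair_shift s x\<bar>"
    using pair_shift_sgn[OF x, of s] s by (simp add: abs_mult[symmetric])
  ultimately show ?thesis
    unfolding mu_kernel_def E_def[symmetric] using x E D by (simp add: field_simps)
qed

lemma mu_kernel_on_integral:
  assumes \<xi>: "\<xi> > 0"
  shows "(\<integral>\<^sup>+ s. ennreal (mu_kernel_on j s x) * indicator {0<..<\<xi>} s \<partial>lborel) = ennreal (nu_dens j \<xi> x)"
proof (cases "x \<noteq> 0 \<and> j = pair_index x \<and> pair_disc \<xi> x > 0")
  case False
  have "mu_kernel_on j s x = 0" if "s \<in> {0<..<\<xi>}" for s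
    using False pair_disc_less[of x s \<xi>] that by (auto simp: mu_kernel_on_def)
  then have "(\<integral>\<^sup>+ s. ennreal (mu_kernel_on j s x) * indicator {0<..<\<xi>} s \<partial>lborel) = (\<integral>\<^sup>+ s. 0 \<partial>(lborel :: real measure))"
    by (intro nn_integral_cong) (auto simp: indicator_def)
  moreover have "nu_dens j \<xi> x = 0" using False pair_disc_less[of x 0 \<xi>] \<xi> by (auto simp: nu_dens_def pair_im_pos_def)
  ultimately show ?thesis by simp
next
  case True
  then have x: "x \<noteq> 0" and j: "j = pair_index x" and D: "pair_disc \<xi> x > 0" by auto
  \<comment> \<open>From \<open>s1\<close> on the pair is nonreal; \<open>s1 = 0\<close> if it is so
    from the start. If \<open>pair_disc s1 x = 0\<close> the kernel is unbounded at
    \<open>s1\<close>, so it is integrated over the open interval by a primitive that is continuous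
    up to the ends.\<close>
  obtain s1 where s1: "0 \<le> s1" "s1 < \<xi>" "pair_disc s1 x \<ge> 0" "s1 > 0 \<Longrightarrow> pair_disc s1 x = 0" "s1 > 0 \<Longrightarrow> pair_disc 0 x \<le> 0"
  proof (cases "pair_disc 0 x \<ge> 0")
    case True
    then show ?thesis using \<xi> that[of 0] by simp
  next
    case False
    then have "\<exists>t\<ge>0. t \<le> \<xi> \<and> pair_disc t x = 0"
      using \<xi> D by (intro IVT' continuous_on_subset[OF pair_disc_continuous[OF x]]) auto
    then obtain t where "0 \<le> t" "t \<le> \<xi>" "pair_disc t x = 0" by blast
    then show ?thesis using False D that[of t] by (cases "t = \<xi>") auto
  qed
  have Dp: "pair_disc s x > 0" if "s > s1" for s using pair_disc_less[OF x s1(1) that] s1(3) by simp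
  have Dn: "\<not> pair_disc s x > 0" if "0 < s" "s \<le> s1" for s
    using pair_disc_less[OF x, of s s1] s1(4) that by (cases "s = s1") auto
  define G where "G = (\<lambda>s. sqrt (pair_disc s x) / (pi * \<bar>x\<bar>))"
  have Gc: "continuous_on {s1..\<xi>} G"
    unfolding G_def using x by (intro continuous_intros continuous_on_subset[OF pair_disc_continuous[OF x]]) (use s1 in auto)
  have kc: "isCont (\<lambda>s. mu_kernel s x) s" if "s > s1" for s
  proof -
    have s0: "s > 0" using that s1 by simp
    have c: "isCont (\<lambda>s. v_real s x) s" "isCont (\<lambda>s. pair_disc s x) s"
      using DERIV_isCont[OF v_real_deriv[OF x s0]] DERIV_isCont[OF pair_disc_deriv[OF x s0]] by auto
    show ?thesis
      unfolding mu_kernel_def pair_shift_def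
      using c Dp[OF that] pair_shift_pair_disc_pos[OF x, of s] s0
      by (intro continuous_intros) (auto simp: pair_shift_def)
  qed
  have lim: "((G \<circ> real_of_ereal) \<longlongrightarrow> G s1) (at_right (ereal s1))" "((G \<circ> real_of_ereal) \<longlongrightarrow> G \<xi>) (at_left (ereal \<xi>))"
    unfolding ereal_tendsto_simps
    using continuous_on_Icc_at_rightD[OF Gc s1(2)] continuous_on_Icc_at_leftD[OF Gc s1(2)] by auto
  have der: "\<And>s. ereal s1 < ereal s \<Longrightarrow> ereal s < ereal \<xi> \<Longrightarrow> DERIV G s :> mu_kernel s x"
    unfolding G_def using pair_im_deriv[OF x _ Dp] s1 by auto
  have nn: "mu_kernel s x \<ge> 0" if "s > s1" for s
    using mu_kernel_on_nonneg[of j s x] Dp[OF that] x j that s1 by (simp add: mu_kernel_on_def)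
  have I: "set_integrable lborel {s1<..<\<xi>} (\<lambda>s. mu_kernel s x)" "(LINT s:{s1<..<\<xi>}|lborel. mu_kernel s x) = G \<xi> - G s1"
    using interval_integral_FTC_nonneg(1)[of "ereal s1" "ereal \<xi>" G "\<lambda>s. mu_kernel s x", OF _ der kc _ lim]
      interval_integral_FTC_nonneg(2)[of "ereal s1" "ereal \<xi>" G "\<lambda>s. mu_kernel s x", OF _ der kc _ lim] s1 nn
    by (auto simp: interval_lebesgue_integral_le_eq)
  have "(\<integral>\<^sup>+ s. ennreal (mu_kernel_on j s x) * indicator {0<..<\<xi>} s \<partial>lborel)
      = (\<integral>\<^sup>+ s. ennreal (indicator {s1<..<\<xi>} s *\<^sub>R mu_kernel s x) \<partial>lborel)"
  proof (intro nn_integral_cong)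
    fix s
    show "ennreal (mu_kernel_on j s x) * indicator {0<..<\<xi>} s = ennreal (indicator {s1<..<\<xi>} s *\<^sub>R mu_kernel s x)"
    proof (cases "s > s1")
      case True
      then show ?thesis using x j Dp[OF True] s1(1) by (auto simp: mu_kernel_on_def indicator_def)
    next
      case False
      then show ?thesis using Dn[of s] by (cases "s > 0") (auto simp: mu_kernel_on_def)
    qed
  qed
  also have "\<dots> = ennreal (LINT s:{s1<..<\<xi>}|lborel. mu_kernel s x)"
    unfolding set_lebesgue_integral_def
    using I(1) nn unfolding set_integrable_def by (intro nn_integral_eq_integral) (auto simp: indicator_def)
  finally have "(\<integral>\<^sup>+ s. ennreal (mu_kernel_on j s x) * indicator {0<..<\<xi>} s \<partial>lborel) = ennreal (G \<xi> - G s1)"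
    unfolding I(2) .
  also have "G \<xi> - G s1 = nu_dens j \<xi> x"
  proof -
    have "sqrt (pair_disc s1 x) = pair_im_pos 0 x"
      using s1 by (cases "s1 = 0") (auto simp: pair_im_pos_def)
    then show ?thesis using x j D by (simp add: G_def nu_dens_def pair_im_pos_def diff_divide_distrib)
  qed
  finally show ?thesis .
qed

lemma nu_dens_measurable [measurable]:
  assumes \<xi>: "\<xi> > 0"
  shows "nu_dens j \<xi> \<in> borel_measurable borel"
proof -
  have 1: "(\<lambda>x. \<integral>\<^sup>+ s. ennreal (mu_kernel_on j s x) * indicator {0<..<\<xi>} s \<partial>lborel) \<in> borel_measurable borel"
    by measurable
  have "nu_dens j \<xi> = (\<lambda>x. enn2real (\<integral>\<^sup>+ s. ennreal (mu_kernel_on j s x) * indicator {0<..<\<xi>} s \<partial>lborel))"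
    unfolding mu_kernel_on_integral[OF \<xi>] using nu_dens_nonneg[OF \<xi>] by simp
  also have "\<dots> \<in> borel_measurable borel" using 1 by measurable
  finally show ?thesis .
qed

text \<open>Tonelli exchanges the integrals, so that for each fixed \<open>x\<close> the kernel is
  integrated over \<open>s\<close> in closed form.\<close>

lemma nu_eq:
  assumes \<xi>: "\<xi> > 0" and j: "j \<in> {1, 2}"
  shows "nu p q j \<xi> = density lborel (\<lambda>x. ennreal (nu_dens j \<xi> x / \<xi>))"
proof -
  note [measurable] = nu_dens_measurable[OF \<xi>]
  have eq: "ennreal (1 / \<xi>) * (\<integral>\<^sup>+ s \<in> {0<..<\<xi>}. emeasure (mu p q j s) B \<partial>lborel)
      = emeasure (density lborel (\<lambda>x. ennreal (nu_dens j \<xi> x / \<xi>))) B" if B [measurable]: "B \<in> sets borel" for B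
  proof -
    have "(\<integral>\<^sup>+ s \<in> {0<..<\<xi>}. emeasure (mu p q j s) B \<partial>lborel)
      = (\<integral>\<^sup>+ s. (\<integral>\<^sup>+ x. ennreal (mu_kernel_on j s x) * indicator {0<..<\<xi>} s * indicator B x \<partial>lborel) \<partial>lborel)"
    proof (intro nn_integral_cong)
      fix s :: real
      show "emeasure (mu p q j s) B * indicator {0<..<\<xi>} s
        = (\<integral>\<^sup>+ x. ennreal (mu_kernel_on j s x) * indicator {0<..<\<xi>} s * indicator B x \<partial>lborel)"
        using mu_eq[OF _ j, of s] B
        by (cases "s \<in> {0<..<\<xi>}") (auto simp: emeasure_density)
    qed
    also have "\<dots> = (\<integral>\<^sup>+ x. (\<integral>\<^sup>+ s. ennreal (mu_kernel_on j s x) * indicator {0<..<\<xi>} s * indicator B x \<partial>lborel) \<partial>lborel)"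
      by (rule lborel_pair.Fubini'[symmetric]) measurable
    also have "\<dots> = (\<integral>\<^sup>+ x. ennreal (nu_dens j \<xi> x) * indicator B x \<partial>lborel)"
      by (simp add: nn_integral_multc mu_kernel_on_integral[OF \<xi>])
    finally have "ennreal (1 / \<xi>) * (\<integral>\<^sup>+ s \<in> {0<..<\<xi>}. emeasure (mu p q j s) B \<partial>lborel)
      = (\<integral>\<^sup>+ x. ennreal (1 / \<xi>) * (ennreal (nu_dens j \<xi> x) * indicator B x) \<partial>lborel)"
      by (simp add: nn_integral_cmult)
    also have "\<dots> = (\<integral>\<^sup>+ x. ennreal (nu_dens j \<xi> x / \<xi>) * indicator B x \<partial>lborel)"
      using \<xi> nu_dens_nonneg[OF \<xi>] by (intro nn_integral_cong) (simp add: mult.assoc[symmetric] ennreal_mult[symmetric])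
    finally show ?thesis by (simp add: emeasure_density)
  qed
  define M where "M = density lborel (\<lambda>x. ennreal (nu_dens j \<xi> x / \<xi>))"
  have "nu p q j \<xi> = measure_of UNIV (sets borel) (emeasure M)"
    unfolding nu_def
  proof (rule measure_of_eq)
    fix B :: "real set" assume "B \<in> sigma_sets UNIV (sets borel)"
    then have "B \<in> sets borel" by (metis sets.sigma_sets_eq space_borel)
    then show "ennreal (1 / \<xi>) * (\<integral>\<^sup>+ s \<in> {0<..<\<xi>}. emeasure (mu p q j s) B \<partial>lborel) = emeasure M B"
      unfolding M_def by (rule eq)
  qed simp
  also have "\<dots> = M"
    using measure_of_of_measure[of M] by (simp add: M_def)
  finally show ?thesis by (simp add: M_def)
qed

text \<open>The density vanishes on an open set described by the sign of the polynomial
  \<open>disc\<close>; no point of it belongs to the support.\<close>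

lemma supp_nu_subset:
  assumes \<xi>: "\<xi> > 0" and j: "j \<in> {1, 2}" and x: "x \<in> supp (nu p q j \<xi>)"
  shows "x \<noteq> 0" "j = pair_index x" "pair_disc \<xi> x \<ge> 0"
proof -
  note [measurable] = nu_dens_measurable[OF \<xi>]
  define U where "U = {x. (if j = 1 then x < 0 else x > 0) \<or> disc \<xi> x > 0}"
  have "open U" unfolding U_def
    by (cases "j = 1") (auto intro!: open_Collect_disj open_Collect_less continuous_intros)
  have z: "nu_dens j \<xi> y = 0" if "y \<in> U" for y
  proof (cases "y \<noteq> 0 \<and> j = pair_index y")
    case True
    then have "disc \<xi> y > 0" using that j by (auto simp: U_def pair_index_def split: if_splits)
    then have "pair_disc \<xi> y < 0" using disc_sign(3)[of y \<xi>] True \<xi> by auto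
    then show ?thesis using pair_disc_less[of y 0 \<xi>] True \<xi> by (simp add: nu_dens_def pair_im_pos_def)
  qed (auto simp: nu_dens_def)
  have [measurable]: "U \<in> sets borel" using \<open>open U\<close> by simp
  have "emeasure (nu p q j \<xi>) U = (\<integral>\<^sup>+ y. ennreal (nu_dens j \<xi> y / \<xi>) * indicator U y \<partial>lborel)"
    unfolding nu_eq[OF \<xi> j] by (simp add: emeasure_density)
  also have "\<dots> = (\<integral>\<^sup>+ y. 0 \<partial>(lborel :: real measure))"
    using z by (intro nn_integral_cong) (auto simp: indicator_def)
  finally have "x \<notin> U" using x \<open>open U\<close> by (auto simp: supp_def)
  then have 1: "j = 1 \<Longrightarrow> x \<ge> 0" "j = 2 \<Longrightarrow> x \<le> 0" "disc \<xi> x \<le> 0" by (auto simp: U_def)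
  have "p * q * (p + q) > 0" using p_pos q_pos by simp
  then show x0: "x \<noteq> 0" using 1(3) by (auto simp: disc_zero)
  show "j = pair_index x" using 1 x0 j by (auto simp: pair_index_def)
  show "pair_disc \<xi> x \<ge> 0" using disc_sign(3)[OF x0] 1(3) \<xi> by simp
qed

text \<open>A point with nonzero density has an open neighbourhood of positive density, and nonempty
  open sets are not Lebesgue null.\<close>

lemma nu_dens_zero_outside_supp:
  assumes \<xi>: "\<xi> > 0" and j: "j \<in> {1, 2}" and x: "x \<notin> supp (nu p q j \<xi>)"
  shows "nu_dens j \<xi> x = 0"
proof (rule ccontr)
  note [measurable] = nu_dens_measurable[OF \<xi>]
  assume nz: "nu_dens j \<xi> x \<noteq> 0"
  obtain V where V: "open V" "x \<in> V" "emeasure (nu p q j \<xi>) V = 0"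
    using x by (auto simp: supp_def not_gr_zero)
  define U where "U = {x. (if j = 1 then x > 0 else x < 0)} \<inter> {x. x \<noteq> 0 \<and> disc \<xi> x < 0}"
  have "open U" unfolding U_def
    by (cases "j = 1") (auto intro!: open_Int open_oval open_Collect_less continuous_intros)
  have pos: "nu_dens j \<xi> y > 0" if "y \<in> U" for y
  proof -
    have y: "y \<noteq> 0" "j = pair_index y" using that j by (auto simp: U_def pair_index_def split: if_splits)
    have "pair_disc \<xi> y > 0" using that disc_sign(1)[OF y(1)] \<xi> by (auto simp: U_def)
    then have "pair_im_pos \<xi> y > pair_im_pos 0 y" using pair_disc_less[OF y(1), of 0 \<xi>] \<xi> by (auto simp: pair_im_pos_def max_def)
    then show ?thesis using y by (simp add: nu_dens_def)
  qed
  have x0: "x \<noteq> 0" "j = pair_index x" using nz by (auto simp: nu_dens_def split: if_splits)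
  have "pair_disc \<xi> x > 0"
  proof (rule ccontr)
    assume "\<not> pair_disc \<xi> x > 0"
    then have "pair_im_pos \<xi> x = 0" "pair_im_pos 0 x = 0" using pair_disc_less[OF x0(1), of 0 \<xi>] \<xi> by (auto simp: pair_im_pos_def)
    then show False using nz by (simp add: nu_dens_def split: if_splits)
  qed
  then have "x \<in> U" using x0 disc_sign(1)[OF x0(1)] \<xi> by (auto simp: U_def pair_index_def split: if_splits)
  have [measurable]: "V \<in> sets borel" using V by simp
  have "(\<integral>\<^sup>+ y. ennreal (nu_dens j \<xi> y / \<xi>) * indicator V y \<partial>lborel) = 0"
    using V(3) unfolding nu_eq[OF \<xi> j] by (simp add: emeasure_density)
  then have "AE y in lborel. ennreal (nu_dens j \<xi> y / \<xi>) * indicator V y = 0"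
    by (subst (asm) nn_integral_0_iff_AE) auto
  then have "AE y in lborel. y \<notin> V \<inter> U"
  proof eventually_elim
    case (elim y)
    then show ?case using pos[of y] \<xi> by (auto simp: indicator_def)
  qed
  then have "V \<inter> U \<in> null_sets lborel"
    using V(1) \<open>open U\<close> by (subst AE_iff_null_sets) auto
  then have "negligible (V \<inter> U)"
    by (simp add: negligible_iff_null_sets null_sets_completionI)
  then show False
    using open_not_negligible[of "V \<inter> U"] V \<open>open U\<close> \<open>x \<in> U\<close> by auto
qed

text \<open>The quotient is \<open>1 / z_minus - 1 / z_plus\<close>. Its denominator
  \<open>h s\<close> cancels against the constant in front, leaving the difference of the two
  conjugate \<open>w\<close>.\<close>

lemma boundary_difference:
  assumes x: "x \<noteq> 0" and s: "s > 0" and D: "pair_disc s x \<ge> 0"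
  shows "complex_of_real (s * (s + p) * (s + p + q)) / (2 * of_real pi * \<i>) *
      (z_plus p q (pair_index x) x s - z_minus p q (pair_index x) x s)
        / (z_plus p q (pair_index x) x s * z_minus p q (pair_index x) x s) = of_real (sgn x * pair_im s x / pi)"
proof -
  define H where "H = complex_of_real (h s)"
  define A B where "A = Complex (pair_mid s x) (- sgn x * pair_im s x)" and "B = Complex (pair_mid s x) (sgn x * pair_im s x)"
  have H: "H \<noteq> 0" using h_pos[OF s] by (simp add: H_def)
  have nz: "A \<noteq> 0" "B \<noteq> 0"
  proof -
    have "sgn x = 1 \<or> sgn x = -1" using x by (simp add: sgn_if)
    then have "A = 0 \<or> B = 0 \<Longrightarrow> pair_mid s x = 0 \<and> pair_im s x = 0" by (auto simp: A_def B_def complex_eq_iff)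
    then show "A \<noteq> 0" "B \<noteq> 0" using pair_mid_pair_disc_pos[OF x s] D by (auto simp: pair_im_def)
  qed
  have hs: "s * (s + p) * (s + p + q) = h s" by (simp add: h_def)
  have "H / (2 * of_real pi * \<i>) * (H / A - H / B) / (H / A * (H / B)) = (B - A) / (2 * of_real pi * \<i>)"
    using H nz by (simp add: field_simps)
  also have "B - A = 2 * \<i> * of_real (sgn x * pair_im s x)"
    by (simp add: A_def B_def complex_eq_iff)
  also have "2 * \<i> * of_real (sgn x * pair_im s x) / (2 * of_real pi * \<i>) = complex_of_real (sgn x * pair_im s x / pi)"
    by (simp add: field_simps)
  finally show ?thesis
    unfolding hs z_pm_eq[OF x s D] A_def[symmetric] B_def[symmetric] H_def[symmetric] .
qed

text \<open>The formula is required at every point of the support, including endpoints, hence on all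
  of \<open>pair_disc \<xi> x \<ge> 0\<close> and not only almost everywhere.\<close>

lemma nu_density:
  assumes \<xi>: "\<xi> > 0" and j: "j \<in> {1, 2}"
    and f: "\<And>x. x \<noteq> 0 \<Longrightarrow> j = pair_index x \<Longrightarrow> pair_disc \<xi> x \<ge> 0 \<Longrightarrow> of_real (nu_dens j \<xi> x / \<xi>) = f x"
  shows "has_density_on_supp (nu p q j \<xi>) f"
  unfolding has_density_on_supp_def
proof (rule bexI[of _ "\<lambda>x. nu_dens j \<xi> x / \<xi>"], intro conjI allI ballI impI)
  note [measurable] = nu_dens_measurable[OF \<xi>]
  show "(\<lambda>x. nu_dens j \<xi> x / \<xi>) \<in> borel_measurable borel" by measurable
  show "0 \<le> nu_dens j \<xi> x / \<xi>" for x using nu_dens_nonneg[OF \<xi>] \<xi> by simp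
  show "nu p q j \<xi> = density lborel (\<lambda>x. ennreal (nu_dens j \<xi> x / \<xi>))" by (rule nu_eq[OF \<xi> j])
  show "complex_of_real (nu_dens j \<xi> x / \<xi>) = f x" if "x \<in> supp (nu p q j \<xi>)" for x
    using supp_nu_subset[OF \<xi> j that] by (intro f)
  show "nu_dens j \<xi> x / \<xi> = 0" if "x \<notin> supp (nu p q j \<xi>)" for x
    using nu_dens_zero_outside_supp[OF \<xi> j that] by simp
qed

lemma nu1_density:
  assumes \<xi>: "\<xi> > 0"
  shows "has_density_on_supp (nu p q 1 \<xi>)
            (\<lambda>x. 1 / of_real (\<xi> * x) *
              (complex_of_real (\<xi> * (\<xi> + p) * (\<xi> + p + q)) / (2 * of_real pi * \<i>) * (z_plus p q 1 x \<xi> - z_minus p q 1 x \<xi>)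
                 / (z_plus p q 1 x \<xi> * z_minus p q 1 x \<xi>)))"
proof (rule nu_density[OF \<xi>])
  fix x :: real assume x: "x \<noteq> 0" "1 = pair_index x" "pair_disc \<xi> x \<ge> 0"
  have x0: "x > 0" using x(1,2) by (auto simp: pair_index_def split: if_splits)
  \<comment> \<open>The pair is real at \<open>s = 0\<close> for every \<open>x > 0\<close>, so the
    lower limit contributes nothing.\<close>
  have "pair_disc 0 x \<le> 0" using pair_disc_zero(2)[OF x0] by simp
  then have "nu_dens 1 \<xi> x = pair_im \<xi> x / (pi * x)" using x x0 by (simp add: nu_dens_def pair_im_pos_def pair_im_def)
  then show "of_real (nu_dens 1 \<xi> x / \<xi>) = 1 / of_real (\<xi> * x) *
              (complex_of_real (\<xi> * (\<xi> + p) * (\<xi> + p + q)) / (2 * of_real pi * \<i>) * (z_plus p q 1 x \<xi> - z_minus p q 1 x \<xi>)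
                 / (z_plus p q 1 x \<xi> * z_minus p q 1 x \<xi>))"
    unfolding boundary_difference[OF x(1) \<xi> x(3), folded x(2)] using x0 by simp
qed simp

lemma nu2_density:
  assumes \<xi>: "\<xi> > 0"
  defines "c \<equiv> complex_of_real (\<xi> * (\<xi> + p) * (\<xi> + p + q)) / (2 * of_real pi * \<i>)"
  shows "has_density_on_supp (nu p q 2 \<xi>)
            (\<lambda>x. 1 / of_real \<xi> *
              (if - (q^2) / 4 < x
               then c * (z_plus p q 2 x \<xi> - z_minus p q 2 x \<xi>)
                      / (z_plus p q 2 x \<xi> * z_minus p q 2 x \<xi> * of_real x)
               else c * (z_plus p q 2 x \<xi> - z_minus p q 2 x \<xi>)
                      / (z_plus p q 2 x \<xi> * z_minus p q 2 x \<xi> * of_real x)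
                    + of_real (sqrt \<bar>q^2 + 4 * x\<bar> / (2 * pi * x))))"
proof (rule nu_density[OF \<xi>])
  fix x :: real assume x: "x \<noteq> 0" "2 = pair_index x" "pair_disc \<xi> x \<ge> 0"
  have x0: "x < 0" using x(1,2) by (auto simp: pair_index_def split: if_splits)
  have D0: "pair_disc 0 x = - (q^2 + 4 * x) / 4" by (rule pair_disc_zero(1)[OF x0])
  have b: "c * (z_plus p q 2 x \<xi> - z_minus p q 2 x \<xi>) / (z_plus p q 2 x \<xi> * z_minus p q 2 x \<xi> * of_real x)
      = of_real (- pair_im \<xi> x / (pi * x))"
    using boundary_difference[OF x(1) \<xi> x(3), folded x(2), folded c_def] x0
    by (simp add: divide_divide_eq_left[symmetric] del: divide_divide_eq_left)
  show "of_real (nu_dens 2 \<xi> x / \<xi>) = 1 / of_real \<xi> *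
              (if - (q^2) / 4 < x
               then c * (z_plus p q 2 x \<xi> - z_minus p q 2 x \<xi>)
                      / (z_plus p q 2 x \<xi> * z_minus p q 2 x \<xi> * of_real x)
               else c * (z_plus p q 2 x \<xi> - z_minus p q 2 x \<xi>)
                      / (z_plus p q 2 x \<xi> * z_minus p q 2 x \<xi> * of_real x)
                    + of_real (sqrt \<bar>q^2 + 4 * x\<bar> / (2 * pi * x)))"
  proof (cases "- (q^2) / 4 < x")
    case True
    then have "pair_disc 0 x \<le> 0" by (simp add: D0)
    then have "nu_dens 2 \<xi> x = - pair_im \<xi> x / (pi * x)" using x x0 by (simp add: nu_dens_def pair_im_pos_def pair_im_def)
    then show ?thesis using True unfolding b by simp
  next
    case False
    then have n: "q^2 + 4 * x \<le> 0" by simp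
    \<comment> \<open>Here the pair is nonreal (or double) already at \<open>s = 0\<close>; this
      lower boundary value is the extra square root term.\<close>
    have "pair_im_pos 0 x = sqrt \<bar>q^2 + 4 * x\<bar> / 2"
    proof -
      have "max 0 (pair_disc 0 x) = \<bar>q^2 + 4 * x\<bar> / 4" unfolding D0 using n by simp
      then show ?thesis by (simp only: pair_im_pos_def real_sqrt_divide) simp
    qed
    then have "nu_dens 2 \<xi> x = - pair_im \<xi> x / (pi * x) + sqrt \<bar>q^2 + 4 * x\<bar> / (2 * pi * x)"
      using x x0 by (simp add: nu_dens_def pair_im_pos_def[of \<xi>] pair_im_def field_simps)
    then show ?thesis using False unfolding b by (simp add: add_divide_distrib)
  qed
qed simp

end

(* The normalising factors 1 / (xi * x) and 1 / xi in front of the two density formulas are needed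
   for nu, which is defined as an average over (0, xi): without them the identities fail (already
   under the scaling p, q, xi -> t p, t q, t xi and x -> t^2 x). *)

theorem theorem2p5:
  fixes p q :: real
  assumes "p > 0" and "q > 0"
  shows
    "(\<forall>x::real. x > 0 \<longrightarrow>
        set_integrable lborel {0<..} (V_integrand p q 1 (of_real x)) \<and>
        V_field p q 1 (of_real x) =
          sqrt (q^2 + 4 * x) - p * ln (4 * x) - q * ln (sqrt (q^2 + 4 * x) + q) - 2 * p - q
            + p * ln (4 * p^2 + 4 * p * q) + q * ln (2 * p + 2 * q)) \<and>
     (\<forall>x::real. x < 0 \<longrightarrow>
        set_integrable lborel {0<..} (V_integrand p q 2 (of_real x)) \<and>
        V_field p q 2 (of_real x) =
          (if x < - (q^2) / 4 then 0
           else - 2 * sqrt (q^2 + 4 * x)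
                  + q * ln ((q + sqrt (q^2 + 4 * x)) / (q - sqrt (q^2 + 4 * x))))) \<and>
     (\<forall>\<xi>::real. \<xi> > 0 \<longrightarrow>
        (let c = complex_of_real (\<xi> * (\<xi> + p) * (\<xi> + p + q)) / (2 * of_real pi * \<i>) in
          has_density_on_supp (nu p q 1 \<xi>)
            (\<lambda>x. 1 / of_real (\<xi> * x) *
              (c * (z_plus p q 1 x \<xi> - z_minus p q 1 x \<xi>)
                 / (z_plus p q 1 x \<xi> * z_minus p q 1 x \<xi>))) \<and>
          has_density_on_supp (nu p q 2 \<xi>)
            (\<lambda>x. 1 / of_real \<xi> *
              (if - (q^2) / 4 < x
               then c * (z_plus p q 2 x \<xi> - z_minus p q 2 x \<xi>)
                      / (z_plus p q 2 x \<xi> * z_minus p q 2 x \<xi> * of_real x)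
               else c * (z_plus p q 2 x \<xi> - z_minus p q 2 x \<xi>)
                      / (z_plus p q 2 x \<xi> * z_minus p q 2 x \<xi> * of_real x)
                    + of_real (sqrt \<bar>q^2 + 4 * x\<bar> / (2 * pi * x))))))"
proof -
  interpret symbol_params p q
    using assms by unfold_locales
  show ?thesis
    unfolding Let_def
    by (intro conjI allI impI V1_value V2_value nu1_density nu2_density) assumption+
qed

end
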